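(* Let $L\supseteq L_{\mathsf{dist}}$ be a countable first-order language and let $\mathcal X$ be a separable complete metric $L$-structure with the extension property and the Hrushovski property. Let $\mathcal B$ be a basis for $\mathsf{Aut}(\mathcal X)$ and suppose that for all $\overline a\in\mathcal B$ and all $\epsilon>0$ the set $$\big\{(g,f)\in N(\overline a,\epsilon)\times \mathsf{Aut}(\mathcal X)\;\big|\; \mathcal O(\overline a/g\overline a)\cap \mathcal O(f\overline a/\overline a)\neq\emptyset\big\}$$ has non-empty interior. Then $\mathsf{Aut}(\mathcal X)$ has the automatic continuity property, i.e., every group homomorphism from $\mathsf{Aut}(\mathcal X)$ into any Polish group is continuous.
   Context: Metric structures. $L_{\mathsf{dist}}=\{D_r\mid r\in\mathbb Q\cap[0,\infty)\}$, each $D_r$ a binary relation symbol. For a first-order language $L\supseteq L_{\mathsf{dist}}$, a metric $L$-structure is an $L$-structure $\mathcal X$ with universe $X$ such that (i) there is a metric $d$ on $X$ with $\mathcal X\models D_r(x,y)\Leftrightarrow d(x,y)\leqslant r$ for all $r$ (this $d$ is then determined by $\mathcal X$); (ii) the interpretation of each $k$-ary function symbol is a continuous map $X^k\to X$; (iii) the interpretation of each $k$-ary relation symbol is a closed subset of $X^k$. It is separable (complete) if $(X,d)$ is separable (complete). Hrushovski property. A first-order structure $\mathcal X$ has the Hrushovski property if for any finite collection $\{\phi_i\}_{i\in I}$ of isomorphisms $\phi_i:\mathcal A_i\to\mathcal B_i$ between finitely generated substructures of $\mathcal X$ there are a finitely generated substructure $\mathcal D\subseteq\mathcal X$ containing all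 the $\mathcal A_i$ and automorphisms $f_i\in\mathsf{Aut}(\mathcal X)$ such that each $f_i$ extends $\phi_i$ and leaves $\mathcal D$ invariant. Extension property. For substructures $\mathcal A\subseteq\mathcal B\cap\mathcal C$ of $\mathcal X$, let $\mathcal D$ be the substructure generated by $\mathcal B\cup\mathcal C$. We say $\mathcal B$ is independent from $\mathcal C$ over $\mathcal A$ if whenever $\phi$ and $\psi$ are automorphisms of $\mathcal B$ and $\mathcal C$, respectively, both leaving $\mathcal A$ invariant and with $\phi|_{\mathcal A}=\psi|_{\mathcal A}$, there is an automorphism of $\mathcal D$ extending both $\phi$ and $\psi$. $\mathcal X$ has the extension property if for all finitely generated substructures $\mathcal A,\mathcal B,\mathcal C$ of $\mathcal X$ with $\mathcal A\subseteq\mathcal B\cap\mathcal C$ there is $g\in\mathsf{Aut}(\mathcal X)$ with $g|_{\mathcal A}=\mathrm{id}_{\mathcal A}$ such that $\mathcal B$ is independent from $g[\mathcal C]$ over $\mathcal A$. Topology and notation. For a separable complete metric $L$-structure $\mathcal X$, the group $\mathsf{Aut}(\mathcal X)$ carries the topology of pointwise convergence on $(X,d)$, which makes it a Polish group (a closed subgroup of $\mathsf{Isom}(X,d)$). Products carry the product topology. For finite tuples, $d_\infty(\overline a,\overline b)=\max_i d(a_i,b_i)$ and automorphisms act coordinatewise. For a finite tuple $\overline a$ in $X$ and $\epsilon>0$: $\mathsf{Aut}(\mathcal X,\overline a)=\{g\in\mathsf{Aut}(\mathcal X)\mid g\overline a=\overline a\}$; $N(\overline a,\epsilon)=\{g\in\mathsf{Aut}(\mathcal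 X)\mid d_\infty(g\overline a,\overline a)<\epsilon\}$; $\mathcal O(\overline b/\overline a)=\mathsf{Aut}(\mathcal X,\overline a)\cdot\overline b=\{g\overline b\mid g\in \mathsf{Aut}(\mathcal X,\overline a)\}$. A family $\mathcal B\subseteq\bigcup_{k\geqslant1}X^k$ is a basis for $\mathsf{Aut}(\mathcal X)$ if for all finite tuples $\overline a$ and $\epsilon>0$ there are $\overline b\in\mathcal B$ and $\eta>0$ such that $\mathsf{Aut}(\mathcal X,\overline b)\subseteq\mathsf{Aut}(\mathcal X,\overline a)$ and $N(\overline b,\eta)\subseteq N(\overline a,\epsilon)$. A Polish group is a topological group whose topology is separable and completely metrisable. *)

theory Defs
  imports "HOL-Analysis.Analysis" "HOL-Algebra.Bij" "HOL-Library.NList"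
begin

section \<open>First-order languages and structures\<close>

text \<open>
  A \<open>k\<close>-tuple over \<open>X\<close> is a list in \<^term>\<open>nlists k X\<close>. The field \<open>dist_sym\<close> names the
  symbols \<open>D\<^sub>r\<close>; only its values at \<open>r \<ge> 0\<close> matter.
\<close>

record ('f, 'r) fo_language =
  fun_syms :: "'f set"
  rel_syms :: "'r set"
  fun_arity :: "'f \<Rightarrow> nat"
  rel_arity :: "'r \<Rightarrow> nat"
  dist_sym :: "rat \<Rightarrow> 'r"

definition contains_dist :: "('f, 'r) fo_language \<Rightarrow> bool" where
  "contains_dist L \<longleftrightarrow>
     (\<forall>r\<ge>0. dist_sym L r \<in> rel_syms L \<and> rel_arity L (dist_sym L r) = 2) \<and>
     inj_on (dist_sym L) {0..}"

definition countable_language :: "('f, 'r) fo_language \<Rightarrow> bool" where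
  "countable_language L \<longleftrightarrow> countable (fun_syms L) \<and> countable (rel_syms L)"

record ('f, 'r, 'a) fo_struct =
  universe :: "'a set"
  fun_int :: "'f \<Rightarrow> 'a list \<Rightarrow> 'a"
  rel_int :: "'r \<Rightarrow> 'a list set"

definition fo_structure :: "('f, 'r) fo_language \<Rightarrow> ('f, 'r, 'a) fo_struct \<Rightarrow> bool" where
  "fo_structure L M \<longleftrightarrow>
     universe M \<noteq> {} \<and>
     (\<forall>F\<in>fun_syms L. \<forall>xs\<in>nlists (fun_arity L F) (universe M). fun_int M F xs \<in> universe M) \<and>
     (\<forall>R\<in>rel_syms L. rel_int M R \<subseteq> nlists (rel_arity L R) (universe M))"

definition fun_closed :: "('f, 'r) fo_language \<Rightarrow> ('f, 'r, 'a) fo_struct \<Rightarrow> 'a set \<Rightarrow> bool" where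
  "fun_closed L M A \<longleftrightarrow>
     A \<subseteq> universe M \<and>
     (\<forall>F\<in>fun_syms L. \<forall>xs\<in>nlists (fun_arity L F) A. fun_int M F xs \<in> A)"

text \<open>
  A substructure is identified with its universe. As for all structures, this is required to be
  nonempty; so if \<open>L\<close> has no constants, the empty set generates no substructure.
\<close>

definition fin_gen_substructure ::
    "('f, 'r) fo_language \<Rightarrow> ('f, 'r, 'a) fo_struct \<Rightarrow> 'a set \<Rightarrow> bool" where
  "fin_gen_substructure L M A \<longleftrightarrow>
     A \<noteq> {} \<and> (\<exists>S. finite S \<and> S \<subseteq> universe M \<and> A = fun_closed L M hull S)"

definition substructure_iso ::
    "('f, 'r) fo_language \<Rightarrow> ('f, 'r, 'a) fo_struct \<Rightarrow> ('a \<Rightarrow> 'a) \<Rightarrow> 'a set \<Rightarrow> 'a set \<Rightarrow> bool" where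
  "substructure_iso L M \<phi> A B \<longleftrightarrow>
     bij_betw \<phi> A B \<and>
     (\<forall>F\<in>fun_syms L. \<forall>xs\<in>nlists (fun_arity L F) A. \<phi> (fun_int M F xs) = fun_int M F (map \<phi> xs)) \<and>
     (\<forall>R\<in>rel_syms L. \<forall>xs\<in>nlists (rel_arity L R) A. map \<phi> xs \<in> rel_int M R \<longleftrightarrow> xs \<in> rel_int M R)"

definition aut :: "('f, 'r) fo_language \<Rightarrow> ('f, 'r, 'a) fo_struct \<Rightarrow> ('a \<Rightarrow> 'a) set" where
  "aut L M = {g \<in> Bij (universe M). substructure_iso L M g (universe M) (universe M)}"

definition aut_group :: "('f, 'r) fo_language \<Rightarrow> ('f, 'r, 'a) fo_struct \<Rightarrow> ('a \<Rightarrow> 'a) monoid" where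
  "aut_group L M = BijGroup (universe M) \<lparr>carrier := aut L M\<rparr>"


section \<open>Metric structures\<close>

definition power_topology :: "'a topology \<Rightarrow> nat \<Rightarrow> (nat \<Rightarrow> 'a) topology" where
  "power_topology T k = product_topology (\<lambda>_. T) {..<k}"

text \<open>The metric is determined by the structure, so it may be carried as a parameter.\<close>

definition metric_structure ::
    "('f, 'r) fo_language \<Rightarrow> ('f, 'r, 'a) fo_struct \<Rightarrow> 'a metric \<Rightarrow> bool" where
  "metric_structure L M m \<longleftrightarrow>
     fo_structure L M \<and>
     mspace m = universe M \<and>
     (\<forall>r\<ge>0. \<forall>x\<in>universe M. \<forall>y\<in>universe M.
        [x, y] \<in> rel_int M (dist_sym L r) \<longleftrightarrow> mdist m x y \<le> of_rat r) \<and>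
     (\<forall>F\<in>fun_syms L.
        continuous_map (power_topology (mtopology_of m) (fun_arity L F)) (mtopology_of m)
          (\<lambda>a. fun_int M F (map a [0..<fun_arity L F]))) \<and>
     (\<forall>R\<in>rel_syms L.
        closedin (power_topology (mtopology_of m) (rel_arity L R))
          {a \<in> topspace (power_topology (mtopology_of m) (rel_arity L R)).
             map a [0..<rel_arity L R] \<in> rel_int M R})"

definition aut_topology ::
    "('f, 'r) fo_language \<Rightarrow> ('f, 'r, 'a) fo_struct \<Rightarrow> 'a metric \<Rightarrow> ('a \<Rightarrow> 'a) topology" where
  "aut_topology L M m =
     subtopology (product_topology (\<lambda>_. mtopology_of m) (universe M)) (aut L M)"


section \<open>The Hrushovski property and the extension property\<close>

definition hrushovski_property ::
    "('f, 'r) fo_language \<Rightarrow> ('f, 'r, 'a) fo_struct \<Rightarrow> bool" where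
  "hrushovski_property L M \<longleftrightarrow>
     (\<forall>(n::nat) \<phi> A B.
        (\<forall>i<n. fin_gen_substructure L M (A i) \<and> fin_gen_substructure L M (B i) \<and>
               substructure_iso L M (\<phi> i) (A i) (B i)) \<longrightarrow>
        (\<exists>D f. fin_gen_substructure L M D \<and>
           (\<forall>i<n. A i \<subseteq> D \<and> f i \<in> aut L M \<and> (\<forall>x\<in>A i. f i x = \<phi> i x) \<and> f i ` D = D)))"

definition independent_over ::
    "('f, 'r) fo_language \<Rightarrow> ('f, 'r, 'a) fo_struct \<Rightarrow> 'a set \<Rightarrow> 'a set \<Rightarrow> 'a set \<Rightarrow> bool" where
  "independent_over L M A B C \<longleftrightarrow>
     (let D = fun_closed L M hull (B \<union> C) in
      \<forall>\<phi> \<psi>. substructure_iso L M \<phi> B B \<and> substructure_iso L M \<psi> C C \<and>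
        \<phi> ` A = A \<and> \<psi> ` A = A \<and> (\<forall>x\<in>A. \<phi> x = \<psi> x) \<longrightarrow>
        (\<exists>\<theta>. substructure_iso L M \<theta> D D \<and> (\<forall>x\<in>B. \<theta> x = \<phi> x) \<and> (\<forall>x\<in>C. \<theta> x = \<psi> x)))"

definition extension_property ::
    "('f, 'r) fo_language \<Rightarrow> ('f, 'r, 'a) fo_struct \<Rightarrow> bool" where
  "extension_property L M \<longleftrightarrow>
     (\<forall>A B C. fin_gen_substructure L M A \<and> fin_gen_substructure L M B \<and>
        fin_gen_substructure L M C \<and> A \<subseteq> B \<inter> C \<longrightarrow>
        (\<exists>g\<in>aut L M. (\<forall>x\<in>A. g x = x) \<and> independent_over L M A B (g ` C)))"


section \<open>Tuples, stabilisers and orbits\<close>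

text \<open>Inserting \<open>0\<close> only affects the distance between empty tuples.\<close>

definition tuple_dist :: "'a metric \<Rightarrow> 'a list \<Rightarrow> 'a list \<Rightarrow> real" where
  "tuple_dist m a b = Max (insert 0 {mdist m (a ! i) (b ! i) | i. i < length a})"

definition aut_fix ::
    "('f, 'r) fo_language \<Rightarrow> ('f, 'r, 'a) fo_struct \<Rightarrow> 'a list \<Rightarrow> ('a \<Rightarrow> 'a) set" where
  "aut_fix L M a = {g \<in> aut L M. map g a = a}"

definition aut_nbhd ::
    "('f, 'r) fo_language \<Rightarrow> ('f, 'r, 'a) fo_struct \<Rightarrow> 'a metric \<Rightarrow> 'a list \<Rightarrow> real \<Rightarrow> ('a \<Rightarrow> 'a) set"
  where
  "aut_nbhd L M m a \<epsilon> = {g \<in> aut L M. tuple_dist m (map g a) a < \<epsilon>}"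

text \<open>\<open>orbit_over L M b a\<close> is \<open>\<O>(b/a)\<close>, the orbit of \<open>b\<close> under the pointwise stabiliser of \<open>a\<close>.\<close>

definition orbit_over ::
    "('f, 'r) fo_language \<Rightarrow> ('f, 'r, 'a) fo_struct \<Rightarrow> 'a list \<Rightarrow> 'a list \<Rightarrow> 'a list set" where
  "orbit_over L M b a = {map g b | g. g \<in> aut_fix L M a}"

definition aut_basis ::
    "('f, 'r) fo_language \<Rightarrow> ('f, 'r, 'a) fo_struct \<Rightarrow> 'a metric \<Rightarrow> 'a list set \<Rightarrow> bool" where
  "aut_basis L M m \<B> \<longleftrightarrow>
     \<B> \<subseteq> (\<Union>k\<in>{1..}. nlists k (universe M)) \<and>
     (\<forall>a\<in>lists (universe M). \<forall>\<epsilon>>0. \<exists>b\<in>\<B>. \<exists>\<eta>>0.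
        aut_fix L M b \<subseteq> aut_fix L M a \<and> aut_nbhd L M m b \<eta> \<subseteq> aut_nbhd L M m a \<epsilon>)"


section \<open>Polish groups and automatic continuity\<close>

definition topological_group :: "('g, 'x) monoid_scheme \<Rightarrow> 'g topology \<Rightarrow> bool" where
  "topological_group G T \<longleftrightarrow>
     group G \<and> topspace T = carrier G \<and>
     continuous_map (prod_topology T T) T (\<lambda>(x, y). x \<otimes>\<^bsub>G\<^esub> y) \<and>
     continuous_map T T (\<lambda>x. inv\<^bsub>G\<^esub> x)"

definition polish_group :: "('g, 'x) monoid_scheme \<Rightarrow> 'g topology \<Rightarrow> bool" where
  "polish_group G T \<longleftrightarrow>
     topological_group G T \<and> separable_space T \<and> completely_metrizable_space T"

text \<open>
  A definition cannot quantify over types, so the type of the elements of the target groups is a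
  parameter; a theorem stated with a free type variable here covers all Polish groups.
\<close>

definition automatic_continuity ::
    "'h itself \<Rightarrow> ('g, 'x) monoid_scheme \<Rightarrow> 'g topology \<Rightarrow> bool" where
  "automatic_continuity _ G T \<longleftrightarrow>
     (\<forall>(H :: 'h monoid) S h. polish_group H S \<and> h \<in> hom G H \<longrightarrow> continuous_map T S h)"

end

theory Submission
  imports Defs
begin

text \<open>
  Let \<open>W\<close> be the preimage of a small symmetric neighbourhood of \<open>1\<close> under the homomorphism.
  As the target group is separable, countably many sets \<open>A\<^sub>n\<close> with \<open>A\<^sub>n\<^sup>-\<^sup>1 A\<^sub>n \<subseteq> W\<close>
  cover the automorphism group. The task is to show that a bounded power of \<open>W\<close> contains a
  neighbourhood of the identity. This takes two steps.

  \<^emph>\<open>Some sixfold product of \<open>W\<close> contains the pointwise stabiliser of a finite tuple.\<close>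
  For countable structures this is the classical consequence of ample generics, and generics are what
  the Hrushovski property and the extension property provide. To use this for the uncountable
  structure \<open>X\<close>, suppose that every tuple \<open>a\<close> had an automorphism \<open>g\<^sub>a\<close> that fixes \<open>a\<close> and lies
  outside the product. By a Loewenheim-Skolem argument (\<open>skeleton_exists\<close>) there is a countable dense
  set \<open>Z\<close> that is closed under witnesses for both properties and under the chosen \<open>g\<^sub>a\<close>. The
  automorphisms that preserve \<open>Z\<close> form a group of permutations of \<open>Z\<close>, which is closed in the
  permutation topology because \<open>Z\<close> is dense and \<open>X\<close> complete, and which inherits both
  properties. Such a group has many generic tuples: a generic tuple \<open>x\<^sub>1, \<dots>, x\<^sub>n\<close> has comeagerly
  many generic one-point extensions (\<open>comeager_generic\<close>), and a partial conjugacy between two generic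
  tuples extends to a full one (\<open>generic_conjugate\<close>). If \<open>g\<close> lay outside the sixfold product, one
  could choose \<open>x\<^sub>n \<in> W\<^sup>2\<close> and \<open>y\<^sub>n \<in> k\<^sub>n g W\<^sup>2 k\<^sub>n\<^sup>-\<^sup>1\<close>, where the sets \<open>k\<^sub>n W\<close> cover the
  group, such that a single \<open>q\<close> conjugates every \<open>x\<^sub>n\<close> to \<open>y\<^sub>n\<close>. Now \<open>q \<in> k\<^sub>n W\<close> for some
  \<open>n\<close>, and the equation \<open>q x\<^sub>n = y\<^sub>n q\<close> puts \<open>g\<close> into the sixfold product after all
  (\<open>stabilizer_in_sixfold_product\<close>).

  \<^emph>\<open>A stabiliser inside a power of \<open>W\<close> yields a neighbourhood inside a power of \<open>W\<close>.\<close>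
  By Baire category \<open>W\<close> is dense in a neighbourhood of the identity
  (\<open>quotients_dense_near_identity\<close>). Choose a tuple \<open>b\<close> of the basis that is adapted to this
  neighbourhood and whose stabiliser lies in a power of \<open>W\<close>. An open rectangle in the set of the
  hypothesis then contains \<open>{g} \<times> U\<close> with \<open>g \<in> W\<close>, and for each \<open>f \<in> U\<close> the common point of the two
  orbits writes \<open>f\<close> as a product \<open>y (g x g\<^sup>-\<^sup>1) z\<close> with \<open>x, y, z\<close> fixing \<open>b\<close>
  (\<open>orbit_meet_factorization\<close>). So \<open>U\<close>, and hence \<open>U\<^sup>-\<^sup>1 U\<close>, lies in a power of \<open>W\<close>.
\<close>

section \<open>Tuples of maps\<close>

text \<open>
  The prefix \<open>inv\<close> is the notation for inverses in a group with explicit carrier; total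
  permutations are inverted as functions.
\<close>

abbreviation perm_inv :: "('a \<Rightarrow> 'a) \<Rightarrow> 'a \<Rightarrow> 'a" where
  "perm_inv \<equiv> inv_into UNIV"

text \<open>
  \<open>g x\<^sub>i = y\<^sub>i g\<close> on \<open>E\<close> for every \<open>i\<close>. The case \<open>g = id\<close> expresses that two tuples agree on \<open>E\<close>,
  so that agreement, partial conjugacy and conjugacy of tuples obey one calculus.
\<close>

definition intertwines :: "('a \<Rightarrow> 'a) \<Rightarrow> 'a set \<Rightarrow> ('a \<Rightarrow> 'a) list \<Rightarrow> ('a \<Rightarrow> 'a) list \<Rightarrow> bool" where
  "intertwines g E xs ys \<longleftrightarrow> list_all2 (\<lambda>x y. \<forall>e\<in>E. g (x e) = y (g e)) xs ys"

definition invariant :: "'a set \<Rightarrow> ('a \<Rightarrow> 'a) list \<Rightarrow> bool" where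
  "invariant D xs \<longleftrightarrow> (\<forall>x\<in>set xs. x ` D = D)"

definition agree_on :: "'a set \<Rightarrow> ('a \<Rightarrow> 'b) \<Rightarrow> ('a \<Rightarrow> 'b) \<Rightarrow> bool" where
  "agree_on D f g \<longleftrightarrow> (\<forall>d\<in>D. f d = g d)"

lemma agree_onD: "agree_on D f g \<Longrightarrow> d \<in> D \<Longrightarrow> f d = g d"
  by (simp add: agree_on_def)

lemma agree_on_refl [simp]: "agree_on D f f"
  by (simp add: agree_on_def)

lemma agree_on_sym: "agree_on D f g \<Longrightarrow> agree_on D g f"
  by (simp add: agree_on_def)

lemma agree_on_trans: "agree_on D f g \<Longrightarrow> agree_on D g h \<Longrightarrow> agree_on D f h"
  by (simp add: agree_on_def)

lemma agree_on_subset: "agree_on E f g \<Longrightarrow> D \<subseteq> E \<Longrightarrow> agree_on D f g"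
  by (auto simp: agree_on_def)

lemma agree_on_image: "agree_on D f g \<Longrightarrow> f ` D = g ` D"
  by (simp add: agree_on_def)

lemma invariant_Nil [simp]: "invariant D []"
  and invariant_Cons [simp]: "invariant D (x # xs) \<longleftrightarrow> x ` D = D \<and> invariant D xs"
  by (simp_all add: invariant_def)

lemma intertwines_Nil [simp]: "intertwines g E [] []"
  and intertwines_Cons [simp]: "intertwines g E (x # xs) (y # ys) \<longleftrightarrow>
     (\<forall>e\<in>E. g (x e) = y (g e)) \<and> intertwines g E xs ys"
  by (simp_all add: intertwines_def)

lemma intertwines_subset: "intertwines g E xs ys \<Longrightarrow> D \<subseteq> E \<Longrightarrow> intertwines g D xs ys"
  unfolding intertwines_def by (erule list_all2_mono) auto

lemma intertwines_agree:
  assumes "intertwines g E xs ys" "agree_on E g h" "invariant E xs"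
  shows "intertwines h E xs ys"
proof -
  have "h (x e) = y (h e)" if "x \<in> set xs" "\<forall>e\<in>E. g (x e) = y (g e)" "e \<in> E" for x y e
  proof -
    have "x e \<in> E" using that assms(3) by (auto simp: invariant_def)
    then show ?thesis using that assms(2) by (metis agree_onD)
  qed
  then show ?thesis
    using assms(1) unfolding intertwines_def by (auto simp: list_all2_conv_all_nth)
qed

lemma intertwines_comp:
  assumes "intertwines g E xs ys" "intertwines h (g ` E) ys zs"
  shows "intertwines (h \<circ> g) E xs zs"
proof -
  have "list_all2 (\<lambda>x z. \<forall>e\<in>E. (h \<circ> g) (x e) = z ((h \<circ> g) e)) xs zs"
    by (rule list_all2_trans[OF _ assms[unfolded intertwines_def]]) auto
  then show ?thesis by (simp add: intertwines_def)
qed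

lemma intertwines_inv:
  assumes "intertwines g E xs ys" "bij g"
  shows "intertwines (perm_inv g) (g ` E) ys xs"
proof -
  have inv: "perm_inv g (g x) = x" for x using assms(2) by (simp add: bij_is_inj)
  have *: "\<forall>e\<in>g ` E. perm_inv g (y e) = x (perm_inv g e)" if "\<forall>e\<in>E. g (x e) = y (g e)" for x y
  proof
    fix d assume "d \<in> g ` E"
    then obtain e where "e \<in> E" "d = g e" by blast
    then show "perm_inv g (y d) = x (perm_inv g d)" using inv[of "x e"] inv[of e] that by simp
  qed
  have "list_all2 (\<lambda>y x. \<forall>e\<in>E. g (x e) = y (g e)) ys xs"
    using assms(1) unfolding intertwines_def by (simp add: list_all2_conv_all_nth)
  then show ?thesis unfolding intertwines_def by (rule list_all2_mono) (rule *)
qed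

lemma invariant_image:
  assumes "intertwines g E xs ys" "invariant E xs"
  shows "invariant (g ` E) ys"
proof -
  have "y ` g ` E = g ` E" if y: "y \<in> set ys" for y
  proof -
    obtain i where i: "i < length ys" "y = ys ! i" using y by (metis in_set_conv_nth)
    define x where "x = xs ! i"
    have "x \<in> set xs" and x: "\<forall>e\<in>E. g (x e) = y (g e)"
      using assms(1) i unfolding intertwines_def list_all2_conv_all_nth x_def by simp_all
    have "y ` g ` E = g ` x ` E"
      unfolding image_image by (rule image_cong[OF refl]) (rule x[rule_format, symmetric])
    then show ?thesis using \<open>x \<in> set xs\<close> assms(2) by (simp add: invariant_def)
  qed
  then show ?thesis by (simp add: invariant_def)
qed

lemma intertwines_length: "intertwines g E xs ys \<Longrightarrow> length xs = length ys"
  by (simp add: intertwines_def list_all2_lengthD)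

section \<open>Permutation groups with invariant pieces and free gluing\<close>

text \<open>
  The pieces in \<open>\<D>\<close> stand for the finitely generated substructures contained in the countable set
  \<open>\<Omega>\<close>. Agreement on a piece defines the topology of \<open>P\<close>, and \<open>closed\<close> says that \<open>P\<close> is closed in it.
  The last two axioms are the Hrushovski property and the extension property in terms of
  \<open>P\<close> alone: finitely many permutations can be changed off a given piece so as to preserve a larger
  one, and two pieces over a common part can be moved so that automorphisms glue.
\<close>

locale closed_permutation_group =
  fixes \<Omega> :: "'a set" and P :: "('a \<Rightarrow> 'a) set" and \<D> :: "'a set set"
  assumes permutes: "p \<in> P \<Longrightarrow> p permutes \<Omega>"
    and id_in: "id \<in> P"
    and comp_in: "p \<in> P \<Longrightarrow> q \<in> P \<Longrightarrow> p \<circ> q \<in> P"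
    and inv_in: "p \<in> P \<Longrightarrow> perm_inv p \<in> P"
    and closed: "p permutes \<Omega> \<Longrightarrow> (\<And>D. D \<in> \<D> \<Longrightarrow> \<exists>q\<in>P. agree_on D q p) \<Longrightarrow> p \<in> P"
    and countable_pieces: "countable \<D>"
    and pieces_nonempty: "\<D> \<noteq> {}"
    and pieces_cover: "\<Union>\<D> = \<Omega>"
    and directed: "D \<in> \<D> \<Longrightarrow> E \<in> \<D> \<Longrightarrow> \<exists>F\<in>\<D>. D \<union> E \<subseteq> F"
    and image_piece: "p \<in> P \<Longrightarrow> D \<in> \<D> \<Longrightarrow> p ` D \<in> \<D>"
    and separable: "\<exists>Q\<subseteq>P. countable Q \<and> (\<forall>p\<in>P. \<forall>D\<in>\<D>. \<exists>q\<in>Q. agree_on D q p)"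
    and extend_partial: "xs \<in> lists P \<Longrightarrow> D \<in> \<D> \<Longrightarrow>
       \<exists>E\<in>\<D>. \<exists>ys\<in>lists P. D \<subseteq> E \<and> intertwines id D xs ys \<and> invariant E ys"
    and independence: "A \<in> \<D> \<Longrightarrow> B \<in> \<D> \<Longrightarrow> C \<in> \<D> \<Longrightarrow> A \<subseteq> B \<Longrightarrow> A \<subseteq> C \<Longrightarrow>
       \<exists>g\<in>P. agree_on A g id \<and>
         (\<exists>E\<in>\<D>. B \<union> g ` C \<subseteq> E \<and>
           (\<forall>\<phi>\<in>P. \<forall>\<psi>\<in>P. \<phi> ` B = B \<and> \<psi> ` g ` C = g ` C \<and> \<phi> ` A = A \<and> agree_on A \<phi> \<psi> \<longrightarrow>
              (\<exists>\<theta>\<in>P. \<theta> ` E = E \<and> agree_on B \<theta> \<phi> \<and> agree_on (g ` C) \<theta> \<psi>)))"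
begin

lemma bij_P: "p \<in> P \<Longrightarrow> bij p"
  using permutes permutes_bij by blast

lemma inv_P_simps [simp]:
  assumes "p \<in> P"
  shows "perm_inv p (p x) = x" "p (perm_inv p x) = x" "perm_inv p ` p ` A = A" "p ` perm_inv p ` A = A"
  using bij_P[OF assms]
  by (auto simp: bij_inv_eq_iff image_image bij_is_surj surj_f_inv_f bij_is_inj)

lemma directed3:
  assumes "A \<in> \<D>" "B \<in> \<D>" "C \<in> \<D>"
  shows "\<exists>F\<in>\<D>. A \<union> B \<union> C \<subseteq> F"
proof -
  obtain G where "G \<in> \<D>" "A \<union> B \<subseteq> G" using directed[OF assms(1,2)] by blast
  moreover from this(1) obtain F where "F \<in> \<D>" "G \<union> C \<subseteq> F" using directed[OF _ assms(3)] by blast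
  ultimately show ?thesis by blast
qed

lemma directed4:
  assumes "A \<in> \<D>" "B \<in> \<D>" "C \<in> \<D>" "D \<in> \<D>"
  shows "\<exists>F\<in>\<D>. A \<union> B \<union> C \<union> D \<subseteq> F"
proof -
  obtain G where "G \<in> \<D>" "A \<union> B \<union> C \<subseteq> G" using directed3[OF assms(1-3)] by blast
  moreover from this(1) obtain F where "F \<in> \<D>" "G \<union> D \<subseteq> F" using directed[OF _ assms(4)] by blast
  ultimately show ?thesis by blast
qed

subsection \<open>Limits of permutations\<close>

text \<open>
  The permutations stabilise on larger and larger pieces; the second exhaustion hypothesis makes the
  pointwise limit surjective.
\<close>

lemma limit_exists:
  assumes inP: "\<And>k. p k \<in> P" and pieces: "\<And>k. D k \<in> \<D>"
    and step: "\<And>k. D k \<subseteq> D (Suc k)" "\<And>k. agree_on (D k) (p (Suc k)) (p k)"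
    and exhaust: "\<And>E. E \<in> \<D> \<Longrightarrow> \<exists>k. E \<subseteq> D k" "\<And>E. E \<in> \<D> \<Longrightarrow> \<exists>k. E \<subseteq> p k ` D k"
  shows "\<exists>q\<in>P. \<forall>k. agree_on (D k) q (p k)"
proof -
  have mono: "D j \<subseteq> D k" if "j \<le> k" for j k
    using lift_Suc_mono_le[of D] step(1) that by blast
  have agree: "agree_on (D j) (p k) (p j)" if "j \<le> k" for j k
    using that
  proof (induction k rule: nat_induct_at_least)
    case (Suc k)
    have "agree_on (D j) (p (Suc k)) (p k)" using step(2) mono[OF Suc.hyps] by (rule agree_on_subset)
    then show ?case using Suc.IH by (rule agree_on_trans)
  qed simp
  define ix where "ix x = (LEAST k. x \<in> D k)" for x
  define q where "q x = (if x \<in> \<Omega> then p (ix x) x else x)" for x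
  have ix: "x \<in> D (ix x)" if x: "x \<in> \<Omega>" for x
  proof -
    obtain F where "F \<in> \<D>" "x \<in> F" using x pieces_cover by blast
    then obtain k where "x \<in> D k" using exhaust(1) by blast
    then show ?thesis unfolding ix_def by (rule LeastI)
  qed
  have D_sub: "D k \<subseteq> \<Omega>" for k using pieces pieces_cover by blast
  have q_eq: "q x = p k x" if "x \<in> D k" for x k
  proof -
    have "ix x \<le> k" using that unfolding ix_def by (rule Least_le)
    moreover have "x \<in> \<Omega>" using that D_sub by blast
    ultimately show ?thesis using agree[of "ix x" k] ix unfolding q_def by (simp add: agree_on_def)
  qed
  have "q permutes \<Omega>"
  proof (rule bij_imp_permutes)
    show "bij_betw q \<Omega> \<Omega>"
      unfolding bij_betw_def
    proof (intro conjI subset_antisym subsetI)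
      show "inj_on q \<Omega>"
      proof (rule inj_onI)
        fix x y assume xy: "x \<in> \<Omega>" "y \<in> \<Omega>" "q x = q y"
        define k where "k = max (ix x) (ix y)"
        have "x \<in> D k" "y \<in> D k" using ix xy mono unfolding k_def by (meson in_mono max.cobounded1 max.cobounded2)+
        then have "p k x = p k y" using q_eq xy(3) by metis
        then show "x = y" using bij_P[OF inP[of k]] by (meson bij_is_inj injD)
      qed
    next
      fix y assume "y \<in> q ` \<Omega>"
      then obtain x where "x \<in> \<Omega>" "y = p (ix x) x" unfolding q_def by auto
      then show "y \<in> \<Omega>"
        using permutes_in_image[OF permutes[OF inP]] by simp
    next
      fix y assume "y \<in> \<Omega>"
      then obtain F where "F \<in> \<D>" "y \<in> F" using pieces_cover by blast
      then obtain k where "y \<in> p k ` D k" using exhaust(2) by blast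
      then obtain x where x: "x \<in> D k" "y = p k x" by blast
      then have "y = q x" using q_eq by simp
      then show "y \<in> q ` \<Omega>" using x(1) D_sub by blast
    qed
  qed (simp add: q_def)
  moreover have "\<exists>q'\<in>P. agree_on E q' q" if E: "E \<in> \<D>" for E
  proof -
    obtain k where "E \<subseteq> D k" using exhaust(1) E by blast
    then have "agree_on E (p k) q" using q_eq by (auto simp: agree_on_def)
    then show ?thesis using inP by blast
  qed
  ultimately have "q \<in> P" by (rule closed)
  moreover have "agree_on (D k) q (p k)" for k using q_eq by (simp add: agree_on_def)
  ultimately show ?thesis by blast
qed

text \<open>
  The common shape of the inductive constructions below: a state carries a permutation and a piece on
  which that permutation is already final, and each step can be made to swallow a prescribed piece \<open>E\<close>
  in the domain and in the range. The relation \<open>R\<close> records what else a step achieves.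
\<close>

lemma fusion:
  fixes perm :: "'s \<Rightarrow> 'a \<Rightarrow> 'a" and piece :: "'s \<Rightarrow> 'a set"
  assumes inv: "\<And>k s. I k s \<Longrightarrow> perm s \<in> P \<and> piece s \<in> \<D>"
    and init: "I 0 s0"
    and step: "\<And>k s E. I k s \<Longrightarrow> E \<in> \<D> \<Longrightarrow>
       \<exists>s'. I (Suc k) s' \<and> R k s s' \<and> piece s \<union> E \<subseteq> piece s' \<and> E \<subseteq> perm s' ` piece s' \<and>
            agree_on (piece s) (perm s') (perm s)"
  obtains S q where "q \<in> P" "S 0 = s0" "\<And>k. I k (S k)" "\<And>k. R k (S k) (S (Suc k))"
    "\<And>k. piece (S k) \<subseteq> piece (S (Suc k))" "\<And>k. agree_on (piece (S k)) q (perm (S k))"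
    "\<And>E. E \<in> \<D> \<Longrightarrow> \<exists>k. E \<subseteq> piece (S k)"
proof -
  define E where "E = from_nat_into \<D>"
  have E: "E k \<in> \<D>" for k unfolding E_def by (rule from_nat_into[OF pieces_nonempty])
  have E_onto: "\<exists>k. E k = F" if "F \<in> \<D>" for F
    using that countable_pieces unfolding E_def by (metis from_nat_into_surj)
  \<comment> \<open>bookkeeping: step \<open>k\<close> takes care of the \<open>k\<close>-th piece\<close>
  have "\<exists>S. \<forall>k. (I k (S k) \<and> (k = 0 \<longrightarrow> S k = s0)) \<and>
     (R k (S k) (S (Suc k)) \<and> piece (S k) \<union> E k \<subseteq> piece (S (Suc k)) \<and>
      E k \<subseteq> perm (S (Suc k)) ` piece (S (Suc k)) \<and>
      agree_on (piece (S k)) (perm (S (Suc k))) (perm (S k)))"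
  proof (rule dependent_nat_choice)
    show "\<exists>s. I 0 s \<and> (0 = 0 \<longrightarrow> s = s0)" using init by blast
  next
    fix s k assume "I k s \<and> (k = 0 \<longrightarrow> s = s0)"
    then show "\<exists>s'. (I (Suc k) s' \<and> (Suc k = 0 \<longrightarrow> s' = s0)) \<and>
       (R k s s' \<and> piece s \<union> E k \<subseteq> piece s' \<and> E k \<subseteq> perm s' ` piece s' \<and>
        agree_on (piece s) (perm s') (perm s))"
      using step[OF _ E[of k]] by simp
  qed
  then obtain S where
    S: "\<And>k. I k (S k)" "S 0 = s0" "\<And>k. R k (S k) (S (Suc k))"
       "\<And>k. piece (S k) \<union> E k \<subseteq> piece (S (Suc k))"
       "\<And>k. E k \<subseteq> perm (S (Suc k)) ` piece (S (Suc k))"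
       "\<And>k. agree_on (piece (S k)) (perm (S (Suc k))) (perm (S k))"
    by blast
  have exh: "\<exists>k. F \<subseteq> piece (S k)" "\<exists>k. F \<subseteq> perm (S k) ` piece (S k)" if "F \<in> \<D>" for F
    using E_onto[OF that] S(4,5) by (metis le_sup_iff)+
  have grow: "piece (S k) \<subseteq> piece (S (Suc k))" for k using S(4)[of k] by blast
  have "\<exists>q\<in>P. \<forall>k. agree_on (piece (S k)) q (perm (S k))"
    by (rule limit_exists[of "\<lambda>k. perm (S k)" "\<lambda>k. piece (S k)", OF _ _ grow S(6) exh])
       (use inv S(1) in blast)+
  then obtain q where q: "q \<in> P" "\<And>k. agree_on (piece (S k)) q (perm (S k))" by blast
  show thesis by (rule that[OF q(1) S(2,1,3) grow q(2) exh(1)])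
qed

subsection \<open>Baire category\<close>

definition dense_open :: "('a \<Rightarrow> 'a) set \<Rightarrow> bool" where
  "dense_open U \<longleftrightarrow>
     (\<forall>p\<in>P. \<forall>D\<in>\<D>. \<exists>q\<in>U. q \<in> P \<and> agree_on D q p) \<and>
     (\<forall>p\<in>U. \<exists>D\<in>\<D>. \<forall>q\<in>P. agree_on D q p \<longrightarrow> q \<in> U)"

definition comeager :: "('a \<Rightarrow> 'a) set \<Rightarrow> bool" where
  "comeager C \<longleftrightarrow> (\<exists>\<U>. countable \<U> \<and> (\<forall>U\<in>\<U>. dense_open U) \<and> P \<inter> \<Inter>\<U> \<subseteq> C)"

lemma comeager_dense_open: "dense_open U \<Longrightarrow> comeager U"
  unfolding comeager_def by (rule exI[of _ "{U}"]) auto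

lemma comeager_P: "comeager P"
  unfolding comeager_def by (rule exI[of _ "{}"]) auto

lemma comeager_mono: "comeager C \<Longrightarrow> P \<inter> C \<subseteq> C' \<Longrightarrow> comeager C'"
  unfolding comeager_def
proof (elim exE conjE)
  fix \<U> assume "countable \<U>" "\<forall>U\<in>\<U>. dense_open U" "P \<inter> \<Inter>\<U> \<subseteq> C" "P \<inter> C \<subseteq> C'"
  then show "\<exists>\<U>. countable \<U> \<and> (\<forall>U\<in>\<U>. dense_open U) \<and> P \<inter> \<Inter>\<U> \<subseteq> C'"
    by (intro exI[of _ \<U>]) auto
qed

lemma comeager_INT:
  assumes "countable J" "\<And>j. j \<in> J \<Longrightarrow> comeager (C j)"
  shows "comeager (\<Inter>j\<in>J. C j)"
proof -
  obtain \<U> where \<U>: "\<And>j. j \<in> J \<Longrightarrow> countable (\<U> j) \<and> (\<forall>U\<in>\<U> j. dense_open U) \<and> P \<inter> \<Inter>(\<U> j) \<subseteq> C j"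
    using assms(2) unfolding comeager_def by metis
  show ?thesis
    unfolding comeager_def
  proof (intro exI conjI)
    show "countable (\<Union>j\<in>J. \<U> j)" using assms(1) \<U> by simp
    show "\<forall>U\<in>\<Union>j\<in>J. \<U> j. dense_open U" using \<U> by simp
    show "P \<inter> \<Inter>(\<Union>j\<in>J. \<U> j) \<subseteq> (\<Inter>j\<in>J. C j)"
    proof (intro subsetI INT_I)
      fix p j assume p: "p \<in> P \<inter> \<Inter>(\<Union>j\<in>J. \<U> j)" and j: "j \<in> J"
      then have "p \<in> P \<inter> \<Inter>(\<U> j)" by auto
      then show "p \<in> C j" using \<U>[OF j] by (elim conjE subsetD)
    qed
  qed
qed

lemma comeager_Int: "comeager A \<Longrightarrow> comeager B \<Longrightarrow> comeager (A \<inter> B)"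
  using comeager_INT[of "{A, B}" "\<lambda>x. x"] by auto

lemma comeager_translate:
  assumes "comeager C" "p \<in> P" "q \<in> P"
  shows "comeager {v \<in> P. p \<circ> v \<circ> q \<in> C}"
proof -
  obtain \<U> where \<U>: "countable \<U>" "\<And>U. U \<in> \<U> \<Longrightarrow> dense_open U" "P \<inter> \<Inter>\<U> \<subseteq> C"
    using assms(1) unfolding comeager_def by blast
  have "dense_open {v \<in> P. p \<circ> v \<circ> q \<in> U}" if U: "U \<in> \<U>" for U
    unfolding dense_open_def
  proof (intro conjI ballI)
    fix v D assume v: "v \<in> P" "D \<in> \<D>"
    have "p \<circ> v \<circ> q \<in> P" "perm_inv q ` D \<in> \<D>" using assms v by (simp_all add: comp_in image_piece inv_in)
    then obtain u where u: "u \<in> U" "u \<in> P" "agree_on (perm_inv q ` D) u (p \<circ> v \<circ> q)"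
      using \<U>(2)[OF U] unfolding dense_open_def by blast
    define w where "w = perm_inv p \<circ> u \<circ> perm_inv q"
    have "w \<in> P" using u assms by (simp add: w_def comp_in inv_in)
    moreover have "p \<circ> w \<circ> q = u" using assms by (simp add: w_def fun_eq_iff)
    moreover have "agree_on D w v" using u(3) assms by (auto simp: w_def agree_on_def)
    ultimately show "\<exists>w\<in>{v \<in> P. p \<circ> v \<circ> q \<in> U}. w \<in> P \<and> agree_on D w v" using u(1) by auto
  next
    fix v assume "v \<in> {v \<in> P. p \<circ> v \<circ> q \<in> U}"
    then have v: "v \<in> P" "p \<circ> v \<circ> q \<in> U" by auto
    then obtain D where D: "D \<in> \<D>" "\<And>w. w \<in> P \<Longrightarrow> agree_on D w (p \<circ> v \<circ> q) \<Longrightarrow> w \<in> U"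
      using \<U>(2)[OF U] unfolding dense_open_def by blast
    have "p \<circ> w \<circ> q \<in> U" if "w \<in> P" "agree_on (q ` D) w v" for w
      by (rule D(2)) (use that assms in \<open>auto simp: comp_in agree_on_def\<close>)
    then show "\<exists>D\<in>\<D>. \<forall>w\<in>P. agree_on D w v \<longrightarrow> w \<in> {v \<in> P. p \<circ> v \<circ> q \<in> U}"
      using image_piece[OF assms(3) D(1)] by blast
  qed
  then show ?thesis
    unfolding comeager_def
    by (intro exI[of _ "(\<lambda>U. {v \<in> P. p \<circ> v \<circ> q \<in> U}) ` \<U>"])
       (use \<U> assms in \<open>auto simp: comp_in\<close>)
qed

text \<open>
  Meet the dense open sets one after the other by \<open>fusion\<close>; the piece of each state is chosen so large
  that agreement on it already forces membership in the dense open set.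
\<close>

lemma baire:
  assumes "comeager C" "p \<in> P" "D \<in> \<D>"
  shows "\<exists>q\<in>C. q \<in> P \<and> agree_on D q p"
proof -
  obtain \<U> where \<U>: "countable \<U>" "\<And>U. U \<in> \<U> \<Longrightarrow> dense_open U" "P \<inter> \<Inter>\<U> \<subseteq> C"
    using assms(1) unfolding comeager_def by blast
  have "dense_open P" unfolding dense_open_def using pieces_nonempty agree_on_refl by blast
  define U where "U = from_nat_into (insert P \<U>)"
  have U: "dense_open (U k)" for k
  proof -
    have "U k \<in> insert P \<U>" unfolding U_def by (rule from_nat_into) simp
    then show ?thesis using \<U>(2) \<open>dense_open P\<close> by blast
  qed
  have U_onto: "\<exists>k. U k = V" if "V \<in> \<U>" for V
    using that \<U>(1) unfolding U_def by (metis countable_insert from_nat_into_surj insertCI)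
  define I where "I k s \<longleftrightarrow> fst s \<in> P \<and> snd s \<in> \<D>" for k :: nat and s :: "('a \<Rightarrow> 'a) \<times> 'a set"
  define R where "R k s s' \<longleftrightarrow> (\<forall>q\<in>P. agree_on (snd s') q (fst s') \<longrightarrow> q \<in> U k)"
    for k and s s' :: "('a \<Rightarrow> 'a) \<times> 'a set"
  obtain S q where S: "q \<in> P" "S 0 = (p, D)" "\<And>k. R k (S k) (S (Suc k))"
    "\<And>k. agree_on (snd (S k)) q (fst (S k))"
  proof (rule fusion[of I fst snd "(p, D)" R])
    fix k s E assume s: "I k s" and E: "E \<in> \<D>"
    obtain p' where p': "p' \<in> U k" "p' \<in> P" "agree_on (snd s) p' (fst s)"
      using U[of k] s unfolding dense_open_def I_def by blast
    obtain F where F: "F \<in> \<D>" "\<And>q. q \<in> P \<Longrightarrow> agree_on F q p' \<Longrightarrow> q \<in> U k"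
      using U[of k] p'(1) unfolding dense_open_def by blast
    obtain D' where D': "D' \<in> \<D>" "snd s \<union> E \<union> perm_inv p' ` E \<union> F \<subseteq> D'"
      using directed4[of "snd s" E "perm_inv p' ` E" F] s E F(1) p'(2) image_piece inv_in
      unfolding I_def by metis
    have "p' ` perm_inv p' ` E \<subseteq> p' ` D'" using D'(2) by (intro image_mono) blast
    then have "E \<subseteq> p' ` D'" using p'(2) by simp
    moreover have "R k s (p', D')"
      using F(2) D'(2) unfolding R_def by (auto intro: agree_on_subset)
    ultimately show "\<exists>s'. I (Suc k) s' \<and> R k s s' \<and> snd s \<union> E \<subseteq> snd s' \<and> E \<subseteq> fst s' ` snd s' \<and>
            agree_on (snd s) (fst s') (fst s)"
      using D' p' by (intro exI[of _ "(p', D')"]) (auto simp: I_def)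
  next
    fix S q assume "q \<in> P" "S 0 = (p, D)" "\<And>k. R k (S k) (S (Suc k))"
      "\<And>k. agree_on (snd (S k)) q (fst (S k))"
    then show thesis by (rule that)
  qed (use assms in \<open>simp_all add: I_def\<close>)
  have "q \<in> U k" for k using S(1,3,4) unfolding R_def by blast
  then have "q \<in> C" using U_onto S(1) \<U>(3) by blast
  moreover have "agree_on D q p" using S(2) S(4)[of 0] by simp
  ultimately show ?thesis using S(1) by blast
qed

end

text \<open>
  Rewriting with \<open>intertwines_Cons\<close> leaves the identity in eta-expanded form.
\<close>

lemma intertwines_eta_id [simp]: "intertwines (\<lambda>a. a) = intertwines id"
  by (simp add: id_def)

lemma agree_list_invariant:
  "list_all2 (agree_on E) xs ys \<Longrightarrow> invariant E xs \<longleftrightarrow> invariant E ys"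
  by (induction rule: list_all2_induct) (simp_all add: agree_on_image)

lemma agree_list_intertwines:
  assumes "list_all2 (agree_on E) xs ys" "F \<subseteq> E"
  shows "intertwines f F xs us \<longleftrightarrow> intertwines f F ys us"
  using assms(1)
proof (induction arbitrary: us rule: list_all2_induct)
  case (Cons x xs y ys)
  have "(\<forall>e\<in>F. f (x e) = u (f e)) \<longleftrightarrow> (\<forall>e\<in>F. f (y e) = u (f e))" for u
    using Cons.hyps(1) assms(2) by (auto simp: agree_on_def subset_iff)
  then show ?case using Cons.IH by (cases us) (simp_all add: intertwines_def)
qed simp

context closed_permutation_group
begin

subsection \<open>Generic tuples\<close>

text \<open>
  Generic tuples without reference to category: invariant pieces are cofinal, and every finite
  extension, within \<open>P\<close>, of the action of the tuple on an invariant piece already occurs, up to an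
  element fixing that piece, inside the tuple itself.
\<close>

definition generic :: "('a \<Rightarrow> 'a) list \<Rightarrow> bool" where
  "generic xs \<longleftrightarrow>
     (\<forall>D\<in>\<D>. \<exists>E\<in>\<D>. D \<subseteq> E \<and> invariant E xs) \<and>
     (\<forall>D\<in>\<D>. \<forall>E\<in>\<D>. \<forall>ys\<in>lists P.
        D \<subseteq> E \<and> invariant D xs \<and> invariant E ys \<and> intertwines id D ys xs \<longrightarrow>
        (\<exists>g\<in>P. agree_on D g id \<and> intertwines g E ys xs))"

lemma generic_invariant:
  assumes "generic xs" "D \<in> \<D>"
  obtains E where "E \<in> \<D>" "D \<subseteq> E" "invariant E xs"
  using assms unfolding generic_def by blast

lemma generic_absorb:
  assumes "generic xs" "D \<in> \<D>" "E \<in> \<D>" "ys \<in> lists P" "D \<subseteq> E" "invariant D xs" "invariant E ys"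
    "intertwines id D ys xs"
  obtains g where "g \<in> P" "agree_on D g id" "intertwines g E ys xs"
proof -
  have "\<exists>g\<in>P. agree_on D g id \<and> intertwines g E ys xs"
    using assms(1)[unfolded generic_def, THEN conjunct2, rule_format, OF assms(2-4)] assms(5-8) by simp
  then show ?thesis using that by blast
qed

lemma generic_Nil: "generic []"
proof -
  have "\<exists>g\<in>P. agree_on D g id \<and> intertwines g E ys []"
    if "intertwines id D ys []" for D E ys
    using that id_in by (intro bexI[of _ id]) (auto simp: intertwines_def)
  then show ?thesis unfolding generic_def by auto
qed

text \<open>
  The Hrushovski property provides an extension of \<open>x\<close> and of the tuple to a piece that all of them
  preserve. Genericity of \<open>xs\<close> then moves this configuration by some \<open>g\<close> so that the new
  copies of the tuple become the tuple itself, and \<open>x\<close> is replaced by a conjugate.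
\<close>

lemma generic_invariant_dense:
  assumes gen: "generic xs" "xs \<in> lists P" and x: "x \<in> P" and D: "D \<in> \<D>"
  obtains x' E where "x' \<in> P" "agree_on D x' x" "E \<in> \<D>" "D \<subseteq> E" "invariant E (x' # xs)"
proof -
  \<comment> \<open>\<open>g\<close> will fix \<open>A\<close>; as \<open>A\<close> also contains \<open>x ` D\<close>, conjugation by \<open>g\<close> keeps \<open>x\<close> on \<open>D\<close>\<close>
  obtain A0 where A0: "A0 \<in> \<D>" "D \<union> x ` D \<subseteq> A0"
    using directed[OF D image_piece[OF x D]] by blast
  obtain A where A: "A \<in> \<D>" "A0 \<subseteq> A" "invariant A xs"
    using generic_invariant[OF gen(1) A0(1)] by blast
  obtain E zs where E: "E \<in> \<D>" "zs \<in> lists P" "A \<subseteq> E" "intertwines id A (x # xs) zs" "invariant E zs"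
    using extend_partial[of "x # xs" A] gen(2) x A(1) by auto
  obtain f fs where zs: "zs = f # fs"
    using intertwines_length[OF E(4)] by (cases zs) auto
  have f: "f \<in> P" "fs \<in> lists P" "f ` E = E" "invariant E fs" "agree_on A x f" "intertwines id A xs fs"
    using E zs by (simp_all add: agree_on_def)
  have "intertwines id A fs xs"
    using intertwines_inv[OF f(6)] by simp
  then obtain g where g: "g \<in> P" "agree_on A g id" "intertwines g E fs xs"
    using generic_absorb[OF gen(1) A(1) E(1) f(2) E(3) A(3) f(4)] by blast
  define x' where "x' = g \<circ> f \<circ> perm_inv g"
  have x'_g: "x' (g e) = g (f e)" for e using g(1) by (simp add: x'_def)
  show ?thesis
  proof (rule that)
    show "x' \<in> P" using g f by (simp add: x'_def comp_in inv_in)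
    show "agree_on D x' x"
      unfolding agree_on_def
    proof
      fix d assume "d \<in> D"
      then have "d \<in> A" "x d \<in> A" using A0(2) A(2) by auto
      then have "g d = d" "g (x d) = x d" "x d = f d" using g(2) f(5) by (simp_all add: agree_on_def)
      then show "x' d = x d" using x'_g[of d] by simp
    qed
    show "g ` E \<in> \<D>" using g(1) E(1) by (rule image_piece)
    show "D \<subseteq> g ` E"
    proof
      fix d assume "d \<in> D"
      then have "d \<in> A" using A0(2) A(2) by auto
      then have "g d = d" "d \<in> E" using g(2) E(3) by (auto simp: agree_on_def)
      then show "d \<in> g ` E" by (metis imageI)
    qed
    have "intertwines g E (f # fs) (x' # xs)" using g(3) x'_g by simp
    then show "invariant (g ` E) (x' # xs)"
      by (rule invariant_image) (use f in simp)
  qed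
qed

text \<open>
  Density in the second clause of genericity. A copy of \<open>E\<close> independent from \<open>B\<close> over \<open>D\<close> lets
  the action of the \<open>x\<close>s on \<open>B\<close> be glued with the action of the \<open>y\<close>s on \<open>E\<close>;
  genericity of \<open>xs\<close> then realises the glued tuple by \<open>xs\<close>, and only the first entry \<open>x\<close> has to be
  changed, off \<open>B\<close>.
\<close>

lemma independent_absorb:
  assumes gen: "generic xs" "xs \<in> lists P" and x: "x \<in> P" and y: "y \<in> P" "ys \<in> lists P"
    and D: "D \<in> \<D>" and E: "E \<in> \<D>" and B: "B \<in> \<D>" and sub: "D \<subseteq> E" "E \<subseteq> B"
    and inv: "invariant D (x # xs)" "invariant E (y # ys)" "invariant B (x # xs)"
    and tw: "intertwines id D (y # ys) (x # xs)"
  obtains x' g where "x' \<in> P" "agree_on B x' x" "g \<in> P" "agree_on D g id"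
    "intertwines g E (y # ys) (x' # xs)"
proof -
  define glues where "glues h F \<longleftrightarrow>
      (\<forall>\<phi>\<in>P. \<forall>\<psi>\<in>P. \<phi> ` B = B \<and> \<psi> ` h ` E = h ` E \<and> \<phi> ` D = D \<and> agree_on D \<phi> \<psi> \<longrightarrow>
        (\<exists>\<theta>\<in>P. \<theta> ` F = F \<and> agree_on B \<theta> \<phi> \<and> agree_on (h ` E) \<theta> \<psi>))" for h F
  have "\<exists>h\<in>P. agree_on D h id \<and> (\<exists>F\<in>\<D>. B \<union> h ` E \<subseteq> F \<and> glues h F)"
    unfolding glues_def using sub by (intro independence D B E) auto
  then obtain h F where h: "h \<in> P" "agree_on D h id" and F: "F \<in> \<D>" "B \<union> h ` E \<subseteq> F" and "glues h F"
    by blast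
  note glue = this(5)[unfolded glues_def, rule_format, OF _ _ conjI[OF _ conjI[OF _ conjI]]]
  have glue1: "\<exists>\<theta>\<in>P. \<theta> ` F = F \<and> agree_on B \<theta> u \<and> (\<forall>e\<in>E. h (v e) = \<theta> (h e))"
    if uv: "u \<in> P" "v \<in> P" "u ` D = D" "v ` E = E" "u ` B = B" "\<forall>d\<in>D. v d = u d" for u v
  proof -
    have "\<exists>\<theta>\<in>P. \<theta> ` F = F \<and> agree_on B \<theta> u \<and> agree_on (h ` E) \<theta> (h \<circ> v \<circ> perm_inv h)"
    proof (rule glue)
      show "(h \<circ> v \<circ> perm_inv h) ` h ` E = h ` E"
        using h(1) uv(4) by (simp only: image_comp[symmetric] inv_P_simps)
      show "agree_on D u (h \<circ> v \<circ> perm_inv h)"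
        unfolding agree_on_def
      proof
        fix d assume d: "d \<in> D"
        then have "h d = d" "h (u d) = u d" using h(2) uv(3) by (auto simp: agree_on_def)
        then show "u d = (h \<circ> v \<circ> perm_inv h) d" using uv(6) d h(1) by (metis comp_apply inv_P_simps(1))
      qed
    qed (use uv h in \<open>simp_all add: comp_in inv_in\<close>)
    then obtain \<theta> where "\<theta> \<in> P" "\<theta> ` F = F" "agree_on B \<theta> u" "agree_on (h ` E) \<theta> (h \<circ> v \<circ> perm_inv h)"
      by blast
    then show ?thesis using h(1) by (intro bexI[of _ \<theta>]) (simp_all add: agree_on_def)
  qed
  have lift: "\<exists>ths\<in>lists P. invariant F ths \<and> intertwines id B xs ths \<and> intertwines h E ys ths"
    if "xs \<in> lists P" "ys \<in> lists P" "invariant D xs" "invariant E ys" "invariant B xs"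
      "intertwines id D ys xs" for xs ys
    using that
  proof (induction ys arbitrary: xs)
    case Nil
    then show ?case by (auto simp: intertwines_def)
  next
    case (Cons v vs)
    then obtain u us where xs: "xs = u # us" by (auto simp: intertwines_def list_all2_Cons1)
    obtain \<theta> where t: "\<theta> \<in> P" "\<theta> ` F = F" "agree_on B \<theta> u" "\<forall>e\<in>E. h (v e) = \<theta> (h e)"
      using glue1[of u v] Cons.prems xs by auto
    have "\<exists>ths\<in>lists P. invariant F ths \<and> intertwines id B us ths \<and> intertwines h E vs ths"
      by (rule Cons.IH) (use Cons.prems xs in simp_all)
    then obtain ths where "ths \<in> lists P" "invariant F ths" "intertwines id B us ths" "intertwines h E vs ths"
      by blast
    then show ?case using t xs by (intro bexI[of _ "\<theta> # ths"]) (auto simp: agree_on_def)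
  qed
  have "\<exists>ths\<in>lists P. invariant F ths \<and> intertwines id B xs ths \<and> intertwines h E ys ths"
    by (rule lift) (use gen(2) y(2) inv tw in simp_all)
  then obtain ths where ths: "ths \<in> lists P" "invariant F ths" "intertwines id B xs ths"
    "intertwines h E ys ths"
    by blast
  obtain \<theta> where t: "\<theta> \<in> P" "\<theta> ` F = F" "agree_on B \<theta> x" "\<forall>e\<in>E. h (y e) = \<theta> (h e)"
    using glue1[of x y] x y inv tw by auto
  have "intertwines id B ths xs" using intertwines_inv[OF ths(3)] by simp
  then obtain k where k: "k \<in> P" "agree_on B k id" "intertwines k F ths xs"
    using generic_absorb[OF gen(1) B F(1) ths(1) _ _ ths(2)] F(2) inv(3) by auto
  define x' where "x' = k \<circ> \<theta> \<circ> perm_inv k"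
  have x'_k: "x' (k e) = k (\<theta> e)" for e using k(1) by (simp add: x'_def)
  show ?thesis
  proof (rule that)
    show "x' \<in> P" using k t by (simp add: x'_def comp_in inv_in)
    show "agree_on B x' x"
      unfolding agree_on_def
    proof
      fix b assume "b \<in> B"
      then have "k b = b" "k (x b) = x b" "\<theta> b = x b"
        using k(2) t(3) inv(3) by (auto simp: agree_on_def)
      then show "x' b = x b" using x'_k[of b] by simp
    qed
    show "k \<circ> h \<in> P" using k h by (simp add: comp_in)
    show "agree_on D (k \<circ> h) id" using h(2) k(2) sub by (auto simp: agree_on_def)
    have "intertwines k (h ` E) ths xs" using k(3) F(2) by (auto intro: intertwines_subset)
    then have "intertwines (k \<circ> h) E ys xs" using intertwines_comp[OF ths(4)] by blast
    then show "intertwines (k \<circ> h) E (y # ys) (x' # xs)" using t(4) x'_k by simp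
  qed
qed

lemma dense_open_invariant:
  assumes "generic xs" "xs \<in> lists P" "D \<in> \<D>"
  shows "dense_open {x \<in> P. \<exists>E\<in>\<D>. D \<subseteq> E \<and> invariant E (x # xs)}"
  unfolding dense_open_def
proof (intro conjI ballI)
  fix x A assume x: "x \<in> P" and A: "A \<in> \<D>"
  obtain A' where A': "A' \<in> \<D>" "A \<union> D \<subseteq> A'" using directed[OF A assms(3)] by blast
  obtain x' E where E: "x' \<in> P" "agree_on A' x' x" "E \<in> \<D>" "A' \<subseteq> E" "invariant E (x' # xs)"
    using generic_invariant_dense[OF assms(1,2) x A'(1)] by blast
  have "agree_on A x' x" by (rule agree_on_subset[OF E(2)]) (use A' in blast)
  moreover have "D \<subseteq> E" using A' E(4) by blast
  ultimately show "\<exists>q\<in>{x \<in> P. \<exists>E\<in>\<D>. D \<subseteq> E \<and> invariant E (x # xs)}. q \<in> P \<and> agree_on A q x"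
    using E by blast
next
  fix x assume "x \<in> {x \<in> P. \<exists>E\<in>\<D>. D \<subseteq> E \<and> invariant E (x # xs)}"
  then obtain E where E: "E \<in> \<D>" "D \<subseteq> E" "x ` E = E" "invariant E xs" by auto
  have "q ` E = E" if "agree_on E q x" for q using agree_on_image[OF that] E(3) by simp
  then show "\<exists>A\<in>\<D>. \<forall>q\<in>P. agree_on A q x \<longrightarrow> q \<in> {x \<in> P. \<exists>E\<in>\<D>. D \<subseteq> E \<and> invariant E (x # xs)}"
    using E by (intro bexI[of _ E]) auto
qed

lemma dense_open_absorb:
  assumes gen: "generic xs" "xs \<in> lists P" and D: "D \<in> \<D>" and E: "E \<in> \<D>"
    and y: "y \<in> P" "ys \<in> lists P" and sub: "D \<subseteq> E"
  shows "dense_open {x \<in> P. invariant D (x # xs) \<and> invariant E (y # ys) \<and>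
      intertwines id D (y # ys) (x # xs) \<longrightarrow>
      (\<exists>g\<in>P. agree_on D g id \<and> intertwines g E (y # ys) (x # xs))}"
    (is "dense_open {x \<in> P. ?H x \<longrightarrow> ?C x}")
proof -
  have H_local: "?H x \<longleftrightarrow> ?H x'" if "agree_on D x x'" for x x'
    using that agree_on_image[OF that] by (auto simp: agree_on_def)
  show ?thesis
    unfolding dense_open_def
  proof (intro conjI ballI)
    fix x A assume x: "x \<in> P" and A: "A \<in> \<D>"
    show "\<exists>q\<in>{x \<in> P. ?H x \<longrightarrow> ?C x}. q \<in> P \<and> agree_on A q x"
    proof (cases "?H x")
      case False
      then show ?thesis using x by (intro bexI[of _ x]) auto
    next
      case True
      obtain A' where A': "A' \<in> \<D>" "A \<union> E \<subseteq> A'" using directed[OF A E] by blast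
      obtain x1 B where B: "x1 \<in> P" "agree_on A' x1 x" "B \<in> \<D>" "A' \<subseteq> B" "invariant B (x1 # xs)"
        using generic_invariant_dense[OF gen x A'(1)] by blast
      have "agree_on D x x1"
        by (rule agree_on_sym, rule agree_on_subset[OF B(2)]) (use A' sub in blast)
      then have "?H x1" using True H_local by blast
      then obtain x' g where x': "x' \<in> P" "agree_on B x' x1" "g \<in> P" "agree_on D g id"
        "intertwines g E (y # ys) (x' # xs)"
        using independent_absorb[OF gen B(1) y D E B(3) sub] A'(2) B(4,5) by (metis le_sup_iff subset_trans)
      have "agree_on A' x' x1" by (rule agree_on_subset[OF x'(2) B(4)])
      then have "agree_on A' x' x" using B(2) by (rule agree_on_trans)
      then have "agree_on A x' x" by (rule agree_on_subset) (use A' in blast)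
      then show ?thesis using x' by (intro bexI[of _ x']) auto
    qed
  next
    fix x assume x: "x \<in> {x \<in> P. ?H x \<longrightarrow> ?C x}"
    show "\<exists>A\<in>\<D>. \<forall>q\<in>P. agree_on A q x \<longrightarrow> q \<in> {x \<in> P. ?H x \<longrightarrow> ?C x}"
    proof (cases "?H x")
      case False
      then show ?thesis using H_local D by (intro bexI[of _ D]) auto
    next
      case True
      then obtain g where g: "g \<in> P" "agree_on D g id" "intertwines g E (y # ys) (x # xs)"
        using x by auto
      have "intertwines g E (y # ys) (q # xs)" if "agree_on (g ` E) q x" for q
        using g(3) that by (auto simp: agree_on_def)
      then show ?thesis using g image_piece[OF g(1) E] by (intro bexI[of _ "g ` E"]) auto
    qed
  qed
qed

text \<open>
  The two clauses of genericity are dense open conditions on the new entry. The second clause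
  ranges over all tuples \<open>ys\<close>, but it depends on \<open>ys\<close> only through \<open>E\<close>, so a countable dense set of
  \<open>ys\<close> suffices.
\<close>

lemma comeager_generic:
  assumes gen: "generic xs" "xs \<in> lists P"
  shows "comeager {x \<in> P. generic (x # xs)}"
proof -
  obtain Q where Q: "Q \<subseteq> P" "countable Q" "\<And>p D. p \<in> P \<Longrightarrow> D \<in> \<D> \<Longrightarrow> \<exists>q\<in>Q. agree_on D q p"
    using separable by blast
  define J where "J = {(D, E, y, ys). D \<in> \<D> \<and> E \<in> \<D> \<and> y \<in> Q \<and> ys \<in> lists Q \<and> D \<subseteq> E}"
  define V where "V = (\<lambda>(D, E, y, ys). {x \<in> P. invariant D (x # xs) \<and> invariant E (y # ys) \<and>
      intertwines id D (y # ys) (x # xs) \<longrightarrow>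
      (\<exists>g\<in>P. agree_on D g id \<and> intertwines g E (y # ys) (x # xs))})"
  define U where "U D = {x \<in> P. \<exists>E\<in>\<D>. D \<subseteq> E \<and> invariant E (x # xs)}" for D
  have "countable (\<D> \<times> \<D> \<times> Q \<times> lists Q)"
    using countable_pieces Q(2) by (intro countable_SIGMA countable_lists)
  then have "countable J" by (rule countable_subset[rotated]) (auto simp: J_def)
  then have "comeager (\<Inter>j\<in>J. V j)"
  proof (rule comeager_INT)
    fix j assume "j \<in> J"
    then obtain D E y ys where j: "j = (D, E, y, ys)" "D \<in> \<D>" "E \<in> \<D>" "y \<in> Q" "ys \<in> lists Q" "D \<subseteq> E"
      unfolding J_def by blast
    have "y \<in> P" "ys \<in> lists P" using j Q(1) by auto
    then show "comeager (V j)"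
      unfolding j(1) V_def prod.case using j gen by (intro comeager_dense_open dense_open_absorb)
  qed
  moreover have "comeager (\<Inter>D\<in>\<D>. U D)"
    unfolding U_def by (intro comeager_INT countable_pieces comeager_dense_open dense_open_invariant gen)
  ultimately have "comeager ((\<Inter>j\<in>J. V j) \<inter> (\<Inter>D\<in>\<D>. U D))" by (rule comeager_Int)
  then show ?thesis
  proof (rule comeager_mono)
    show "P \<inter> ((\<Inter>j\<in>J. V j) \<inter> (\<Inter>D\<in>\<D>. U D)) \<subseteq> {x \<in> P. generic (x # xs)}"
    proof clarify
      fix x assume x: "x \<in> P" "x \<in> (\<Inter>j\<in>J. V j)" "x \<in> (\<Inter>D\<in>\<D>. U D)"
      have "\<exists>g\<in>P. agree_on D g id \<and> intertwines g E zs (x # xs)"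
        if h: "D \<in> \<D>" "E \<in> \<D>" "zs \<in> lists P" "D \<subseteq> E" "invariant D (x # xs)" "invariant E zs"
          "intertwines id D zs (x # xs)" for D E zs
      proof -
        have "\<exists>ys\<in>lists Q. list_all2 (agree_on E) ys zs" using h(3)
        proof (induction zs)
          case (Cons z zs)
          then obtain y ys where "y \<in> Q" "agree_on E y z" "ys \<in> lists Q" "list_all2 (agree_on E) ys zs"
            using Q(3)[of z E] h(2) by auto
          then show ?case by (intro bexI[of _ "y # ys"]) auto
        qed auto
        then obtain ys' where ys': "ys' \<in> lists Q" "list_all2 (agree_on E) ys' zs" by blast
        note transfer = agree_list_invariant[OF ys'(2)] agree_list_intertwines[OF ys'(2)]
        obtain y ys where yys: "ys' = y # ys"
          using intertwines_length[OF h(7)] ys'(2) by (cases ys') (auto dest: list_all2_lengthD)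
        have "(D, E, y, ys) \<in> J" using h ys'(1) yys by (simp add: J_def)
        then have "x \<in> V (D, E, y, ys)" using x(2) by blast
        then obtain g where "g \<in> P" "agree_on D g id" "intertwines g E (y # ys) (x # xs)"
          using h transfer(1) transfer(2)[of D id "x # xs"] yys unfolding V_def by auto
        then show ?thesis using transfer(2)[of E g "x # xs"] yys by auto
      qed
      moreover have "\<exists>E\<in>\<D>. D \<subseteq> E \<and> invariant E (x # xs)" if "D \<in> \<D>" for D
        using x(3) that unfolding U_def by blast
      ultimately show "generic (x # xs)" unfolding generic_def by blast
    qed
  qed
qed

end

context closed_permutation_group
begin

text \<open>
  Genericity relative to a conjugation: reduce to \<open>generic_absorb\<close> by replacing \<open>ys\<close> with its
  conjugate under \<open>g\<close>.
\<close>

lemma generic_absorb_along: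
  assumes gen: "generic xs" and D: "D \<in> \<D>" and E: "E \<in> \<D>" and ys: "ys \<in> lists P"
    and sub: "D \<subseteq> E" and inv: "invariant D ys" "invariant E ys"
    and g: "g \<in> P" "intertwines g D ys xs"
  obtains g' where "g' \<in> P" "agree_on D g' g" "intertwines g' E ys xs"
proof -
  define zs where "zs = map (\<lambda>y. g \<circ> y \<circ> perm_inv g) ys"
  have tw: "intertwines g A ys zs" for A
    using g(1) by (simp add: intertwines_def zs_def list_all2_conv_all_nth)
  have zs: "zs \<in> lists P" using ys g(1) by (auto simp: zs_def comp_in inv_in)
  have "intertwines (perm_inv g) (g ` D) zs ys"
    using intertwines_inv[OF tw bij_P[OF g(1)]] .
  moreover have "intertwines g (perm_inv g ` g ` D) ys xs" using g by simp
  ultimately have "intertwines (g \<circ> perm_inv g) (g ` D) zs xs" by (rule intertwines_comp)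
  moreover have "g \<circ> perm_inv g = id" using g(1) by (simp add: fun_eq_iff)
  ultimately have base: "intertwines id (g ` D) zs xs" by simp
  obtain k where k: "k \<in> P" "agree_on (g ` D) k id" "intertwines k (g ` E) zs xs"
  proof (rule generic_absorb[OF gen])
    show "g ` D \<in> \<D>" "g ` E \<in> \<D>" using g(1) D E by (simp_all add: image_piece)
    show "g ` D \<subseteq> g ` E" using sub by (rule image_mono)
    show "invariant (g ` D) xs" using g(2) inv(1) by (rule invariant_image)
    show "invariant (g ` E) zs" using tw inv(2) by (rule invariant_image)
  qed (use zs base in auto)
  show ?thesis
  proof (rule that)
    show "k \<circ> g \<in> P" using k g by (simp add: comp_in)
    show "agree_on D (k \<circ> g) g" using k(2) by (auto simp: agree_on_def)
    show "intertwines (k \<circ> g) E ys xs" using tw k(3) by (rule intertwines_comp)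
  qed
qed

text \<open>
  Back and forth: alternately absorb an invariant piece of \<open>xs\<close> into \<open>zs\<close> and one of \<open>zs\<close> into \<open>xs\<close>.
\<close>

lemma generic_conjugate:
  assumes xs: "generic xs" "xs \<in> lists P" and zs: "generic zs" "zs \<in> lists P"
    and D: "D \<in> \<D>" "invariant D xs" and g: "g \<in> P" "intertwines g D xs zs"
  obtains q where "q \<in> P" "agree_on D q g" "intertwines q \<Omega> xs zs"
proof -
  define I where "I k s \<longleftrightarrow> fst s \<in> P \<and> snd s \<in> \<D> \<and> invariant (snd s) xs \<and>
      intertwines (fst s) (snd s) xs zs" for k :: nat and s :: "('a \<Rightarrow> 'a) \<times> 'a set"
  obtain S q where S: "q \<in> P" "S 0 = (g, D)" "\<And>k. I k (S k)"
    "\<And>k. agree_on (snd (S k)) q (fst (S k))" "\<And>E. E \<in> \<D> \<Longrightarrow> \<exists>k. E \<subseteq> snd (S k)"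
  proof (rule fusion[of I fst snd "(g, D)" "\<lambda>_ _ _. True"])
    fix k :: nat and s :: "('a \<Rightarrow> 'a) \<times> 'a set" and E
    assume "I k s" and E: "E \<in> \<D>"
    obtain p A where s: "s = (p, A)" by (cases s)
    have p: "p \<in> P" "A \<in> \<D>" "invariant A xs" "intertwines p A xs zs"
      using \<open>I k s\<close> by (simp_all add: I_def s)
    obtain E0 where E0: "E0 \<in> \<D>" "A \<union> E \<subseteq> E0" using directed[OF p(2) E] by blast
    obtain E1 where E1: "E1 \<in> \<D>" "E0 \<subseteq> E1" "invariant E1 xs" by (rule generic_invariant[OF xs(1) E0(1)])
    have AE1: "A \<subseteq> E1" using E0 E1 by blast
    \<comment> \<open>forth: the domain swallows \<open>E\<close>\<close>
    obtain p1 where p1: "p1 \<in> P" "agree_on A p1 p" "intertwines p1 E1 xs zs"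
      by (rule generic_absorb_along[OF zs(1) p(2) E1(1) xs(2) AE1 p(3) E1(3) p(1,4)])
    obtain F0 where F0: "F0 \<in> \<D>" "p1 ` E1 \<union> E \<subseteq> F0"
      using directed[OF image_piece[OF p1(1) E1(1)] E] by blast
    obtain E2 where E2: "E2 \<in> \<D>" "F0 \<subseteq> E2" "invariant E2 zs" by (rule generic_invariant[OF zs(1) F0(1)])
    have p1E2: "p1 ` E1 \<subseteq> E2" using F0 E2 by blast
    \<comment> \<open>back: absorb \<open>E2\<close>, which contains \<open>E\<close>, along the inverse\<close>
    obtain v where v: "v \<in> P" "agree_on (p1 ` E1) v (perm_inv p1)" "intertwines v E2 zs xs"
      by (rule generic_absorb_along[OF xs(1) image_piece[OF p1(1) E1(1)] E2(1) zs(2) p1E2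
            invariant_image[OF p1(3) E1(3)] E2(3) inv_in[OF p1(1)]
            intertwines_inv[OF p1(3) bij_P[OF p1(1)]]])
    have v_p1: "v (p1 e) = e" if "e \<in> E1" for e
      using v(2) that p1(1) by (simp add: agree_on_def)
    have "E1 \<subseteq> v ` E2"
    proof
      fix e assume "e \<in> E1"
      then have "e = v (p1 e)" "p1 e \<in> E2" using v_p1 p1E2 by auto
      then show "e \<in> v ` E2" by (rule image_eqI)
    qed
    moreover have "agree_on E1 (perm_inv v) p1"
      unfolding agree_on_def using v_p1 v(1) inv_P_simps(1) by metis
    then have "agree_on A (perm_inv v) p"
      using AE1 p1(2) by (meson agree_on_subset agree_on_trans)
    moreover have "perm_inv v ` v ` E2 = E2" using v(1) by simp
    moreover have "I (Suc k) (perm_inv v, v ` E2)"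
      using v E2 intertwines_inv[OF v(3) bij_P[OF v(1)]] invariant_image[OF v(3) E2(3)]
      by (simp add: I_def inv_in image_piece)
    ultimately show "\<exists>s'. I (Suc k) s' \<and> True \<and> snd s \<union> E \<subseteq> snd s' \<and> E \<subseteq> fst s' ` snd s' \<and>
            agree_on (snd s) (fst s') (fst s)"
      using E0(2) E1(2) F0(2) E2(2) by (intro exI[of _ "(perm_inv v, v ` E2)"]) (auto simp: s)
  next
    fix S q assume "q \<in> P" "S 0 = (g, D)" "\<And>k. I k (S k)"
      "\<And>k. agree_on (snd (S k)) q (fst (S k))" "\<And>E. E \<in> \<D> \<Longrightarrow> \<exists>k. E \<subseteq> snd (S k)"
    then show thesis by (rule that)
  qed (use D g in \<open>simp_all add: I_def\<close>)
  show ?thesis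
  proof (rule that)
    show "q \<in> P" by (rule S(1))
    show "agree_on D q g" using S(2) S(4)[of 0] by simp
    have len: "length xs = length zs" using g(2) by (rule intertwines_length)
    have "q ((xs ! i) e) = (zs ! i) (q e)" if i: "i < length xs" and e: "e \<in> \<Omega>" for i e
    proof -
      obtain F where "F \<in> \<D>" "e \<in> F" using e pieces_cover by blast
      then obtain k where k: "e \<in> snd (S k)" using S(5) by blast
      have "intertwines q (snd (S k)) xs zs"
        using S(3)[of k] S(4)[of k] by (auto simp: I_def intro: intertwines_agree agree_on_sym)
      then show ?thesis using i k by (simp add: intertwines_def list_all2_conv_all_nth)
    qed
    then show "intertwines q \<Omega> xs zs"
      using len by (simp add: intertwines_def list_all2_conv_all_nth)
  qed
qed

subsection \<open>Countably syndetic sets\<close>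

text \<open>
  \<open>S\<close> is nonmeager in every nonempty open subset of the pointwise stabiliser of \<open>D\<close>.
\<close>

definition everywhere_nonmeager :: "'a set \<Rightarrow> ('a \<Rightarrow> 'a) set \<Rightarrow> bool" where
  "everywhere_nonmeager D S \<longleftrightarrow>
     (\<forall>C p E. comeager C \<and> p \<in> P \<and> agree_on D p id \<and> E \<in> \<D> \<longrightarrow>
        (\<exists>s\<in>S. s \<in> C \<and> s \<in> P \<and> agree_on E s p))"

lemma everywhere_nonmeagerD:
  assumes "everywhere_nonmeager D S" "comeager C" "p \<in> P" "agree_on D p id" "E \<in> \<D>"
  obtains s where "s \<in> S" "s \<in> C" "s \<in> P" "agree_on E s p"
  using assms unfolding everywhere_nonmeager_def by (elim allE impE) auto

lemma everywhere_nonmeager_translate: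
  assumes S: "everywhere_nonmeager D S" and p: "p \<in> P" and q: "q \<in> P"
    and fixed: "agree_on D (q \<circ> p) id"
  shows "everywhere_nonmeager (perm_inv q ` D) ((\<lambda>s. p \<circ> s \<circ> q) ` S)"
  unfolding everywhere_nonmeager_def
proof (intro allI impI, elim conjE)
  fix C r E assume C: "comeager C" and r: "r \<in> P" "agree_on (perm_inv q ` D) r id" and E: "E \<in> \<D>"
  obtain s where s: "s \<in> S" "s \<in> {v \<in> P. p \<circ> v \<circ> q \<in> C}" "s \<in> P"
    "agree_on (q ` E) s (perm_inv p \<circ> r \<circ> perm_inv q)"
  proof (rule everywhere_nonmeagerD[OF S comeager_translate[OF C p q]])
    show "perm_inv p \<circ> r \<circ> perm_inv q \<in> P" using p q r by (simp add: comp_in inv_in)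
    show "q ` E \<in> \<D>" using q E by (rule image_piece)
    show "agree_on D (perm_inv p \<circ> r \<circ> perm_inv q) id"
      unfolding agree_on_def
    proof
      fix d assume d: "d \<in> D"
      have "r (perm_inv q d) = perm_inv q d" using r(2) d by (simp add: agree_on_def)
      moreover have "q (p d) = d" using fixed d by (simp add: agree_on_def)
      then have "perm_inv q d = p d" using q by (metis inv_P_simps(1))
      ultimately show "(perm_inv p \<circ> r \<circ> perm_inv q) d = id d" using p by simp
    qed
  qed
  have "agree_on E (p \<circ> s \<circ> q) r" using s(4) p q by (auto simp: agree_on_def)
  then show "\<exists>t\<in>(\<lambda>s. p \<circ> s \<circ> q) ` S. t \<in> C \<and> t \<in> P \<and> agree_on E t r"
    using s p q by (auto simp: comp_in)
qed

text \<open>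
  One of countably many covering sets is nonmeager in every open part of some basic open set. Otherwise
  the basic open sets in which the \<open>n\<close>-th set is meager have dense union; only countably many basic open sets
  occur, so a point generic for all of them lies in no covering set.
\<close>

lemma nonmeager_translate:
  fixes k :: "nat \<Rightarrow> 'a \<Rightarrow> 'a"
  assumes cover: "\<And>p. p \<in> P \<Longrightarrow> \<exists>n. perm_inv (k n) \<circ> p \<in> W"
  obtains n p D where "p \<in> P" "D \<in> \<D>"
    "\<And>C q E. comeager C \<Longrightarrow> q \<in> P \<Longrightarrow> agree_on D q p \<Longrightarrow> E \<in> \<D> \<Longrightarrow>
       \<exists>s\<in>C. s \<in> P \<and> perm_inv (k n) \<circ> s \<in> W \<and> agree_on E s q"
proof (rule ccontr)
  \<comment> \<open>\<open>C\<close> witnesses that \<open>k\<^sub>n W\<close> is meager in the basic open set of \<open>q\<close> and \<open>E\<close>\<close>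
  define avoid where "avoid n q E C \<longleftrightarrow> comeager C \<and>
      (\<forall>s\<in>C. s \<in> P \<longrightarrow> agree_on E s q \<longrightarrow> perm_inv (k n) \<circ> s \<notin> W)" for n q E C
  note witness = that
  assume "\<not> thesis"
  have dense: "\<exists>q E C. q \<in> P \<and> agree_on D q p \<and> E \<in> \<D> \<and> avoid n q E C"
    if h: "p \<in> P" "D \<in> \<D>" for n p D
  proof (rule ccontr)
    assume *: "\<not> (\<exists>q E C. q \<in> P \<and> agree_on D q p \<and> E \<in> \<D> \<and> avoid n q E C)"
    have "\<exists>s\<in>C. s \<in> P \<and> perm_inv (k n) \<circ> s \<in> W \<and> agree_on E s q"
      if "comeager C" "q \<in> P" "agree_on D q p" "E \<in> \<D>" for C q E
    proof -
      have "\<not> avoid n q E C" using * that by simp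
      then show ?thesis using that(1) by (auto simp: avoid_def)
    qed
    then show False using \<open>\<not> thesis\<close> witness[of p D n] h by blast
  qed
  have avoid_cong: "avoid n q E C \<longleftrightarrow> avoid n q' E C" if "agree_on E q q'" for n q q' E C
    using that by (simp add: avoid_def agree_on_def)
  define U where "U n = {q \<in> P. \<exists>E\<in>\<D>. \<exists>C. avoid n q E C}" for n
  have "dense_open (U n)" for n
    unfolding dense_open_def
  proof (intro conjI ballI)
    fix p D assume "p \<in> P" "D \<in> \<D>"
    from dense[OF this, of n] obtain q E C where "q \<in> P" "agree_on D q p" "E \<in> \<D>" "avoid n q E C"
      by blast
    then show "\<exists>q\<in>U n. q \<in> P \<and> agree_on D q p" unfolding U_def by (intro bexI[of _ q]) auto
  next
    fix p assume "p \<in> U n"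
    then obtain E C where E: "E \<in> \<D>" "avoid n p E C" unfolding U_def by blast
    have "q \<in> U n" if "q \<in> P" "agree_on E q p" for q
      using E that(1) avoid_cong[OF that(2), of n C] unfolding U_def by blast
    then show "\<exists>D\<in>\<D>. \<forall>q\<in>P. agree_on D q p \<longrightarrow> q \<in> U n"
      using E(1) by (intro bexI[of _ E] ballI impI)
  qed
  then have comU: "comeager (\<Inter>n\<in>UNIV. U n)" by (intro comeager_INT comeager_dense_open) auto
  obtain Q where Q: "Q \<subseteq> P" "countable Q" "\<And>p D. p \<in> P \<Longrightarrow> D \<in> \<D> \<Longrightarrow> \<exists>q\<in>Q. agree_on D q p"
    using separable by blast
  define C where "C j = (case j of (n, q, E) \<Rightarrow> if \<exists>C. avoid n q E C then SOME C. avoid n q E C else P)" for j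
  have C: "avoid n q E (C (n, q, E))" if "avoid n q E C'" for n q E C'
    using that someI_ex[of "avoid n q E"] by (auto simp: C_def)
  have "comeager (C j)" for j
  proof (cases j)
    case (fields n q E)
    show ?thesis
    proof (cases "\<exists>C. avoid n q E C")
      case True
      then have "avoid n q E (C j)" using C fields by blast
      then show ?thesis by (simp add: avoid_def)
    next
      case False
      then show ?thesis using comeager_P by (auto simp: C_def fields)
    qed
  qed
  moreover have "countable ((UNIV :: nat set) \<times> Q \<times> \<D>)"
    using Q(2) countable_pieces by (intro countable_SIGMA) auto
  ultimately have "comeager (\<Inter>j\<in>(UNIV :: nat set) \<times> Q \<times> \<D>. C j)" by (intro comeager_INT)
  then have com: "comeager ((\<Inter>n\<in>UNIV. U n) \<inter> (\<Inter>j\<in>(UNIV :: nat set) \<times> Q \<times> \<D>. C j))"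
    using comU by (intro comeager_Int)
  obtain D where "D \<in> \<D>" using pieces_nonempty by blast
  then obtain r where r0: "r \<in> (\<Inter>n\<in>UNIV. U n) \<inter> (\<Inter>j\<in>UNIV \<times> Q \<times> \<D>. C j)" "r \<in> P"
    by (elim baire[OF com id_in, THEN bexE] conjE)
  have r: "r \<in> P" "\<And>n. r \<in> U n" "\<And>j. j \<in> UNIV \<times> Q \<times> \<D> \<Longrightarrow> r \<in> C j"
    using r0 by auto
  obtain n where n: "perm_inv (k n) \<circ> r \<in> W" using cover[OF r(1)] by blast
  obtain E C' where E: "E \<in> \<D>" "avoid n r E C'" using r(2)[of n] unfolding U_def by blast
  obtain q where q: "q \<in> Q" "agree_on E q r" using Q(3)[OF r(1) E(1)] by blast
  have "avoid n q E C'" using E(2) avoid_cong[OF q(2)] by simp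
  then have "avoid n q E (C (n, q, E))" by (rule C)
  moreover have "r \<in> C (n, q, E)" using r(3) q(1) E(1) by simp
  ultimately show False using n r(1) agree_on_sym[OF q(2)] by (simp add: avoid_def)
qed

text \<open>
  Left translation turns the nonmeager covering set into a quotient set that is nonmeager near the identity.
\<close>

lemma syndetic_quotient_nonmeager:
  fixes k :: "nat \<Rightarrow> 'a \<Rightarrow> 'a"
  assumes k: "\<And>n. k n \<in> P" and W: "W \<subseteq> P"
    and cover: "\<And>p. p \<in> P \<Longrightarrow> \<exists>n. perm_inv (k n) \<circ> p \<in> W"
  obtains w D where "w \<in> W" "D \<in> \<D>" "everywhere_nonmeager D ((\<lambda>v. perm_inv w \<circ> v) ` W)"
proof -
  obtain n p D where D: "p \<in> P" "D \<in> \<D>"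
    "\<And>C q E. comeager C \<Longrightarrow> q \<in> P \<Longrightarrow> agree_on D q p \<Longrightarrow> E \<in> \<D> \<Longrightarrow>
       \<exists>s\<in>C. s \<in> P \<and> perm_inv (k n) \<circ> s \<in> W \<and> agree_on E s q"
    by (rule nonmeager_translate[OF cover]) blast+
  obtain s0 where s0: "s0 \<in> P" "perm_inv (k n) \<circ> s0 \<in> W" "agree_on D s0 p"
    using D(3)[OF comeager_P D(1) agree_on_refl D(2)] by blast
  have "everywhere_nonmeager D ((\<lambda>v. perm_inv (perm_inv (k n) \<circ> s0) \<circ> v) ` W)"
    unfolding everywhere_nonmeager_def
  proof (intro allI impI, elim conjE)
    fix C q E assume C: "comeager C" and q: "q \<in> P" "agree_on D q id" and E: "E \<in> \<D>"
    have "agree_on D (s0 \<circ> q) p" using q(2) s0(3) by (simp add: agree_on_def)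
    moreover have "comeager {v \<in> P. perm_inv s0 \<circ> v \<circ> id \<in> C}"
      by (rule comeager_translate[OF C inv_in[OF s0(1)] id_in])
    ultimately obtain s where s: "s \<in> P" "perm_inv s0 \<circ> s \<in> C" "perm_inv (k n) \<circ> s \<in> W" "agree_on E s (s0 \<circ> q)"
      using D(3)[of _ "s0 \<circ> q" E] comp_in[OF s0(1) q(1)] E by fastforce
    have "perm_inv (perm_inv (k n) \<circ> s0) = perm_inv s0 \<circ> k n"
      using o_inv_distrib[of "perm_inv (k n)" s0] bij_P k s0(1) by (simp add: inv_in inv_inv_eq)
    then have "perm_inv (perm_inv (k n) \<circ> s0) \<circ> (perm_inv (k n) \<circ> s) = perm_inv s0 \<circ> s"
      using k by (simp add: fun_eq_iff)
    then have "perm_inv s0 \<circ> s \<in> (\<lambda>v. perm_inv (perm_inv (k n) \<circ> s0) \<circ> v) ` W" using s(3) by (metis imageI)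
    moreover have "agree_on E (perm_inv s0 \<circ> s) q" using s(4) s0(1) by (simp add: agree_on_def)
    ultimately show "\<exists>t\<in>(\<lambda>v. perm_inv (perm_inv (k n) \<circ> s0) \<circ> v) ` W. t \<in> C \<and> t \<in> P \<and> agree_on E t q"
      using s(1,2) s0(1) by (intro bexI[of _ "perm_inv s0 \<circ> s"]) (auto simp: comp_in inv_in)
  qed
  then show ?thesis using that s0(2) D(2) by blast
qed

text \<open>
  Otherwise let \<open>g\<close> fix \<open>D\<close> and lie outside the product. Both \<open>S = w\<^sup>-\<^sup>1 W\<close> and \<open>B\<^sub>n = k\<^sub>n g S k\<^sub>n\<^sup>-\<^sup>1\<close>
  are nonmeager near the identity, so \<open>x\<^sub>n \<in> S\<close> and \<open>y\<^sub>n \<in> B\<^sub>n\<close> can be picked generic over the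
  earlier choices and trivial on any given piece. Extending the conjugacy by \<open>generic_conjugate\<close> at
  each step gives in the limit one \<open>q\<close> with \<open>q x\<^sub>n = y\<^sub>n q\<close> for all \<open>n\<close>. Since \<open>q \<in> k\<^sub>n W\<close> for some
  \<open>n\<close>, this equation expresses \<open>g\<close> as a product of six elements of \<open>W\<close>.
\<close>

theorem stabilizer_in_sixfold_product:
  fixes k :: "nat \<Rightarrow> 'a \<Rightarrow> 'a"
  assumes k: "\<And>n. k n \<in> P" and W: "W \<subseteq> P" and W_inv: "\<And>w. w \<in> W \<Longrightarrow> perm_inv w \<in> W"
    and cover: "\<And>p. p \<in> P \<Longrightarrow> \<exists>n. perm_inv (k n) \<circ> p \<in> W"
  obtains D where "D \<in> \<D>"
    "\<And>g. g \<in> P \<Longrightarrow> agree_on D g id \<Longrightarrow>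
       \<exists>a\<in>W. \<exists>b\<in>W. \<exists>c\<in>W. \<exists>d\<in>W. \<exists>e\<in>W. \<exists>f\<in>W. g = a \<circ> b \<circ> c \<circ> d \<circ> e \<circ> f"
proof -
  obtain w D where w: "w \<in> W" and D: "D \<in> \<D>" and S: "everywhere_nonmeager D ((\<lambda>v. perm_inv w \<circ> v) ` W)"
    by (rule syndetic_quotient_nonmeager[OF k W cover])
  have "\<exists>a\<in>W. \<exists>b\<in>W. \<exists>c\<in>W. \<exists>d\<in>W. \<exists>e\<in>W. \<exists>f\<in>W. g = a \<circ> b \<circ> c \<circ> d \<circ> e \<circ> f"
    if g: "g \<in> P" "agree_on D g id" for g
  proof -
    define B where "B n = (\<lambda>s. (k n \<circ> g) \<circ> s \<circ> perm_inv (k n)) ` (\<lambda>v. perm_inv w \<circ> v) ` W" for n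
    have B: "everywhere_nonmeager (perm_inv (perm_inv (k n)) ` D) (B n)" for n
      unfolding B_def
      by (rule everywhere_nonmeager_translate[OF S])
         (use g k[of n] in \<open>auto simp: comp_in inv_in agree_on_def\<close>)
    \<comment> \<open>\<open>zs\<close> lists the pairs \<open>(x\<^sub>i, y\<^sub>i)\<close> chosen so far, most recent first, and \<open>h\<close> conjugates them\<close>
    define I where "I j s \<longleftrightarrow> (case s of (h, A, zs) \<Rightarrow> h \<in> P \<and> A \<in> \<D> \<and>
        generic (map fst zs) \<and> map fst zs \<in> lists P \<and> generic (map snd zs) \<and> map snd zs \<in> lists P \<and>
        intertwines h \<Omega> (map fst zs) (map snd zs))"
      for j :: nat and s :: "('a \<Rightarrow> 'a) \<times> 'a set \<times> (('a \<Rightarrow> 'a) \<times> ('a \<Rightarrow> 'a)) list"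
    define R where "R j s s' \<longleftrightarrow> (\<exists>x\<in>(\<lambda>v. perm_inv w \<circ> v) ` W. \<exists>y\<in>B j. snd (snd s') = (x, y) # snd (snd s))"
      for j :: nat and s s' :: "('a \<Rightarrow> 'a) \<times> 'a set \<times> (('a \<Rightarrow> 'a) \<times> ('a \<Rightarrow> 'a)) list"
    obtain T q where T: "q \<in> P" "\<And>j. I j (T j)" "\<And>j. R j (T j) (T (Suc j))"
      "\<And>j. fst (snd (T j)) \<subseteq> fst (snd (T (Suc j)))" "\<And>j. agree_on (fst (snd (T j))) q (fst (T j))"
      "\<And>E. E \<in> \<D> \<Longrightarrow> \<exists>j. E \<subseteq> fst (snd (T j))"
    proof (rule fusion[of I fst "\<lambda>s. fst (snd s)" "(id, D, [])" R])
      fix j s E assume "I j s" and E: "E \<in> \<D>"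
      obtain h A zs where s: "s = (h, A, zs)" by (cases s)
      have h: "h \<in> P" and A: "A \<in> \<D>"
        and xs: "generic (map fst zs)" "map fst zs \<in> lists P"
        and ys: "generic (map snd zs)" "map snd zs \<in> lists P"
        and tw: "intertwines h \<Omega> (map fst zs) (map snd zs)"
        using \<open>I j s\<close> by (simp_all add: I_def s)
      obtain A1 where A1: "A1 \<in> \<D>" "A \<subseteq> A1" "invariant A1 (map fst zs)"
        by (rule generic_invariant[OF xs(1) A])
      obtain x where x: "x \<in> (\<lambda>v. perm_inv w \<circ> v) ` W" "x \<in> {x \<in> P. generic (x # map fst zs)}" "x \<in> P"
        "agree_on A1 x id"
        by (rule everywhere_nonmeagerD[OF S comeager_generic[OF xs] id_in agree_on_refl A1(1)])
      obtain y where y: "y \<in> B j" "y \<in> {y \<in> P. generic (y # map snd zs)}" "y \<in> P"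
        "agree_on (h ` A1) y id"
        by (rule everywhere_nonmeagerD[OF B comeager_generic[OF ys] id_in agree_on_refl
              image_piece[OF h A1(1)]])
      have "A1 \<subseteq> \<Omega>" using A1(1) pieces_cover by blast
      then have tw': "intertwines h A1 (x # map fst zs) (y # map snd zs)"
        using intertwines_subset[OF tw] x(4) y(4) by (simp add: agree_on_def)
      have inv: "invariant A1 (x # map fst zs)" using A1(3) x(4) by (simp add: agree_on_def)
      obtain h' where h': "h' \<in> P" "agree_on A1 h' h" "intertwines h' \<Omega> (x # map fst zs) (y # map snd zs)"
      proof (rule generic_conjugate[OF _ _ _ _ A1(1) inv h tw'])
        show "generic (x # map fst zs)" "generic (y # map snd zs)" using x y by simp_all
        show "x # map fst zs \<in> lists P" "y # map snd zs \<in> lists P" using x(3) y(3) xs ys by simp_all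
      qed
      obtain A2 where A2: "A2 \<in> \<D>" "A1 \<union> E \<union> perm_inv h' ` E \<subseteq> A2"
        using directed3[OF A1(1) E image_piece[OF inv_in[OF h'(1)] E]] by blast
      have "h' ` perm_inv h' ` E \<subseteq> h' ` A2" using A2(2) by (intro image_mono) blast
      then have "E \<subseteq> h' ` A2" using h'(1) by simp
      moreover have "agree_on A h' h" using h'(2) A1(2) by (rule agree_on_subset)
      moreover have "I (Suc j) (h', A2, (x, y) # zs)"
        using h' A2 x y xs ys by (simp add: I_def)
      moreover have "R j s (h', A2, (x, y) # zs)" using x y by (auto simp: R_def s)
      ultimately show "\<exists>s'. I (Suc j) s' \<and> R j s s' \<and> fst (snd s) \<union> E \<subseteq> fst (snd s') \<and>
            E \<subseteq> fst s' ` fst (snd s') \<and> agree_on (fst (snd s)) (fst s') (fst s)"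
        using A1(2) A2(2) by (intro exI[of _ "(h', A2, (x, y) # zs)"]) (auto simp: s)
    next
      fix T q assume T: "q \<in> P" "T 0 = (id, D, [])" "\<And>j. I j (T j)" "\<And>j. R j (T j) (T (Suc j))"
        "\<And>j. fst (snd (T j)) \<subseteq> fst (snd (T (Suc j)))" "\<And>j. agree_on (fst (snd (T j))) q (fst (T j))"
        "\<And>E. E \<in> \<D> \<Longrightarrow> \<exists>j. E \<subseteq> fst (snd (T j))"
      show thesis by (rule that[OF T(1,3-7)])
    qed (use D id_in generic_Nil in \<open>auto simp: I_def\<close>)
    obtain n where n: "perm_inv (k n) \<circ> q \<in> W" using cover[OF T(1)] by blast
    obtain x y where x: "x \<in> (\<lambda>v. perm_inv w \<circ> v) ` W" and y: "y \<in> B n"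
      and xy: "snd (snd (T (Suc n))) = (x, y) # snd (snd (T n))"
      using T(3)[of n] unfolding R_def by blast
    have xy_in: "(x, y) \<in> set (snd (snd (T j)))" if "Suc n \<le> j" for j
      using that
    proof (induction j rule: nat_induct_at_least)
      case (Suc j)
      then show ?case using T(3)[of j] by (auto simp: R_def)
    qed (simp add: xy)
    have piece_mono: "fst (snd (T i)) \<subseteq> fst (snd (T j))" if "i \<le> j" for i j
      using lift_Suc_mono_le[of "\<lambda>j. fst (snd (T j))", OF T(4) that] .
    have xyP: "x \<in> P" "y \<in> P"
      using T(2)[of "Suc n"] xy by (auto simp: I_def split: prod.splits)
    have qx: "q (x e) = y (q e)" for e
    proof (cases "e \<in> \<Omega>")
      case True
      then obtain F where F: "F \<in> \<D>" "e \<in> F" using pieces_cover by blast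
      obtain F' where F': "F' \<in> \<D>" "F \<union> x ` F \<subseteq> F'"
        using directed[OF F(1) image_piece[OF xyP(1) F(1)]] by blast
      obtain i where "F' \<subseteq> fst (snd (T i))" using T(6)[OF F'(1)] by blast
      define j where "j = max i (Suc n)"
      have "F' \<subseteq> fst (snd (T j))" using \<open>F' \<subseteq> _\<close> piece_mono[of i j] by (simp add: j_def)
      moreover have "e \<in> F'" "x e \<in> F'" using F(2) F'(2) by auto
      ultimately have "e \<in> fst (snd (T j))" "x e \<in> fst (snd (T j))" by auto
      then have "q e = fst (T j) e" "q (x e) = fst (T j) (x e)"
        using T(5)[of j] by (simp_all add: agree_on_def)
      moreover have "fst (T j) (x e) = y (fst (T j) e)"
      proof -
        obtain i where "i < length (snd (snd (T j)))" "snd (snd (T j)) ! i = (x, y)"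
          using xy_in[of j] by (auto simp: j_def in_set_conv_nth)
        then show ?thesis
          using T(2)[of j] True
          by (force simp: I_def intertwines_def list_all2_conv_all_nth split: prod.splits)
      qed
      ultimately show ?thesis by simp
    next
      case False
      then show ?thesis using permutes[OF T(1)] permutes[OF xyP(1)] permutes[OF xyP(2)]
        by (simp add: permutes_not_in)
    qed
    obtain v' where v': "v' \<in> W" "x = perm_inv w \<circ> v'" using x by blast
    obtain v where v: "v \<in> W" "y = (k n \<circ> g) \<circ> (perm_inv w \<circ> v) \<circ> perm_inv (k n)" using y unfolding B_def by blast
    define u where "u = perm_inv (k n) \<circ> q"
    have uW: "u \<in> W" using n by (simp add: u_def)
    have inP: "u \<in> P" "v \<in> P" "v' \<in> P" "w \<in> P" using uW v v' w W by auto
    have "g (perm_inv w (v (u e))) = u (perm_inv w (v' e))" for e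
      using qx[of e] v(2) v'(2) k[of n] unfolding u_def by (metis comp_apply inv_P_simps(1))
    from this[of "perm_inv u (perm_inv v (w e))" for e] have "g e = u (perm_inv w (v' (perm_inv u (perm_inv v (w e)))))" for e
      using inP by simp
    then have "g = u \<circ> perm_inv w \<circ> v' \<circ> perm_inv u \<circ> perm_inv v \<circ> w" by (simp add: fun_eq_iff)
    then show ?thesis using uW W_inv w v v' by blast
  qed
  then show ?thesis using that D by blast
qed

end

section \<open>Metric structures and their automorphisms\<close>

text \<open>
  These rules rewrite a length under a membership premise, so the simplifier does not terminate when
  \<open>nlists\<close> is unfolded.
\<close>

declare nlistsE_length [simp del] nlistsE_set [simp del]

locale metric_fo_structure =
  fixes L :: "('f, 'r) fo_language" and M :: "('f, 'r, 'a) fo_struct" and m :: "'a metric"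
  assumes dist_symbols: "contains_dist L" and metric_structure: "metric_structure L M m"
begin

abbreviation "X \<equiv> universe M"
abbreviation "d \<equiv> mdist m"
abbreviation "Aut \<equiv> aut L M"
abbreviation "G \<equiv> aut_group L M"
abbreviation "T \<equiv> aut_topology L M m"

lemma mspace_eq: "mspace m = X"
  using metric_structure by (simp add: metric_structure_def)

sublocale Metric_space X d
  using Metric_space_mspace_mdist[of m] by (simp add: mspace_eq)

lemma mtopology_of_eq: "mtopology_of m = mtopology"
  by (simp add: mtopology_of_def mspace_eq)

lemma fun_int_in: "F \<in> fun_syms L \<Longrightarrow> xs \<in> nlists (fun_arity L F) X \<Longrightarrow> fun_int M F xs \<in> X"
  using metric_structure by (simp add: metric_structure_def fo_structure_def)

lemma X_nonempty: "X \<noteq> {}"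
  using metric_structure by (simp add: metric_structure_def fo_structure_def)

subsection \<open>The automorphism group\<close>

lemma autI:
  assumes "g \<in> extensional X" "bij_betw g X X"
    "\<And>F xs. F \<in> fun_syms L \<Longrightarrow> xs \<in> nlists (fun_arity L F) X \<Longrightarrow> g (fun_int M F xs) = fun_int M F (map g xs)"
    "\<And>R xs. R \<in> rel_syms L \<Longrightarrow> xs \<in> nlists (rel_arity L R) X \<Longrightarrow> map g xs \<in> rel_int M R \<longleftrightarrow> xs \<in> rel_int M R"
  shows "g \<in> Aut"
  using assms by (simp add: aut_def Bij_def substructure_iso_def)

lemma autD:
  assumes "g \<in> Aut"
  shows "g \<in> extensional X" "bij_betw g X X"
    "\<And>F xs. F \<in> fun_syms L \<Longrightarrow> xs \<in> nlists (fun_arity L F) X \<Longrightarrow> g (fun_int M F xs) = fun_int M F (map g xs)"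
    "\<And>R xs. R \<in> rel_syms L \<Longrightarrow> xs \<in> nlists (rel_arity L R) X \<Longrightarrow> map g xs \<in> rel_int M R \<longleftrightarrow> xs \<in> rel_int M R"
  using assms by (simp_all add: aut_def Bij_def substructure_iso_def)

lemma aut_in: "g \<in> Aut \<Longrightarrow> x \<in> X \<Longrightarrow> g x \<in> X"
  using autD(2) bij_betwE by blast

lemma map_aut_nlists:
  assumes "g \<in> Aut" "xs \<in> nlists k X"
  shows "map g xs \<in> nlists k X"
  using assms(2) aut_in[OF assms(1)] by (auto simp: nlists_def)

definition ainv :: "('a \<Rightarrow> 'a) \<Rightarrow> 'a \<Rightarrow> 'a" where
  "ainv g = restrict (inv_into X g) X"

lemma ainv_left: "g \<in> Aut \<Longrightarrow> x \<in> X \<Longrightarrow> ainv g (g x) = x"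
  using autD(2)[of g] aut_in[of g x] by (simp add: ainv_def bij_betw_inv_into_left)

lemma ainv_right: "g \<in> Aut \<Longrightarrow> x \<in> X \<Longrightarrow> g (ainv g x) = x"
  using autD(2)[of g] by (simp add: ainv_def bij_betw_inv_into_right)

lemma compose_aut: "g \<in> Aut \<Longrightarrow> f \<in> Aut \<Longrightarrow> compose X g f \<in> Aut"
proof (rule autI)
  assume g: "g \<in> Aut" and f: "f \<in> Aut"
  have map: "map (compose X g f) xs = map g (map f xs)" if "xs \<in> nlists k X" for k xs
    using that by (auto simp: nlists_def compose_def)
  show "compose X g f \<in> extensional X" by (rule compose_extensional)
  show "bij_betw (compose X g f) X X" using bij_betw_compose autD(2) f g by blast
  show "compose X g f (fun_int M F xs) = fun_int M F (map (compose X g f) xs)"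
    if "F \<in> fun_syms L" "xs \<in> nlists (fun_arity L F) X" for F xs
    using that f g map[OF that(2)] map_aut_nlists[OF f that(2)]
    by (simp add: compose_def fun_int_in autD(3) del: map_map)
  show "map (compose X g f) xs \<in> rel_int M R \<longleftrightarrow> xs \<in> rel_int M R"
    if "R \<in> rel_syms L" "xs \<in> nlists (rel_arity L R) X" for R xs
    using that f g map[OF that(2)] map_aut_nlists[OF f that(2)] by (simp add: autD(4) del: map_map)
qed

lemma ainv_aut: "g \<in> Aut \<Longrightarrow> ainv g \<in> Aut"
proof (rule autI)
  assume g: "g \<in> Aut"
  show "ainv g \<in> extensional X" by (simp add: ainv_def)
  show bij: "bij_betw (ainv g) X X"
    using bij_betw_inv_into[OF autD(2)[OF g]] by (simp add: ainv_def)
  have in_X: "ainv g x \<in> X" if "x \<in> X" for x using bij that bij_betwE by blast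
  have map: "map g (map (ainv g) xs) = xs" "map (ainv g) xs \<in> nlists k X" if "xs \<in> nlists k X" for k xs
    using that in_X ainv_right[OF g] by (auto simp: nlists_def subset_iff intro: map_idI)
  show "ainv g (fun_int M F xs) = fun_int M F (map (ainv g) xs)"
    if F: "F \<in> fun_syms L" "xs \<in> nlists (fun_arity L F) X" for F xs
    using autD(3)[OF g F(1) map(2)[OF F(2)]] map(1)[OF F(2)]
      ainv_left[OF g fun_int_in[OF F(1) map(2)[OF F(2)]]] by metis
  show "map (ainv g) xs \<in> rel_int M R \<longleftrightarrow> xs \<in> rel_int M R"
    if "R \<in> rel_syms L" "xs \<in> nlists (rel_arity L R) X" for R xs
    using autD(4)[OF g that(1) map(2)[OF that(2)]] map(1)[OF that(2)] by metis
qed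

lemma id_aut: "restrict (\<lambda>x. x) X \<in> Aut"
proof (rule autI)
  have map: "map (restrict (\<lambda>x. x) X) xs = xs" if "xs \<in> nlists k X" for k xs
    using that by (intro map_idI) (auto simp: nlists_def)
  show "bij_betw (restrict (\<lambda>x. x) X) X X" using id_Bij by (simp add: Bij_def)
  show "restrict (\<lambda>x. x) X (fun_int M F xs) = fun_int M F (map (restrict (\<lambda>x. x) X) xs)"
    if "F \<in> fun_syms L" "xs \<in> nlists (fun_arity L F) X" for F xs
    using map[OF that(2)] fun_int_in[OF that] by simp
  show "map (restrict (\<lambda>x. x) X) xs \<in> rel_int M R \<longleftrightarrow> xs \<in> rel_int M R"
    if "R \<in> rel_syms L" "xs \<in> nlists (rel_arity L R) X" for R xs
    using map[OF that(2)] by simp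
qed simp

lemma carrier_G [simp]: "carrier G = Aut"
  and one_G: "\<one>\<^bsub>G\<^esub> = restrict (\<lambda>x. x) X"
  by (simp_all add: aut_group_def BijGroup_def)

lemma Aut_Bij: "Aut \<subseteq> Bij X"
  by (auto simp: aut_def)

lemma mult_G: "g \<in> Aut \<Longrightarrow> f \<in> Aut \<Longrightarrow> g \<otimes>\<^bsub>G\<^esub> f = compose X g f"
  using Aut_Bij by (auto simp: aut_group_def BijGroup_def)

lemma aut_ext:
  assumes "g \<in> Aut" "f \<in> Aut" "\<And>x. x \<in> X \<Longrightarrow> g x = f x"
  shows "g = f"
  using assms autD(1) by (meson extensionalityI)

lemma group_G: "group G"
proof (rule groupI)
  fix f g h assume fgh: "f \<in> carrier G" "g \<in> carrier G" "h \<in> carrier G"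
  then show "f \<otimes>\<^bsub>G\<^esub> g \<otimes>\<^bsub>G\<^esub> h = f \<otimes>\<^bsub>G\<^esub> (g \<otimes>\<^bsub>G\<^esub> h)"
    by (simp add: mult_G compose_aut) (auto simp: compose_def aut_in[of g] aut_in[of h])
next
  fix g assume g: "g \<in> carrier G"
  show "\<one>\<^bsub>G\<^esub> \<otimes>\<^bsub>G\<^esub> g = g"
    using g by (intro aut_ext) (simp_all add: one_G mult_G id_aut compose_aut, simp add: compose_def aut_in[of g])
  have "ainv g \<otimes>\<^bsub>G\<^esub> g = \<one>\<^bsub>G\<^esub>"
    using g by (intro aut_ext) (simp_all add: one_G mult_G id_aut compose_aut ainv_aut, simp add: compose_def ainv_left)
  then show "\<exists>f\<in>carrier G. f \<otimes>\<^bsub>G\<^esub> g = \<one>\<^bsub>G\<^esub>" using g ainv_aut by auto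
qed (simp_all add: mult_G one_G id_aut compose_aut)

lemma inv_G: "g \<in> Aut \<Longrightarrow> inv\<^bsub>G\<^esub> g = ainv g"
proof (rule group.inv_equality[OF group_G])
  assume g: "g \<in> Aut"
  show "ainv g \<otimes>\<^bsub>G\<^esub> g = \<one>\<^bsub>G\<^esub>"
    using g by (intro aut_ext) (simp_all add: one_G mult_G id_aut compose_aut ainv_aut, simp add: compose_def ainv_left)
qed (simp_all add: ainv_aut)

text \<open>
  The symbols \<open>D\<^sub>r\<close> preserve all comparisons of a distance with rationals.
\<close>

lemma aut_isometry:
  assumes "g \<in> Aut" "x \<in> X" "y \<in> X"
  shows "d (g x) (g y) = d x y"
proof -
  have le: "d (g x) (g y) \<le> of_rat r \<longleftrightarrow> d x y \<le> of_rat r" if "r \<ge> 0" for r :: rat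
  proof -
    have "dist_sym L r \<in> rel_syms L" "rel_arity L (dist_sym L r) = 2"
      using dist_symbols that by (simp_all add: contains_dist_def)
    then have "[g x, g y] \<in> rel_int M (dist_sym L r) \<longleftrightarrow> [x, y] \<in> rel_int M (dist_sym L r)"
      using autD(4)[OF assms(1), of "dist_sym L r" "[x, y]"] assms by (simp add: nlists_def)
    then show ?thesis
      using metric_structure that assms(2,3) aut_in[OF assms(1)] by (simp add: metric_structure_def)
  qed
  have "\<not> a < b" if "a \<ge> 0" "\<And>r::rat. r \<ge> 0 \<Longrightarrow> a \<le> of_rat r \<longleftrightarrow> b \<le> of_rat r" for a b :: real
  proof
    assume "a < b"
    then obtain r where r: "a < of_rat r" "of_rat r < b" using of_rat_dense by blast
    then have "(0::real) \<le> of_rat r" using that(1) by linarith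
    then have "0 \<le> r" by simp
    then show False using that(2)[of r] r by linarith
  qed
  from this[of "d (g x) (g y)" "d x y"] this[of "d x y" "d (g x) (g y)"] show ?thesis
    using le by (meson linorder_neqE_linordered_idom mdist_nonneg)
qed

subsection \<open>Pointwise convergence\<close>

definition dense_in_X :: "'a set \<Rightarrow> bool" where
  "dense_in_X Y \<longleftrightarrow> Y \<subseteq> X \<and> (\<forall>x\<in>X. \<forall>\<epsilon>>0. \<exists>y\<in>Y. d x y < \<epsilon>)"

text \<open>
  Automorphisms are isometries, hence continuous.
\<close>

lemma aut_eq_on_dense:
  assumes "g \<in> Aut" "f \<in> Aut" "dense_in_X Y" "\<And>y. y \<in> Y \<Longrightarrow> g y = f y"
  shows "g = f"
proof (rule aut_ext[OF assms(1,2)])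
  fix x assume x: "x \<in> X"
  show "g x = f x"
  proof (rule ccontr)
    assume "g x \<noteq> f x"
    then have pos: "0 < d (g x) (f x)" using x assms(1,2) aut_in mdist_pos_less by blast
    then obtain y where y: "y \<in> Y" "d x y < d (g x) (f x) / 2"
      using assms(3) x unfolding dense_in_X_def by (meson half_gt_zero)
    then have yX: "y \<in> X" using assms(3) by (auto simp: dense_in_X_def)
    have "d (g x) (f x) \<le> d (g x) (g y) + d (g y) (f x)"
      using x yX aut_in[OF assms(1)] aut_in[OF assms(2)] by (intro triangle) auto
    also have "\<dots> = d x y + d y x"
      using assms(4)[OF y(1)] aut_isometry[OF assms(1) x yX] aut_isometry[OF assms(2) yX x] by simp
    also have "\<dots> < d (g x) (f x)" using y(2) commute by simp
    finally show False by simp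
  qed
qed

lemma pointwise_Cauchy:
  assumes Y: "dense_in_X Y" and g: "\<And>n. g n \<in> Aut"
    and cauchy: "\<And>y. y \<in> Y \<Longrightarrow> MCauchy (\<lambda>n. g n y)" and x: "x \<in> X"
  shows "MCauchy (\<lambda>n. g n x)"
  unfolding MCauchy_def
proof (intro conjI allI impI)
  show "range (\<lambda>n. g n x) \<subseteq> X" using x aut_in[OF g] by auto
  fix \<epsilon> :: real assume "\<epsilon> > 0"
  then obtain y where y: "y \<in> Y" "d x y < \<epsilon> / 3"
    using Y x unfolding dense_in_X_def by (meson divide_pos_pos zero_less_numeral)
  then have yX: "y \<in> X" using Y by (auto simp: dense_in_X_def)
  obtain N where N: "\<And>n n'. N \<le> n \<Longrightarrow> N \<le> n' \<Longrightarrow> d (g n y) (g n' y) < \<epsilon> / 3"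
    using cauchy[OF y(1)] \<open>\<epsilon> > 0\<close> unfolding MCauchy_def by (meson divide_pos_pos zero_less_numeral)
  have "d (g n x) (g n' x) < \<epsilon>" if "N \<le> n" "N \<le> n'" for n n'
  proof -
    have "d (g n x) (g n' x) \<le> d (g n x) (g n y) + d (g n y) (g n' x)"
      using x yX aut_in[OF g] by (intro triangle) auto
    also have "d (g n y) (g n' x) \<le> d (g n y) (g n' y) + d (g n' y) (g n' x)"
      using x yX aut_in[OF g] by (intro triangle) auto
    finally show ?thesis
      using aut_isometry[OF g x yX, of n] aut_isometry[OF g yX x, of n'] N[OF that] y(2) commute[of x y]
      by simp
  qed
  then show "\<exists>N. \<forall>n n'. N \<le> n \<longrightarrow> N \<le> n' \<longrightarrow> d (g n x) (g n' x) < \<epsilon>" by blast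
qed

text \<open>
  Pointwise convergence, stated for tuples in the topology in which symbols are continuous or closed.
\<close>

lemma pointwise_limit_map:
  assumes g: "\<And>n. g n \<in> Aut" and lim: "\<And>x. x \<in> X \<Longrightarrow> limitin mtopology (\<lambda>n. g n x) (h x) sequentially"
    and xs: "xs \<in> nlists k X"
  shows "limitin (power_topology (mtopology_of m) k) (\<lambda>n. \<lambda>i\<in>{..<k}. g n (xs ! i))
           (\<lambda>i\<in>{..<k}. h (xs ! i)) sequentially"
    and "map (\<lambda>i\<in>{..<k}. h (xs ! i)) [0..<k] = map h xs"
proof -
  have X: "xs ! i \<in> X" if "i < k" for i using xs that by (rule nlistsE_nth_in)
  show "limitin (power_topology (mtopology_of m) k) (\<lambda>n. \<lambda>i\<in>{..<k}. g n (xs ! i))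
           (\<lambda>i\<in>{..<k}. h (xs ! i)) sequentially"
    unfolding power_topology_def mtopology_of_eq limitin_componentwise
    using X aut_in[OF g] lim by (auto simp: PiE_iff)
  show "map (\<lambda>i\<in>{..<k}. h (xs ! i)) [0..<k] = map h xs"
    using xs by (intro nth_equalityI) (auto simp: nlists_def)
qed

text \<open>
  Completeness of the automorphism group for its two-sided uniformity. Convergence of the inverses is
  needed for surjectivity, and for the limit to reflect relations: closedness only gives preservation.
\<close>

lemma pointwise_limit_aut:
  assumes complete: mcomplete and Y: "dense_in_X Y" and g: "\<And>n. g n \<in> Aut"
    and cauchy: "\<And>y. y \<in> Y \<Longrightarrow> MCauchy (\<lambda>n. g n y)"
      "\<And>y. y \<in> Y \<Longrightarrow> MCauchy (\<lambda>n. ainv (g n) y)"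
  obtains h where "h \<in> Aut" "\<And>x. x \<in> X \<Longrightarrow> limitin mtopology (\<lambda>n. g n x) (h x) sequentially"
proof -
  have "\<exists>l. limitin mtopology (\<lambda>n. g n x) l sequentially" if "x \<in> X" for x
    using complete pointwise_Cauchy[OF Y g cauchy(1) that] unfolding mcomplete_def by blast
  then obtain h0 where h0: "\<And>x. x \<in> X \<Longrightarrow> limitin mtopology (\<lambda>n. g n x) (h0 x) sequentially"
    by metis
  have "\<exists>l. limitin mtopology (\<lambda>n. ainv (g n) x) l sequentially" if "x \<in> X" for x
    using complete pointwise_Cauchy[OF Y ainv_aut[OF g] cauchy(2) that] unfolding mcomplete_def by blast
  then obtain k where k: "\<And>x. x \<in> X \<Longrightarrow> limitin mtopology (\<lambda>n. ainv (g n) x) (k x) sequentially"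
    by metis
  define h where "h = restrict h0 X"
  have h: "limitin mtopology (\<lambda>n. g n x) (h x) sequentially" if "x \<in> X" for x
    using h0[OF that] that by (simp add: h_def)
  have hX: "h x \<in> X" and kX: "k x \<in> X" if "x \<in> X" for x
    using h[OF that] k[OF that] by (simp_all add: limitin_mspace)
  have kh: "k (h x) = x" if x: "x \<in> X" for x
  proof (rule limitin_metric_unique[OF k[OF hX[OF x]]])
    have "d (ainv (g n) (h x)) x = d (g n x) (h x)" for n
    proof -
      have "d (ainv (g n) (h x)) x = d (g n (ainv (g n) (h x))) (g n x)"
        using aut_isometry[OF g, of "ainv (g n) (h x)" x n] x hX[OF x] aut_in[OF ainv_aut[OF g]] by simp
      then show ?thesis using ainv_right[OF g hX[OF x]] commute by simp
    qed
    then show "limitin mtopology (\<lambda>n. ainv (g n) (h x)) x sequentially"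
      using h[OF x] x hX[OF x] aut_in[OF ainv_aut[OF g]] by (auto simp: limitin_metric_dist_null)
  qed simp
  have hk: "h (k x) = x" if x: "x \<in> X" for x
  proof (rule limitin_metric_unique[OF h[OF kX[OF x]]])
    have "d (g n (k x)) x = d (ainv (g n) x) (k x)" for n
    proof -
      have "d (g n (k x)) x = d (g n (k x)) (g n (ainv (g n) x))"
        using ainv_right[OF g x] by simp
      also have "\<dots> = d (k x) (ainv (g n) x)"
        using aut_isometry[OF g, of "k x" "ainv (g n) x" n] x kX[OF x] aut_in[OF ainv_aut[OF g]] by simp
      finally show ?thesis using commute by simp
    qed
    then show "limitin mtopology (\<lambda>n. g n (k x)) x sequentially"
      using k[OF x] x kX[OF x] aut_in[OF g] by (auto simp: limitin_metric_dist_null)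
  qed simp
  have rel: "map f xs \<in> rel_int M R"
    if f: "\<And>n. f' n \<in> Aut" "\<And>x. x \<in> X \<Longrightarrow> limitin mtopology (\<lambda>n. f' n x) (f x) sequentially"
      and R: "R \<in> rel_syms L" "xs \<in> nlists (rel_arity L R) X" "xs \<in> rel_int M R" for f f' R xs
  proof -
    define k where "k = rel_arity L R"
    have xs: "xs \<in> nlists k X" using R by (simp add: k_def)
    note lim = pointwise_limit_map[of f' f, OF f xs]
    have "(\<lambda>i\<in>{..<k}. f (xs ! i)) \<in>
        {a \<in> topspace (power_topology (mtopology_of m) k). map a [0..<k] \<in> rel_int M R}"
    proof (rule limitin_closedin[OF lim(1)])
      show "closedin (power_topology (mtopology_of m) k)
          {a \<in> topspace (power_topology (mtopology_of m) k). map a [0..<k] \<in> rel_int M R}"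
        using metric_structure R(1) by (simp add: metric_structure_def k_def)
      have "map (\<lambda>i\<in>{..<k}. f' n (xs ! i)) [0..<k] = map (f' n) xs" for n
        using xs by (intro nth_equalityI) (auto simp: nlists_def)
      moreover have "map (f' n) xs \<in> rel_int M R" for n using autD(4)[OF f(1) R(1,2)] R(3) by simp
      moreover have "(\<lambda>i\<in>{..<k}. f' n (xs ! i)) \<in> topspace (power_topology (mtopology_of m) k)" for n
        using aut_in[OF f(1)] nlistsE_nth_in[OF xs] by (auto simp: power_topology_def mspace_eq)
      ultimately show "\<forall>\<^sub>F n in sequentially. (\<lambda>i\<in>{..<k}. f' n (xs ! i)) \<in>
          {a \<in> topspace (power_topology (mtopology_of m) k). map a [0..<k] \<in> rel_int M R}"
        by simp
    qed auto
    then show ?thesis using lim(2) by simp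
  qed
  have "h \<in> Aut"
  proof (rule autI)
    show "h \<in> extensional X" by (simp add: h_def)
    show "bij_betw h X X" by (rule bij_betw_byWitness[of X k]) (use hk kh hX kX in auto)
    show "h (fun_int M F xs) = fun_int M F (map h xs)"
      if F: "F \<in> fun_syms L" "xs \<in> nlists (fun_arity L F) X" for F xs
    proof -
      define k where "k = fun_arity L F"
      have xs: "xs \<in> nlists k X" using F by (simp add: k_def)
      note lim = pointwise_limit_map[of g h, OF g h xs]
      have "continuous_map (power_topology (mtopology_of m) k) (mtopology_of m) (\<lambda>a. fun_int M F (map a [0..<k]))"
        using metric_structure F(1) by (simp add: metric_structure_def k_def)
      from continuous_map_limit[OF this lim(1)]
      have "limitin mtopology (\<lambda>n. fun_int M F (map (\<lambda>i\<in>{..<k}. g n (xs ! i)) [0..<k])) (fun_int M F (map h xs)) sequentially"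
        using lim(2) unfolding mtopology_of_eq by (simp add: o_def)
      moreover have "map (\<lambda>i\<in>{..<k}. g n (xs ! i)) [0..<k] = map (g n) xs" for n
        using xs by (intro nth_equalityI) (auto simp: nlists_def)
      ultimately have "limitin mtopology (\<lambda>n. g n (fun_int M F xs)) (fun_int M F (map h xs)) sequentially"
        using autD(3)[OF g F] by simp
      then show ?thesis by (rule limitin_metric_unique[OF h[OF fun_int_in[OF F]]]) simp
    qed
    show "map h xs \<in> rel_int M R \<longleftrightarrow> xs \<in> rel_int M R"
      if R: "R \<in> rel_syms L" "xs \<in> nlists (rel_arity L R) X" for R xs
    proof
      assume "xs \<in> rel_int M R" then show "map h xs \<in> rel_int M R" using rel[OF g h R] by blast
    next
      assume "map h xs \<in> rel_int M R"
      moreover have "map h xs \<in> nlists (rel_arity L R) X" using R(2) hX by (auto simp: nlists_def)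
      ultimately have "map k (map h xs) \<in> rel_int M R" using rel[OF ainv_aut[OF g] k R(1)] by blast
      moreover have "map k (map h xs) = xs"
        using R(2) kh unfolding map_map by (intro map_idI) (auto simp: nlists_def)
      ultimately show "xs \<in> rel_int M R" by simp
    qed
  qed
  then show ?thesis using that h by blast
qed

end

context metric_fo_structure
begin

subsection \<open>Basic neighbourhoods\<close>

definition near :: "'a set \<Rightarrow> real \<Rightarrow> ('a \<Rightarrow> 'a) \<Rightarrow> ('a \<Rightarrow> 'a) set" where
  "near F \<epsilon> g = {f \<in> Aut. \<forall>x\<in>F. d (f x) (g x) < \<epsilon>}"

lemma near_self: "g \<in> Aut \<Longrightarrow> F \<subseteq> X \<Longrightarrow> 0 < \<epsilon> \<Longrightarrow> g \<in> near F \<epsilon> g"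
  using aut_in[of g] by (auto simp: near_def)

lemma near_mono: "F \<subseteq> F' \<Longrightarrow> \<epsilon>' \<le> \<epsilon> \<Longrightarrow> near F' \<epsilon>' g \<subseteq> near F \<epsilon> g"
  by (force simp: near_def)

lemma T_eq: "T = subtopology (product_topology (\<lambda>_. mtopology) X) Aut"
  by (simp add: aut_topology_def mtopology_of_eq)

lemma aut_PiE: "g \<in> Aut \<Longrightarrow> g \<in> X \<rightarrow>\<^sub>E X"
  using aut_in[of g] autD(1)[of g] by (auto simp: PiE_def)

lemma topspace_T [simp]: "topspace T = Aut"
  using aut_PiE by (auto simp: T_eq)

lemma openin_near:
  assumes F: "finite F" "F \<subseteq> X" and g: "g \<in> Aut"
  shows "openin T (near F \<epsilon> g)"
proof -
  define S where "S x = {f \<in> topspace (product_topology (\<lambda>_. mtopology) X). f x \<in> mball (g x) \<epsilon>}" for x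
  have "openin (product_topology (\<lambda>_. mtopology) X) (S x)" if "x \<in> F" for x
    unfolding S_def using that F(2)
    by (intro openin_continuous_map_preimage[OF continuous_map_product_projection]) auto
  then have "openin (product_topology (\<lambda>_. mtopology) X)
      (\<Inter>(insert (topspace (product_topology (\<lambda>_. mtopology) X)) (S ` F)))"
    using F(1) by (intro openin_Inter) (auto simp del: topspace_product_topology)
  moreover have "near F \<epsilon> g = \<Inter>(insert (topspace (product_topology (\<lambda>_. mtopology) X)) (S ` F)) \<inter> Aut"
  proof (intro subset_antisym subsetI)
    fix f assume f: "f \<in> near F \<epsilon> g"
    then have fA: "f \<in> Aut" by (simp add: near_def)
    have "f \<in> S x" if "x \<in> F" for x
      using f that F(2) aut_PiE[OF fA] aut_in[OF fA, of x] aut_in[OF g, of x] commute[of "f x" "g x"]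
      by (auto simp: near_def S_def)
    then show "f \<in> \<Inter>(insert (topspace (product_topology (\<lambda>_. mtopology) X)) (S ` F)) \<inter> Aut"
      using fA aut_PiE[OF fA] by auto
  next
    fix f assume "f \<in> \<Inter>(insert (topspace (product_topology (\<lambda>_. mtopology) X)) (S ` F)) \<inter> Aut"
    then show "f \<in> near F \<epsilon> g"
      using commute by (auto simp: near_def S_def)
  qed
  ultimately show ?thesis unfolding T_eq openin_subtopology by blast
qed

lemma openin_T_near:
  assumes U: "openin T U" and g: "g \<in> U"
  obtains F \<epsilon> where "finite F" "F \<subseteq> X" "0 < \<epsilon>" "near F \<epsilon> g \<subseteq> U"
proof -
  obtain V where V: "openin (product_topology (\<lambda>_. mtopology) X) V" "U = V \<inter> Aut"
    using U unfolding T_eq openin_subtopology by blast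
  then have "g \<in> V" "g \<in> Aut" using g by auto
  then obtain B where B: "finite {i \<in> X. B i \<noteq> X}" "\<And>i. i \<in> X \<Longrightarrow> openin mtopology (B i)"
    "g \<in> PiE X B" "PiE X B \<subseteq> V"
    using V(1) unfolding openin_product_topology_alt by force
  define F where "F = {i \<in> X. B i \<noteq> X}"
  have "\<exists>r>0. mball (g i) r \<subseteq> B i" if "i \<in> F" for i
  proof -
    have "i \<in> X" using that by (simp add: F_def)
    then have "g i \<in> B i" using B(3) by auto
    then show ?thesis using B(2)[OF \<open>i \<in> X\<close>] unfolding openin_mtopology by blast
  qed
  then obtain r where r: "\<And>i. i \<in> F \<Longrightarrow> 0 < r i \<and> mball (g i) (r i) \<subseteq> B i" by metis
  define \<epsilon> where "\<epsilon> = Min (insert 1 (r ` F))"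
  have fin: "finite F" using B(1) by (simp add: F_def)
  have pos: "0 < \<epsilon>" using r fin by (auto simp: \<epsilon>_def)
  have le: "\<epsilon> \<le> r i" if "i \<in> F" for i using that fin by (auto simp: \<epsilon>_def)
  have "near F \<epsilon> g \<subseteq> U"
  proof
    fix f assume "f \<in> near F \<epsilon> g"
    then have f: "f \<in> Aut" "\<And>i. i \<in> F \<Longrightarrow> d (f i) (g i) < \<epsilon>" by (auto simp: near_def)
    have "f i \<in> B i" if i: "i \<in> X" for i
    proof (cases "i \<in> F")
      case True
      have "f i \<in> mball (g i) (r i)"
        using f(2)[OF True] le[OF True] aut_in[OF f(1) i] aut_in[OF \<open>g \<in> Aut\<close> i] commute[of "f i" "g i"] by simp
      then show ?thesis using r[OF True] by blast
    next
      case False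
      then show ?thesis using i aut_in[OF f(1) i] by (simp add: F_def)
    qed
    then have "f \<in> PiE X B" using autD(1)[OF f(1)] by (auto simp: PiE_def)
    then show "f \<in> U" using B(4) V(2) f(1) by blast
  qed
  then show ?thesis using that fin pos by (auto simp: F_def)
qed

text \<open>
  Left translation is an isometry, so basic neighbourhoods of all points arise from one another by it.
\<close>

lemma near_translate:
  assumes g: "g \<in> Aut" and f: "f \<in> Aut" and k: "k \<in> Aut" and F: "F \<subseteq> X"
  shows "compose X k f \<in> near F \<epsilon> (compose X k g) \<longleftrightarrow> f \<in> near F \<epsilon> g"
proof -
  have "d (compose X k f x) (compose X k g x) = d (f x) (g x)" if "x \<in> F" for x
    using that F aut_isometry[OF k aut_in[OF f] aut_in[OF g], of x x] by (auto simp: compose_def)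
  then show ?thesis using f compose_aut[OF k f] by (simp add: near_def)
qed

lemma aut_nbhd_eq_near:
  assumes "0 < \<epsilon>"
  shows "aut_nbhd L M m a \<epsilon> = near (set a) \<epsilon> (\<lambda>x. x)"
proof -
  have "tuple_dist m (map g a) a < \<epsilon> \<longleftrightarrow> (\<forall>x\<in>set a. d (g x) x < \<epsilon>)" for g
  proof -
    have eq: "{d (map g a ! i) (a ! i) |i. i < length (map g a)} = (\<lambda>x. d (g x) x) ` set a"
    proof -
      have "{d (map g a ! i) (a ! i) |i. i < length (map g a)} = (\<lambda>i. d (map g a ! i) (a ! i)) ` {..<length a}"
        unfolding length_map image_def by blast
      also have "\<dots> = (\<lambda>i. d (g (a ! i)) (a ! i)) ` {..<length a}" by (rule image_cong) auto
      also have "\<dots> = (\<lambda>x. d (g x) x) ` ((!) a ` {..<length a})" by (simp add: image_image)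
      also have "(!) a ` {..<length a} = set a" by (auto simp: set_conv_nth)
      finally show ?thesis .
    qed
    show ?thesis unfolding tuple_dist_def eq using assms by (subst Max_less_iff) auto
  qed
  then show ?thesis by (simp add: aut_nbhd_def near_def)
qed

subsection \<open>Baire category in the automorphism group\<close>

text \<open>
  A shrinking sequence of closed balls in the sense of \<open>near\<close> avoids the sets one after the other. The
  radii halve, and the finite sets eventually contain each point \<open>y\<^sub>i\<close> of a dense sequence together with
  its preimage under the current centre; the latter makes the inverses Cauchy as well.
\<close>

lemma baire_aut:
  assumes complete: mcomplete and Y: "dense_in_X Y" "countable Y"
    and cover: "Aut \<subseteq> (\<Union>n. A n)"
  obtains n :: nat and F \<epsilon> g where "finite F" "F \<subseteq> X" "0 < \<epsilon>" "g \<in> Aut"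
    "\<And>f F' \<epsilon>'. f \<in> near F \<epsilon> g \<Longrightarrow> finite F' \<Longrightarrow> F' \<subseteq> X \<Longrightarrow> 0 < \<epsilon>' \<Longrightarrow> near F' \<epsilon>' f \<inter> A n \<noteq> {}"
proof (rule ccontr)
  note witness = that
  assume contra: "\<not> thesis"
  have escape: "\<exists>f F' \<epsilon>'. f \<in> near F \<epsilon> g \<and> finite F' \<and> F' \<subseteq> X \<and> 0 < \<epsilon>' \<and> near F' \<epsilon>' f \<inter> A n = {}"
    if h: "finite F" "F \<subseteq> X" "0 < \<epsilon>" "g \<in> Aut" for n F \<epsilon> g
    using contra witness[OF h, of n] by blast
  obtain y0 where "y0 \<in> Y" using Y(1) X_nonempty unfolding dense_in_X_def by (meson all_not_in_conv zero_less_one)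
  define y where "y = from_nat_into Y"
  have y: "range y = Y" using Y(2) \<open>y0 \<in> Y\<close> unfolding y_def by (intro range_from_nat_into) auto
  then have yX: "y i \<in> X" for i using Y(1) unfolding dense_in_X_def by blast
  define I where "I s \<longleftrightarrow> (case s of (g, F, \<epsilon>) \<Rightarrow> g \<in> Aut \<and> finite F \<and> F \<subseteq> X \<and> 0 < \<epsilon>)"
    for s :: "('a \<Rightarrow> 'a) \<times> 'a set \<times> real"
  define R where "R k s s' \<longleftrightarrow> (case s of (g, F, \<epsilon>) \<Rightarrow> case s' of (g', F', \<epsilon>') \<Rightarrow>
      g' \<in> near F (\<epsilon> / 2) g \<and> F \<subseteq> F' \<and> (\<forall>i\<le>k. y i \<in> F' \<and> ainv g' (y i) \<in> F') \<and>
      \<epsilon>' \<le> \<epsilon> / 2 \<and> (\<exists>\<delta>>\<epsilon>'. near F' \<delta> g' \<inter> A k = {}))"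
    for k :: nat and s s' :: "('a \<Rightarrow> 'a) \<times> 'a set \<times> real"
  have "\<exists>S. \<forall>k. (I (S k) \<and> (k = 0 \<longrightarrow> S k = (restrict (\<lambda>x. x) X, {}, 1))) \<and> R k (S k) (S (Suc k))"
  proof (rule dependent_nat_choice)
    show "\<exists>s. I s \<and> ((0::nat) = 0 \<longrightarrow> s = (restrict (\<lambda>x. x) X, {}, 1))"
      using id_aut by (simp add: I_def)
  next
    fix s :: "('a \<Rightarrow> 'a) \<times> 'a set \<times> real" and k :: nat
    assume s: "I s \<and> (k = 0 \<longrightarrow> s = (restrict (\<lambda>x. x) X, {}, 1))"
    obtain g F \<epsilon> where s_eq: "s = (g, F, \<epsilon>)" by (cases s)
    then have h: "finite F" "F \<subseteq> X" "0 < \<epsilon> / 2" "g \<in> Aut" using s by (simp_all add: I_def)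
    obtain f F' \<epsilon>' where f: "f \<in> near F (\<epsilon> / 2) g" "finite F'" "F' \<subseteq> X" "0 < \<epsilon>'" "near F' \<epsilon>' f \<inter> A k = {}"
      using escape[OF h, of k] by blast
    have fA: "f \<in> Aut" using f(1) by (simp add: near_def)
    define F'' where "F'' = F \<union> F' \<union> y ` {..k} \<union> (ainv f \<circ> y) ` {..k}"
    define \<epsilon>'' where "\<epsilon>'' = min (\<epsilon>' / 2) (\<epsilon> / 2)"
    have "near F'' \<epsilon>' f \<inter> A k = {}"
      using f(5) near_mono[of F' F'' \<epsilon>' \<epsilon>' f] by (auto simp: F''_def)
    moreover have "\<epsilon>'' < \<epsilon>'" "\<epsilon>'' \<le> \<epsilon> / 2" "0 < \<epsilon>''" using f(4) h(3) by (auto simp: \<epsilon>''_def)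
    moreover have "F'' \<subseteq> X" "finite F''"
      using h f yX aut_in[OF ainv_aut[OF fA]] by (auto simp: F''_def)
    moreover have "F \<subseteq> F''" "\<forall>i\<le>k. y i \<in> F'' \<and> ainv f (y i) \<in> F''" by (auto simp: F''_def)
    ultimately have "I (f, F'', \<epsilon>'') \<and> R k s (f, F'', \<epsilon>'')"
      using f(1) fA unfolding I_def R_def s_eq prod.case by blast
    then show "\<exists>s'. (I s' \<and> (Suc k = 0 \<longrightarrow> s' = (restrict (\<lambda>x. x) X, {}, 1))) \<and> R k s s'" by blast
  qed
  then obtain S where S: "\<And>k. I (S k)" "S 0 = (restrict (\<lambda>x. x) X, {}, 1)" "\<And>k. R k (S k) (S (Suc k))"
    by blast
  define g where "g k = fst (S k)" for k
  define F where "F k = fst (snd (S k))" for k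
  define \<epsilon> where "\<epsilon> k = snd (snd (S k))" for k
  have S_eq: "S k = (g k, F k, \<epsilon> k)" for k by (simp add: g_def F_def \<epsilon>_def)
  have g: "g k \<in> Aut" and F: "F k \<subseteq> X" and pos: "0 < \<epsilon> k" for k
    using S(1)[of k] by (simp_all add: I_def S_eq)
  have step: "g (Suc k) \<in> near (F k) (\<epsilon> k / 2) (g k)" "F k \<subseteq> F (Suc k)" "\<epsilon> (Suc k) \<le> \<epsilon> k / 2"
    "\<And>i. i \<le> k \<Longrightarrow> y i \<in> F (Suc k)" "\<And>i. i \<le> k \<Longrightarrow> ainv (g (Suc k)) (y i) \<in> F (Suc k)"
    "\<exists>\<delta>>\<epsilon> (Suc k). near (F (Suc k)) \<delta> (g (Suc k)) \<inter> A k = {}" for k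
    using S(3)[of k] unfolding R_def S_eq prod.case by blast+
  have F_mono: "F j \<subseteq> F k" if "j \<le> k" for j k using lift_Suc_mono_le[of F, OF step(2) that] .
  \<comment> \<open>the bound must leave room for the later centres, which is possible because the radii halve\<close>
  have dist: "d (g j x) (g k x) \<le> \<epsilon> k - \<epsilon> j" if "k \<le> j" "x \<in> F k" for j k x
    using that
  proof (induction j rule: nat_induct_at_least)
    case base
    then have "x \<in> X" using F by blast
    then show ?case using aut_in[OF g] by simp
  next
    case (Suc j)
    have "x \<in> F j" "x \<in> X" using Suc F_mono[OF Suc.hyps] F by auto
    have "d (g (Suc j) x) (g k x) \<le> d (g (Suc j) x) (g j x) + d (g j x) (g k x)"
      using \<open>x \<in> X\<close> aut_in[OF g] by (intro triangle) auto
    moreover have "d (g (Suc j) x) (g j x) < \<epsilon> j / 2" using step(1)[of j] \<open>x \<in> F j\<close> by (simp add: near_def)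
    ultimately show ?case using Suc.IH Suc.prems step(3)[of j] by linarith
  qed
  have eps0: "\<epsilon> k \<le> (1/2) ^ k" for k
  proof (induction k)
    case 0
    then show ?case using S(2) by (simp add: \<epsilon>_def)
  next
    case (Suc k)
    then show ?case using step(3)[of k] by simp
  qed
  have cauchyI: "MCauchy u"
    if u: "\<And>n. u n \<in> X" "\<And>j k. i < k \<Longrightarrow> k \<le> j \<Longrightarrow> d (u j) (u k) \<le> \<epsilon> k" for u and i :: nat
    unfolding MCauchy_def
  proof (intro conjI allI impI)
    show "range u \<subseteq> X" using u(1) by auto
    fix e :: real assume "0 < e"
    then obtain N where N: "(1/2) ^ N < e / 2" using real_arch_pow_inv[of "e/2" "1/2"] by auto
    define K where "K = max N (Suc i)"
    have "\<epsilon> K < e / 2"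
    proof -
      have "\<epsilon> K \<le> (1/2) ^ K" by (rule eps0)
      also have "\<dots> \<le> (1/2) ^ N" by (rule power_decreasing) (auto simp: K_def)
      finally show ?thesis using N by simp
    qed
    have "d (u n) (u n') < e" if "K \<le> n" "K \<le> n'" for n n'
    proof -
      have "d (u n) (u n') \<le> d (u n) (u K) + d (u K) (u n')" using u(1) by (intro triangle) auto
      moreover have "d (u n) (u K) \<le> \<epsilon> K" "d (u n') (u K) \<le> \<epsilon> K" using u(2)[of K] that by (auto simp: K_def)
      ultimately show ?thesis using \<open>\<epsilon> K < e / 2\<close> commute[of "u K" "u n'"] by linarith
    qed
    then show "\<exists>N. \<forall>n n'. N \<le> n \<longrightarrow> N \<le> n' \<longrightarrow> d (u n) (u n') < e" by blast
  qed
  have le_eps: "d (g j x) (g k x) \<le> \<epsilon> k" if "k \<le> j" "x \<in> F k" for j k x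
    using dist[OF that] pos[of j] by linarith
  obtain h where h: "h \<in> Aut" "\<And>x. x \<in> X \<Longrightarrow> limitin mtopology (\<lambda>n. g n x) (h x) sequentially"
  proof (rule pointwise_limit_aut[OF complete Y(1) g])
    fix z assume "z \<in> Y"
    then obtain i where i: "z = y i" using y by blast
    have in_F: "z \<in> F k" "ainv (g k) z \<in> F k" if "i < k" for k
      using that i step(4,5)[of i "k - 1"] by auto
    have zX: "z \<in> X" using i yX by simp
    show "MCauchy (\<lambda>n. g n z)"
      by (rule cauchyI[of _ i]) (use aut_in[OF g zX] le_eps in_F in auto)
    show "MCauchy (\<lambda>n. ainv (g n) z)"
    proof (rule cauchyI[of _ i])
      show "ainv (g n) z \<in> X" for n using aut_in[OF ainv_aut[OF g] zX] .
      fix j k assume jk: "i < k" "k \<le> j"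
      define w where "w = ainv (g k) z"
      have w: "w \<in> X" "w \<in> F k" "g k w = z"
        using aut_in[OF ainv_aut[OF g] zX] in_F(2)[OF jk(1)] ainv_right[OF g zX] by (simp_all add: w_def)
      have "d (ainv (g j) z) w = d (g j (ainv (g j) z)) (g j w)"
        using aut_isometry[OF g aut_in[OF ainv_aut[OF g] zX] w(1)] by simp
      also have "\<dots> = d (g j w) (g k w)" using ainv_right[OF g zX] w(3) commute by simp
      finally show "d (ainv (g j) z) (ainv (g k) z) \<le> \<epsilon> k" using le_eps[OF jk(2) w(2)] by (simp add: w_def)
    qed
  next
    fix h assume "h \<in> Aut" "\<And>x. x \<in> X \<Longrightarrow> limitin mtopology (\<lambda>n. g n x) (h x) sequentially"
    then show thesis by (rule that)
  qed
  have lim: "d (h x) (g k x) \<le> \<epsilon> k" if "x \<in> F k" for k x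
  proof (rule ccontr)
    assume "\<not> d (h x) (g k x) \<le> \<epsilon> k"
    then have gap: "0 < d (h x) (g k x) - \<epsilon> k" by simp
    have xX: "x \<in> X" using that F by blast
    then obtain N where N: "\<And>n. N \<le> n \<Longrightarrow> d (g n x) (h x) < d (h x) (g k x) - \<epsilon> k"
      using h(2)[OF xX] gap unfolding limit_metric_sequentially by blast
    define j where "j = max N k"
    have "d (h x) (g k x) \<le> d (h x) (g j x) + d (g j x) (g k x)"
      using xX aut_in[OF g] aut_in[OF h(1)] by (intro triangle) auto
    moreover have "d (g j x) (g k x) \<le> \<epsilon> k" using le_eps[of k j x] that by (simp add: j_def)
    ultimately show False using N[of j] commute[of "h x" "g j x"] by (simp add: j_def)
  qed
  have "h \<notin> A k" for k
  proof -
    obtain \<delta> where "\<epsilon> (Suc k) < \<delta>" "near (F (Suc k)) \<delta> (g (Suc k)) \<inter> A k = {}" using step(6) by blast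
    moreover have "h \<in> near (F (Suc k)) \<delta> (g (Suc k))"
      using lim[of _ "Suc k"] h(1) \<open>\<epsilon> (Suc k) < \<delta>\<close> by (force simp: near_def)
    ultimately show ?thesis by blast
  qed
  then show False using cover h(1) by blast
qed

text \<open>
  Some \<open>A\<^sub>n\<close> is dense in an open set; translate by the inverse of one of its elements in this set.
\<close>

lemma quotients_dense_near_identity:
  assumes complete: mcomplete and Y: "dense_in_X Y" "countable Y"
    and cover: "Aut \<subseteq> (\<Union>n::nat. A n)" and A: "\<And>n. A n \<subseteq> Aut"
    and quotient: "\<And>n p q. p \<in> A n \<Longrightarrow> q \<in> A n \<Longrightarrow> compose X (ainv p) q \<in> W"
  obtains F \<epsilon> where "finite F" "F \<subseteq> X" "0 < \<epsilon>"
    "\<And>f F' \<epsilon>'. f \<in> near F \<epsilon> (\<lambda>x. x) \<Longrightarrow> finite F' \<Longrightarrow> F' \<subseteq> X \<Longrightarrow> 0 < \<epsilon>' \<Longrightarrow> near F' \<epsilon>' f \<inter> W \<noteq> {}"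
proof -
  obtain n F \<epsilon> g where F: "finite F" "F \<subseteq> X" "0 < \<epsilon>" and g: "g \<in> Aut"
    and dense: "\<And>f F' \<epsilon>'. f \<in> near F \<epsilon> g \<Longrightarrow> finite F' \<Longrightarrow> F' \<subseteq> X \<Longrightarrow> 0 < \<epsilon>' \<Longrightarrow> near F' \<epsilon>' f \<inter> A n \<noteq> {}"
    by (rule baire_aut[OF complete Y cover]) blast
  have "near F (\<epsilon> / 2) g \<inter> A n \<noteq> {}"
    by (rule dense[OF near_self[OF g F(2,3)] F(1,2)]) (use F in simp)
  then obtain w where w: "w \<in> A n" "w \<in> near F (\<epsilon> / 2) g" by blast
  have wA: "w \<in> Aut" using w(1) A by blast
  show ?thesis
  proof (rule that[OF F(1,2), of "\<epsilon> / 2"])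
    show "0 < \<epsilon> / 2" using F by simp
    fix f F' and \<epsilon>' :: real
    assume f: "f \<in> near F (\<epsilon> / 2) (\<lambda>x. x)" and F': "finite F'" "F' \<subseteq> X" "0 < \<epsilon>'"
    have fA: "f \<in> Aut" using f by (simp add: near_def)
    have wf: "compose X w f \<in> Aut" by (rule compose_aut[OF wA fA])
    have "d (compose X w f x) (g x) < \<epsilon>" if x: "x \<in> F" for x
    proof -
      have xX: "x \<in> X" using x F by blast
      have "d (w (f x)) (g x) \<le> d (w (f x)) (w x) + d (w x) (g x)"
        using xX aut_in[OF wA] aut_in[OF fA] aut_in[OF g] by (intro triangle) auto
      moreover have "d (w (f x)) (w x) < \<epsilon> / 2"
        using aut_isometry[OF wA aut_in[OF fA xX] xX] f x by (simp add: near_def)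
      moreover have "d (w x) (g x) < \<epsilon> / 2" using w(2) x by (simp add: near_def)
      ultimately show ?thesis using xX by (simp add: compose_def)
    qed
    then have "compose X w f \<in> near F \<epsilon> g" using wf by (simp add: near_def)
    from dense[OF this F'] obtain v where v: "v \<in> near F' \<epsilon>' (compose X w f)" "v \<in> A n" by blast
    have vA: "v \<in> Aut" using v(2) A by blast
    define u where "u = compose X (ainv w) v"
    have uA: "u \<in> Aut" unfolding u_def by (intro compose_aut ainv_aut wA vA)
    have "compose X w u = v"
      by (rule aut_ext[OF compose_aut[OF wA uA] vA])
         (simp add: u_def compose_def ainv_right[OF wA] aut_in[OF vA])
    then have "u \<in> near F' \<epsilon>' f" using v(1) near_translate[OF fA uA wA F'(2)] by simp
    moreover have "u \<in> W" unfolding u_def using quotient w(1) v(2) by blast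
    ultimately show "near F' \<epsilon>' f \<inter> W \<noteq> {}" by blast
  qed
qed

end

section \<open>Finitely generated substructures\<close>

context metric_fo_structure
begin

abbreviation gen :: "'a set \<Rightarrow> 'a set" where
  "gen S \<equiv> fun_closed L M hull S"

lemma fun_closed_X: "fun_closed L M X"
  using fun_int_in by (simp add: fun_closed_def)

lemma fun_closedI:
  assumes "A \<subseteq> X"
    "\<And>F xs. F \<in> fun_syms L \<Longrightarrow> xs \<in> nlists (fun_arity L F) A \<Longrightarrow> fun_int M F xs \<in> A"
  shows "fun_closed L M A"
  using assms by (simp add: fun_closed_def)

lemma fun_closed_gen:
  assumes "S \<subseteq> X"
  shows "fun_closed L M (gen S)"
proof (rule fun_closedI)
  show "gen S \<subseteq> X" using assms fun_closed_X by (rule hull_minimal)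
  fix F xs assume F: "F \<in> fun_syms L" and xs: "xs \<in> nlists (fun_arity L F) (gen S)"
  show "fun_int M F xs \<in> gen S"
    unfolding hull_def
  proof (intro InterI)
    fix A assume "A \<in> {t. fun_closed L M t \<and> S \<subseteq> t}"
    then have A: "fun_closed L M A" "gen S \<subseteq> A"
      using hull_minimal[of S A "fun_closed L M"] by simp_all
    then have "xs \<in> nlists (fun_arity L F) A" using xs nlists_mono by blast
    then show "fun_int M F xs \<in> A" using A(1) F by (simp add: fun_closed_def)
  qed
qed

lemma gen_subset_X: "S \<subseteq> X \<Longrightarrow> gen S \<subseteq> X"
  using fun_closed_gen by (simp add: fun_closed_def)

lemma gen_least: "S \<subseteq> gen S'\<Longrightarrow> S' \<subseteq> X \<Longrightarrow> gen S \<subseteq> gen S'"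
  using fun_closed_gen by (intro hull_minimal)

lemma fun_closed_image:
  assumes g: "g \<in> Aut" and A: "fun_closed L M A"
  shows "fun_closed L M (g ` A)"
  unfolding fun_closed_def
proof (intro conjI ballI)
  have AX: "A \<subseteq> X" using A by (simp add: fun_closed_def)
  then show "g ` A \<subseteq> X" using aut_in[OF g] by auto
  fix F xs assume F: "F \<in> fun_syms L" and xs: "xs \<in> nlists (fun_arity L F) (g ` A)"
  define ys where "ys = map (ainv g) xs"
  have "ainv g x \<in> A" "g (ainv g x) = x" if x: "x \<in> set xs" for x
  proof -
    obtain y where "y \<in> A" "x = g y" using x xs by (auto simp: nlists_def)
    then show "ainv g x \<in> A" "g (ainv g x) = x" using AX ainv_left[OF g, of y] by auto
  qed
  then have ys: "ys \<in> nlists (fun_arity L F) A" "xs = map g ys"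
    using xs by (auto simp: ys_def nlists_def map_idI)
  have "fun_int M F xs = g (fun_int M F ys)"
    using autD(3)[OF g F, of ys] ys AX nlists_mono by (metis subsetD)
  then show "fun_int M F xs \<in> g ` A" using A F ys(1) by (simp add: fun_closed_def)
qed

lemma ainv_image:
  assumes "g \<in> Aut" "A \<subseteq> X"
  shows "ainv g ` g ` A = A" "g ` ainv g ` A = A"
  using assms ainv_left[OF assms(1)] ainv_right[OF assms(1)]
  by (force simp: image_image image_iff subset_iff)+

text \<open>
  One inclusion is minimality of the hull; applied to the inverse automorphism it gives the other.
\<close>

lemma image_gen:
  assumes g: "g \<in> Aut" and S: "S \<subseteq> X"
  shows "g ` gen S = gen (g ` S)"
proof
  have sub: "gen (f ` S') \<subseteq> f ` gen S'" if "f \<in> Aut" "S' \<subseteq> X" for f S'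
    by (rule hull_minimal) (use that fun_closed_image fun_closed_gen hull_subset in \<open>auto intro: hull_inc\<close>)
  show "gen (g ` S) \<subseteq> g ` gen S" by (rule sub[OF g S])
  have gS: "g ` S \<subseteq> X" using S aut_in[OF g] by auto
  have "gen S \<subseteq> ainv g ` gen (g ` S)" using sub[OF ainv_aut[OF g] gS] ainv_image(1)[OF g S] by simp
  then have "g ` gen S \<subseteq> g ` ainv g ` gen (g ` S)" by (rule image_mono)
  then show "g ` gen S \<subseteq> gen (g ` S)" using ainv_image(2)[OF g gen_subset_X[OF gS]] by simp
qed

lemma agree_on_gen:
  assumes "g \<in> Aut" "f \<in> Aut" "S \<subseteq> X" "\<And>x. x \<in> S \<Longrightarrow> g x = f x" "x \<in> gen S"
  shows "g x = f x"
proof -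
  have "gen S \<subseteq> {x \<in> X. g x = f x}"
  proof (rule hull_minimal)
    show "fun_closed L M {x \<in> X. g x = f x}"
      unfolding fun_closed_def
    proof (intro conjI ballI)
      fix F xs assume F: "F \<in> fun_syms L" and xs: "xs \<in> nlists (fun_arity L F) {x \<in> X. g x = f x}"
      then have xs: "xs \<in> nlists (fun_arity L F) X" "map g xs = map f xs" by (auto simp: nlists_def)
      then show "fun_int M F xs \<in> {x \<in> X. g x = f x}"
        using fun_int_in[OF F xs(1)] autD(3)[OF assms(1) F xs(1)] autD(3)[OF assms(2) F xs(1)]
        by (simp del: map_eq_conv)
    qed auto
  qed (use assms in auto)
  then show ?thesis using assms(5) by blast
qed

lemma fin_gen_gen:
  assumes "a \<in> lists X" "a \<noteq> []"
  shows "fin_gen_substructure L M (gen (set a))"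
proof -
  have "hd a \<in> gen (set a)" using assms(2) by (intro hull_inc) simp
  then show ?thesis using assms unfolding fin_gen_substructure_def by (auto intro!: exI[of _ "set a"])
qed

lemma aut_substructure_iso:
  assumes g: "g \<in> Aut" and A: "A \<subseteq> X"
  shows "substructure_iso L M g A (g ` A)"
  unfolding substructure_iso_def
proof (intro conjI ballI)
  show "bij_betw g A (g ` A)"
    using autD(2)[OF g] A by (meson bij_betw_def inj_on_imp_bij_betw inj_on_subset)
next
  fix F xs assume F: "F \<in> fun_syms L" and "xs \<in> nlists (fun_arity L F) A"
  then have "xs \<in> nlists (fun_arity L F) X" using nlists_mono[OF A] by blast
  then show "g (fun_int M F xs) = fun_int M F (map g xs)" by (rule autD(3)[OF g F])
next
  fix R xs assume R: "R \<in> rel_syms L" and "xs \<in> nlists (rel_arity L R) A"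
  then have "xs \<in> nlists (rel_arity L R) X" using nlists_mono[OF A] by blast
  then show "map g xs \<in> rel_int M R \<longleftrightarrow> xs \<in> rel_int M R" by (rule autD(4)[OF g R])
qed

text \<open>
  The Hrushovski property for partial isomorphisms that are restrictions of automorphisms, coded by the
  images of a generating tuple. The codes are finite tuples of points, so there are only countably many
  over a countable set.
\<close>

lemma extend_finite_partial:
  assumes hrushovski: "hrushovski_property L M"
    and a: "a \<in> lists X" "a \<noteq> []" and bs: "\<And>b. b \<in> set bs \<Longrightarrow> \<exists>g\<in>Aut. map g a = b"
  shows "\<exists>e f. e \<in> lists X \<and> e \<noteq> [] \<and> gen (set a) \<subseteq> gen (set e) \<and>
    (\<forall>b\<in>set bs. f b \<in> Aut \<and> map (f b) a = b \<and> f b ` gen (set e) = gen (set e))"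
proof -
  have aX: "set a \<subseteq> X" using a by auto
  obtain \<gamma> where \<gamma>: "\<And>b. b \<in> set bs \<Longrightarrow> \<gamma> b \<in> Aut \<and> map (\<gamma> b) a = b" using bs by metis
  \<comment> \<open>the extra identity map makes the collection nonempty, so that the new substructure contains \<open>a\<close>\<close>
  define \<phi> where "\<phi> i = (if i < length bs then \<gamma> (bs ! i) else restrict (\<lambda>x. x) X)" for i
  have \<phi>: "\<phi> i \<in> Aut" for i using \<gamma> id_aut by (simp add: \<phi>_def)
  have fg: "fin_gen_substructure L M (\<phi> i ` gen (set a))" for i
  proof -
    have "map (\<phi> i) a \<in> lists X" using aX aut_in[OF \<phi>] by (auto simp: lists_eq_set)
    then show ?thesis using image_gen[OF \<phi> aX, of i] fin_gen_gen[of "map (\<phi> i) a"] a(2) by simp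
  qed
  have "\<forall>i<Suc (length bs). fin_gen_substructure L M (gen (set a)) \<and>
      fin_gen_substructure L M (\<phi> i ` gen (set a)) \<and>
      substructure_iso L M (\<phi> i) (gen (set a)) (\<phi> i ` gen (set a))"
    using fin_gen_gen[OF a] fg aut_substructure_iso[OF \<phi> gen_subset_X[OF aX]] by blast
  then obtain D f where D: "fin_gen_substructure L M D"
    and f: "\<And>i. i < Suc (length bs) \<Longrightarrow>
      gen (set a) \<subseteq> D \<and> f i \<in> Aut \<and> (\<forall>x\<in>gen (set a). f i x = \<phi> i x) \<and> f i ` D = D"
    using hrushovski[unfolded hrushovski_property_def, rule_format,
        of "Suc (length bs)" "\<lambda>_. gen (set a)" "\<lambda>i. \<phi> i ` gen (set a)" \<phi>] by blast
  obtain S where S: "finite S" "S \<subseteq> X" "D = gen S" using D unfolding fin_gen_substructure_def by blast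
  have aD: "gen (set a) \<subseteq> D" using f[of "length bs"] by simp
  obtain s where s: "set s = S" using S(1) finite_list by blast
  have De: "D = gen (set (a @ s))"
  proof
    show "D \<subseteq> gen (set (a @ s))" unfolding S(3) s[symmetric] by (rule hull_mono) simp
    have "set (a @ s) \<subseteq> D" using aD hull_subset[of "set a" "fun_closed L M"] hull_subset[of S "fun_closed L M"] S(3) s by auto
    then show "gen (set (a @ s)) \<subseteq> D" unfolding S(3) by (rule gen_least) (rule S(2))
  qed
  define ix where "ix b = (SOME i. i < length bs \<and> bs ! i = b)" for b
  have ix: "ix b < length bs" "bs ! ix b = b" if "b \<in> set bs" for b
    using that someI_ex[of "\<lambda>i. i < length bs \<and> bs ! i = b"] by (auto simp: ix_def in_set_conv_nth)
  have "f (ix b) \<in> Aut \<and> map (f (ix b)) a = b \<and> f (ix b) ` D = D" if b: "b \<in> set bs" for b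
  proof -
    have "f (ix b) x = \<gamma> b x" if "x \<in> set a" for x
      using f[of "ix b"] ix[OF b] hull_inc[OF that, of "fun_closed L M"] by (simp add: \<phi>_def)
    then have "map (f (ix b)) a = map (\<gamma> b) a" by simp
    then show ?thesis using f[of "ix b"] ix[OF b] \<gamma>[OF b] by simp
  qed
  then show ?thesis
    using De aD a S(2) s by (intro exI[of _ "a @ s"] exI[of _ "\<lambda>b. f (ix b)"]) auto
qed

text \<open>
  The extension property as seen by automorphisms of the whole structure: \<open>g\<close> moves \<open>c\<close> over \<open>a\<close> to a
  copy independent from \<open>b\<close>, and glued maps are again restrictions of automorphisms.
\<close>

definition independent_copy :: "'a list \<Rightarrow> 'a list \<Rightarrow> 'a list \<Rightarrow> ('a \<Rightarrow> 'a) \<Rightarrow> bool" where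
  "independent_copy a b c g \<longleftrightarrow> (\<forall>x\<in>gen (set a). g x = x) \<and>
    (\<forall>\<phi>\<in>Aut. \<forall>\<psi>\<in>Aut. \<phi> ` gen (set b) = gen (set b) \<and> \<psi> ` g ` gen (set c) = g ` gen (set c) \<and>
       \<phi> ` gen (set a) = gen (set a) \<and> (\<forall>x\<in>gen (set a). \<phi> x = \<psi> x) \<longrightarrow>
       (\<exists>\<theta>\<in>Aut. \<theta> ` gen (set (b @ map g c)) = gen (set (b @ map g c)) \<and>
          (\<forall>x\<in>gen (set b). \<theta> x = \<phi> x) \<and> (\<forall>x\<in>g ` gen (set c). \<theta> x = \<psi> x)))"

text \<open>
  The gluing map is defined on a finitely generated substructure only; the Hrushovski property for this
  single map extends it to an automorphism.
\<close>

lemma independent_copy_exists: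
  assumes hrushovski: "hrushovski_property L M" and extension: "extension_property L M"
    and a: "a \<in> lists X" "a \<noteq> []" and b: "b \<in> lists X" "b \<noteq> []" and c: "c \<in> lists X" "c \<noteq> []"
    and sub: "gen (set a) \<subseteq> gen (set b)" "gen (set a) \<subseteq> gen (set c)"
  shows "\<exists>g\<in>Aut. independent_copy a b c g"
proof -
  have X: "set a \<subseteq> X" "set b \<subseteq> X" "set c \<subseteq> X" using a b c by auto
  have "gen (set a) \<subseteq> gen (set b) \<inter> gen (set c)" using sub by blast
  then obtain g where g: "g \<in> Aut" "\<forall>x\<in>gen (set a). g x = x"
    and ind: "independent_over L M (gen (set a)) (gen (set b)) (g ` gen (set c))"
    using extension fin_gen_gen a b c unfolding extension_property_def by metis
  define D where "D = gen (set (b @ map g c))"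
  have bc: "b @ map g c \<in> lists X" "b @ map g c \<noteq> []" using b c aut_in[OF g(1)] by auto
  have gc: "g ` gen (set c) = gen (g ` set c)" by (rule image_gen[OF g(1) X(3)])
  have "gen (gen (set b) \<union> g ` gen (set c)) = D"
  proof
    have bcX: "set (b @ map g c) \<subseteq> X" using bc(1) by auto
    have "gen (set b) \<subseteq> D" "gen (g ` set c) \<subseteq> D" unfolding D_def by (rule hull_mono, simp)+
    then show "gen (gen (set b) \<union> g ` gen (set c)) \<subseteq> D"
      unfolding gc D_def using bcX by (intro gen_least) auto
    show "D \<subseteq> gen (gen (set b) \<union> g ` gen (set c))"
      unfolding D_def gc by (rule hull_mono) (auto intro: hull_inc)
  qed
  note ind = ind[unfolded independent_over_def Let_def this, rule_format]
  have glue: "\<exists>\<theta>\<in>Aut. \<theta> ` D = D \<and> (\<forall>x\<in>gen (set b). \<theta> x = \<phi> x) \<and> (\<forall>x\<in>g ` gen (set c). \<theta> x = \<psi> x)"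
    if h: "\<phi> \<in> Aut" "\<psi> \<in> Aut" "\<phi> ` gen (set b) = gen (set b)" "\<psi> ` g ` gen (set c) = g ` gen (set c)"
      "\<phi> ` gen (set a) = gen (set a)" "\<forall>x\<in>gen (set a). \<phi> x = \<psi> x" for \<phi> \<psi>
  proof -
    have gcX: "g ` gen (set c) \<subseteq> X" using gen_subset_X[OF X(3)] aut_in[OF g(1)] by auto
    have "substructure_iso L M \<phi> (gen (set b)) (gen (set b))"
      "substructure_iso L M \<psi> (g ` gen (set c)) (g ` gen (set c))"
      using aut_substructure_iso[OF h(1) gen_subset_X[OF X(2)]] aut_substructure_iso[OF h(2) gcX] h(3,4) by simp_all
    moreover have "\<psi> ` gen (set a) = gen (set a)" using h(5,6) by simp
    ultimately obtain \<theta> where \<theta>: "substructure_iso L M \<theta> D D" "\<forall>x\<in>gen (set b). \<theta> x = \<phi> x"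
      "\<forall>x\<in>g ` gen (set c). \<theta> x = \<psi> x"
      using ind[of \<phi> \<psi>] h(5,6) by blast
    have fgD: "fin_gen_substructure L M D" unfolding D_def using bc by (rule fin_gen_gen)
    have "\<exists>D' f. fin_gen_substructure L M D' \<and>
        (\<forall>i<Suc 0. D \<subseteq> D' \<and> f i \<in> Aut \<and> (\<forall>x\<in>D. f i x = \<theta> x) \<and> f i ` D' = D')"
      using hrushovski[unfolded hrushovski_property_def, rule_format, of "Suc 0" "\<lambda>_. D" "\<lambda>_. D" "\<lambda>_. \<theta>"]
        fgD \<theta>(1) by blast
    then have "\<exists>f. f \<in> Aut \<and> (\<forall>x\<in>D. f x = \<theta> x)"
    proof (elim exE conjE)
      fix D' f assume "\<forall>i<Suc 0. D \<subseteq> D' \<and> f i \<in> Aut \<and> (\<forall>x\<in>D. f i x = \<theta> x) \<and> f i ` D' = D'"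
      then show ?thesis by (intro exI[of _ "f 0"]) simp
    qed
    then obtain f where f: "f \<in> Aut" "\<forall>x\<in>D. f x = \<theta> x" by blast
    have "f ` D = \<theta> ` D" using f(2) by simp
    also have "\<dots> = D" using \<theta>(1) by (simp add: substructure_iso_def bij_betw_def)
    finally have "f ` D = D" .
    moreover have "gen (set b) \<subseteq> D" "g ` gen (set c) \<subseteq> D" unfolding D_def gc by (rule hull_mono, simp)+
    ultimately show ?thesis using f \<theta>(2,3) by (intro bexI[of _ f]) (auto simp: subset_iff)
  qed
  show ?thesis
    unfolding independent_copy_def
    by (rule bexI[OF _ g(1)], rule conjI[OF g(2)], intro ballI impI, elim conjE)
       (rule glue[unfolded D_def])
qed

end

section \<open>Countable skeletons\<close>

lemma lists_UN_chain:
  fixes Z :: "nat \<Rightarrow> 'b set"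
  assumes "\<And>n. Z n \<subseteq> Z (Suc n)" "xs \<in> lists (\<Union>n. Z n)"
  shows "\<exists>n. xs \<in> lists (Z n)"
  using assms(2)
proof (induction xs)
  case (Cons x xs)
  then obtain n k where "xs \<in> lists (Z n)" "x \<in> Z k" by auto
  moreover have "Z n \<subseteq> Z (max n k)" "Z k \<subseteq> Z (max n k)"
    using lift_Suc_mono_le[of Z, OF assms(1)] by simp_all
  ultimately show ?case by (intro exI[of _ "max n k"]) auto
qed auto

text \<open>
  Iterate the operator countably often. Its arguments are finite, so each of them is available at some
  finite stage.
\<close>

lemma countable_closure:
  fixes \<Phi> :: "'a list list \<Rightarrow> 'a set"
  assumes Y: "countable Y" "Y \<subseteq> X"
    and \<Phi>: "\<And>t. t \<in> lists (lists X) \<Longrightarrow> countable (\<Phi> t) \<and> \<Phi> t \<subseteq> X"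
  obtains Z where "countable Z" "Y \<subseteq> Z" "Z \<subseteq> X" "\<And>t. t \<in> lists (lists Z) \<Longrightarrow> \<Phi> t \<subseteq> Z"
proof -
  define Z where "Z = rec_nat Y (\<lambda>_ A. A \<union> (\<Union>t\<in>lists (lists A). \<Phi> t))"
  have Z: "Z 0 = Y" "\<And>n. Z (Suc n) = Z n \<union> (\<Union>t\<in>lists (lists (Z n)). \<Phi> t)" by (simp_all add: Z_def)
  have "countable (Z n) \<and> Z n \<subseteq> X" for n
  proof (induction n)
    case (Suc n)
    then have sub: "lists (lists (Z n)) \<subseteq> lists (lists X)" by (intro lists_mono) auto
    have "countable (\<Union>t\<in>lists (lists (Z n)). \<Phi> t)"
      using Suc \<Phi> sub by (intro countable_UN countable_lists) auto
    moreover have "(\<Union>t\<in>lists (lists (Z n)). \<Phi> t) \<subseteq> X" using \<Phi> sub by blast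
    ultimately show ?case using Suc Z(2) by simp
  qed (use Z Y in simp)
  then have "countable (\<Union>n. Z n)" "(\<Union>n. Z n) \<subseteq> X" by auto
  moreover have "\<Phi> t \<subseteq> (\<Union>n. Z n)" if t: "t \<in> lists (lists (\<Union>n. Z n))" for t
  proof -
    have mono: "Z n \<subseteq> Z (Suc n)" for n using Z(2) by blast
    have "t \<in> lists (\<Union>n. lists (Z n))" using t lists_UN_chain[of Z, OF mono] by auto
    then obtain n where "t \<in> lists (lists (Z n))"
      using lists_UN_chain[of "\<lambda>n. lists (Z n)" t] lists_mono[OF mono] by blast
    then have "\<Phi> t \<subseteq> Z (Suc n)" using Z(2) by blast
    then show ?thesis by blast
  qed
  moreover have "Y \<subseteq> (\<Union>n. Z n)" using Z(1) by blast
  ultimately show ?thesis using that by blast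
qed

lemma (in Metric_space) MCauchy_eventually_const:
  assumes "\<And>n. u n \<in> M" "\<And>n. N \<le> n \<Longrightarrow> u n = c"
  shows "MCauchy u"
  unfolding MCauchy_def
proof (intro conjI allI impI)
  fix \<epsilon> :: real assume "0 < \<epsilon>"
  have "c \<in> M" using assms(1)[of N] assms(2)[of N] by simp
  then show "\<exists>N. \<forall>n n'. N \<le> n \<longrightarrow> N \<le> n' \<longrightarrow> d (u n) (u n') < \<epsilon>"
    using assms(2) \<open>0 < \<epsilon>\<close> by (intro exI[of _ N]) simp
qed (use assms(1) in auto)

text \<open>
  A countable dense substructure that reflects the homogeneity of the whole: partial isomorphisms between its
  finitely generated parts extend, and its finitely generated parts have independent copies, by automorphisms
  that preserve \<open>Z\<close>.
\<close>

locale countable_skeleton = metric_fo_structure L M m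
  for L :: "('f, 'r) fo_language" and M :: "('f, 'r, 'a) fo_struct" and m :: "'a metric" +
  fixes Z :: "'a set"
  assumes complete: mcomplete and dense: "dense_in_X Z" and countable: "countable Z"
    and fun_closed: "fun_closed L M Z"
    and lift_partial: "\<And>a bs. a \<in> lists Z \<Longrightarrow> a \<noteq> [] \<Longrightarrow> bs \<in> lists (lists Z) \<Longrightarrow>
      (\<And>b. b \<in> set bs \<Longrightarrow> \<exists>g\<in>Aut. map g a = b) \<Longrightarrow>
      \<exists>e f. e \<in> lists Z \<and> e \<noteq> [] \<and> gen (set a) \<subseteq> gen (set e) \<and>
        (\<forall>b\<in>set bs. f b \<in> Aut \<and> f b ` Z = Z \<and> map (f b) a = b \<and> f b ` gen (set e) = gen (set e))"
    and lift_copy: "\<And>a b c. a \<in> lists Z \<Longrightarrow> a \<noteq> [] \<Longrightarrow> b \<in> lists Z \<Longrightarrow> b \<noteq> [] \<Longrightarrow> c \<in> lists Z \<Longrightarrow> c \<noteq> [] \<Longrightarrow>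
      gen (set a) \<subseteq> gen (set b) \<Longrightarrow> gen (set a) \<subseteq> gen (set c) \<Longrightarrow>
      \<exists>g\<in>Aut. g ` Z = Z \<and> independent_copy a b c g"
begin

lemma Z_sub: "Z \<subseteq> X"
  using dense by (simp add: dense_in_X_def)

lemma Z_nonempty: "Z \<noteq> {}"
  using dense X_nonempty zero_less_one unfolding dense_in_X_def by blast

lemma gen_Z: "a \<in> lists Z \<Longrightarrow> gen (set a) \<subseteq> Z"
  using fun_closed by (intro hull_minimal) auto

definition skeleton_perms :: "('a \<Rightarrow> 'a) set" where
  "skeleton_perms = {p. p permutes Z \<and> (\<exists>g\<in>Aut. agree_on Z g p)}"

definition skeleton_pieces :: "'a set set" where
  "skeleton_pieces = (\<lambda>a. gen (set a)) ` {a \<in> lists Z. a \<noteq> []}"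

text \<open>
  Passing between an automorphism and the permutation of \<open>Z\<close> that it induces.
\<close>

definition on_Z :: "('a \<Rightarrow> 'a) \<Rightarrow> 'a \<Rightarrow> 'a" where
  "on_Z g x = (if x \<in> Z then g x else x)"

definition lift :: "('a \<Rightarrow> 'a) \<Rightarrow> 'a \<Rightarrow> 'a" where
  "lift p = (SOME g. g \<in> Aut \<and> agree_on Z g p)"

lemma agree_on_Z: "agree_on Z g (on_Z g)"
  by (simp add: agree_on_def on_Z_def)

lemma lift:
  assumes "p \<in> skeleton_perms"
  shows "lift p \<in> Aut" "\<And>x. x \<in> Z \<Longrightarrow> lift p x = p x" "p permutes Z"
    "\<And>x. x \<in> Z \<Longrightarrow> p x \<in> Z"
proof -
  have "\<exists>g. g \<in> Aut \<and> agree_on Z g p" using assms by (auto simp: skeleton_perms_def)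
  from someI_ex[OF this] show "lift p \<in> Aut" "\<And>x. x \<in> Z \<Longrightarrow> lift p x = p x"
    by (simp_all add: lift_def agree_on_def)
  show "p permutes Z" using assms by (simp add: skeleton_perms_def)
  then show "\<And>x. x \<in> Z \<Longrightarrow> p x \<in> Z" by (simp add: permutes_in_image)
qed

lemma on_Z_in:
  assumes "g \<in> Aut" "g ` Z = Z"
  shows "on_Z g \<in> skeleton_perms"
proof -
  have "inj_on g Z" using autD(2)[OF assms(1)] Z_sub by (meson bij_betw_def inj_on_subset)
  then have "bij_betw (on_Z g) Z Z" using assms(2) by (auto simp: bij_betw_def inj_on_def on_Z_def)
  then have "on_Z g permutes Z" by (rule bij_imp_permutes) (simp add: on_Z_def)
  then show ?thesis using assms(1) agree_on_Z by (auto simp: skeleton_perms_def)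
qed

lemma agree_on_piece:
  assumes p: "p \<in> skeleton_perms" and g: "g \<in> Aut" and a: "a \<in> lists Z" "map p a = map g a"
  shows "agree_on (gen (set a)) p g"
  unfolding agree_on_def
proof
  fix x assume x: "x \<in> gen (set a)"
  have "lift p x = g x"
  proof (rule agree_on_gen[OF lift(1)[OF p] g _ _ x])
    show "set a \<subseteq> X" using a(1) Z_sub by auto
    show "lift p y = g y" if "y \<in> set a" for y using that a lift(2)[OF p] by auto
  qed
  then show "p x = g x" using lift(2)[OF p] gen_Z[OF a(1)] x by auto
qed

lemma image_skeleton_piece:
  assumes p: "p \<in> skeleton_perms" and a: "a \<in> lists Z"
  shows "p ` gen (set a) = gen (set (map p a))" "map p a \<in> lists Z"
proof -
  have map: "map p a = map (lift p) a" using a lift(2)[OF p] by auto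
  have "p ` gen (set a) = lift p ` gen (set a)"
    using agree_on_piece[OF p lift(1)[OF p] a map] by (rule agree_on_image)
  also have "\<dots> = gen (lift p ` set a)" using a Z_sub by (intro image_gen lift p) auto
  finally show "p ` gen (set a) = gen (set (map p a))" unfolding map by simp
  show "map p a \<in> lists Z" using a lift(4)[OF p] by auto
qed

text \<open>
  If \<open>p\<close> is approximated by automorphisms, then these automorphisms and their inverses are eventually
  constant on each point of \<open>Z\<close>, so they converge to an automorphism that induces \<open>p\<close>.
\<close>

lemma skeleton_closed:
  assumes p: "p permutes Z" and approx: "\<And>D. D \<in> skeleton_pieces \<Longrightarrow> \<exists>q\<in>skeleton_perms. agree_on D q p"
  shows "p \<in> skeleton_perms"
proof -
  define z where "z = from_nat_into Z"
  have z: "z i \<in> Z" for i unfolding z_def by (rule from_nat_into[OF Z_nonempty])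
  have z_onto: "\<exists>i. z i = x" if "x \<in> Z" for x
    using that countable unfolding z_def by (metis from_nat_into_surj)
  have ip: "perm_inv p permutes Z" using p by (rule permutes_inv)
  \<comment> \<open>the preimages under \<open>p\<close> are included for the sake of the inverses\<close>
  define a where "a n = map z [0..<Suc n] @ map (\<lambda>i. perm_inv p (z i)) [0..<Suc n]" for n
  have a: "a n \<in> lists Z" "a n \<noteq> []" for n
    using z permutes_in_image[OF ip] by (auto simp: a_def lists_eq_set)
  have "\<exists>g\<in>Aut. \<forall>x\<in>set (a n). g x = p x" for n
  proof -
    have "gen (set (a n)) \<in> skeleton_pieces" using a by (auto simp: skeleton_pieces_def)
    then obtain q where q: "q \<in> skeleton_perms" "agree_on (gen (set (a n))) q p" using approx by blast
    have "lift q x = p x" if "x \<in> set (a n)" for x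
      using agree_onD[OF q(2) hull_inc[OF that]] lift(2)[OF q(1)] that a(1)[of n] by auto
    then show ?thesis using lift(1)[OF q(1)] by blast
  qed
  then obtain g where g: "\<And>n. g n \<in> Aut" "\<And>n x. x \<in> set (a n) \<Longrightarrow> g n x = p x" by metis
  have gz: "g n (z i) = p (z i)" "g n (perm_inv p (z i)) = z i" if "i \<le> n" for n i
  proof -
    have "z i \<in> set (a n)" "perm_inv p (z i) \<in> set (a n)" using that by (auto simp: a_def simp del: upt_Suc)
    then show "g n (z i) = p (z i)" "g n (perm_inv p (z i)) = z i"
      using g(2) permutes_inverses(1)[OF p, of "z i"] by simp_all
  qed
  have zX: "z i \<in> X" "perm_inv p (z i) \<in> X" "p (z i) \<in> X" for i
    using z[of i] permutes_in_image[OF ip, of "z i"] permutes_in_image[OF p, of "z i"] Z_sub by auto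
  obtain h where h: "h \<in> Aut" "\<And>x. x \<in> X \<Longrightarrow> limitin mtopology (\<lambda>n. g n x) (h x) sequentially"
  proof (rule pointwise_limit_aut[OF complete dense g(1)])
    fix y assume "y \<in> Z"
    then obtain i where i: "y = z i" using z_onto by blast
    show "MCauchy (\<lambda>n. g n y)"
      by (rule MCauchy_eventually_const[of _ i "p (z i)"]) (use gz zX aut_in[OF g(1)] i in auto)
    have "ainv (g n) y = perm_inv p (z i)" if "i \<le> n" for n
      using ainv_left[OF g(1) zX(2), of n i] gz(2)[OF that] i by simp
    then show "MCauchy (\<lambda>n. ainv (g n) y)"
      by (rule MCauchy_eventually_const[of _ i, rotated]) (use zX aut_in[OF ainv_aut[OF g(1)]] i in auto)
  next
    fix h assume "h \<in> Aut" "\<And>x. x \<in> X \<Longrightarrow> limitin mtopology (\<lambda>n. g n x) (h x) sequentially"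
    then show thesis by (rule that)
  qed
  have "h x = p x" if x: "x \<in> Z" for x
  proof -
    obtain i where i: "x = z i" using z_onto x by blast
    have "limitin mtopology (\<lambda>n. g n x) (p x) sequentially"
    proof (rule limitin_eventually)
      show "\<forall>\<^sub>F n in sequentially. g n x = p x"
        using eventually_ge_at_top[of i] by eventually_elim (simp add: gz i)
    qed (use zX i in simp)
    then show ?thesis using h(2)[of x] zX i limitin_metric_unique sequentially_bot by metis
  qed
  then show ?thesis using p h(1) by (auto simp: skeleton_perms_def agree_on_def)
qed

text \<open>
  An automorphism is determined on a finitely generated substructure by its values on the generators.
\<close>

lemma skeleton_separable:
  "\<exists>Q\<subseteq>skeleton_perms. countable Q \<and> (\<forall>p\<in>skeleton_perms. \<forall>D\<in>skeleton_pieces. \<exists>q\<in>Q. agree_on D q p)"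
proof -
  define c where "c = (\<lambda>(a, b). SOME p. p \<in> skeleton_perms \<and> map p a = b)"
  define J where "J = {(a, b). a \<in> lists Z \<and> b \<in> lists Z \<and> (\<exists>p\<in>skeleton_perms. map p a = b)}"
  have c: "c (a, b) \<in> skeleton_perms \<and> map (c (a, b)) a = b" if "(a, b) \<in> J" for a b
  proof -
    have "\<exists>p. p \<in> skeleton_perms \<and> map p a = b" using that by (auto simp: J_def)
    from someI_ex[OF this] show ?thesis by (simp add: c_def)
  qed
  have "countable (lists Z \<times> lists Z)" using countable by (intro countable_SIGMA countable_lists)
  then have "countable J" by (rule countable_subset[rotated]) (auto simp: J_def)
  then have "countable (c ` J)" by simp
  moreover have "c ` J \<subseteq> skeleton_perms" using c by auto
  moreover have "\<exists>q\<in>c ` J. agree_on D q p" if p: "p \<in> skeleton_perms" and D: "D \<in> skeleton_pieces" for p D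
  proof -
    obtain a where a: "a \<in> lists Z" "D = gen (set a)" using D by (auto simp: skeleton_pieces_def)
    define q where "q = c (a, map p a)"
    have J: "(a, map p a) \<in> J" using a p image_skeleton_piece(2)[OF p a(1)] by (auto simp: J_def)
    then have q: "q \<in> skeleton_perms" "map q a = map p a" using c unfolding q_def by blast+
    have map: "map p a = map (lift p) a" using a lift(2)[OF p] by auto
    have "agree_on D q (lift p)" unfolding a(2) using q map by (intro agree_on_piece lift p a) auto
    moreover have "agree_on D (lift p) p"
      unfolding a(2) using map by (intro agree_on_sym[OF agree_on_piece] lift p a) auto
    ultimately have "agree_on D q p" by (rule agree_on_trans)
    then show ?thesis using J unfolding q_def by blast
  qed
  ultimately show ?thesis by (intro exI[of _ "c ` J"]) blast
qed

lemma skeleton_extend_partial: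
  assumes xs: "xs \<in> lists skeleton_perms" and D: "D \<in> skeleton_pieces"
  shows "\<exists>E\<in>skeleton_pieces. \<exists>ys\<in>lists skeleton_perms. D \<subseteq> E \<and> intertwines id D xs ys \<and> invariant E ys"
proof -
  obtain a where a: "a \<in> lists Z" "a \<noteq> []" "D = gen (set a)" using D by (auto simp: skeleton_pieces_def)
  have perm: "p \<in> skeleton_perms" if "p \<in> set xs" for p using xs that by auto
  define bs where "bs = map (\<lambda>p. map p a) xs"
  have bs: "bs \<in> lists (lists Z)"
  proof -
    have "map p a \<in> lists Z" if "p \<in> set xs" for p
      by (rule image_skeleton_piece(2)[OF perm[OF that] a(1)])
    then show ?thesis unfolding bs_def by (intro in_listsI ballI) (unfold set_map, blast)
  qed
  have "\<exists>g\<in>Aut. map g a = b" if b: "b \<in> set bs" for b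
  proof -
    obtain p where p: "p \<in> set xs" "b = map p a" using b by (auto simp: bs_def)
    then have "map (lift p) a = b" using a(1) lift(2)[OF perm] by auto
    then show ?thesis using lift(1)[OF perm[OF p(1)]] by blast
  qed
  from lift_partial[OF a(1,2) bs this] obtain e f where e: "e \<in> lists Z" "e \<noteq> []" "gen (set a) \<subseteq> gen (set e)"
    and f: "\<And>b. b \<in> set bs \<Longrightarrow> f b \<in> Aut \<and> f b ` Z = Z \<and> map (f b) a = b \<and> f b ` gen (set e) = gen (set e)"
    by blast
  define ys where "ys = map (\<lambda>p. on_Z (f (map p a))) xs"
  have fp: "f (map p a) \<in> Aut" "f (map p a) ` Z = Z" "map (f (map p a)) a = map p a"
    "f (map p a) ` gen (set e) = gen (set e)" if p: "p \<in> set xs" for p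
  proof -
    have "map p a \<in> set bs" unfolding bs_def set_map using p by (rule imageI)
    from f[OF this] show "f (map p a) \<in> Aut" "f (map p a) ` Z = Z" "map (f (map p a)) a = map p a"
      "f (map p a) ` gen (set e) = gen (set e)" by blast+
  qed
  have "gen (set e) \<in> skeleton_pieces" using e by (auto simp: skeleton_pieces_def)
  moreover have "ys \<in> lists skeleton_perms" using fp on_Z_in by (auto simp: ys_def lists_eq_set)
  moreover have "D \<subseteq> gen (set e)" using e a by simp
  moreover have "p x = on_Z (f (map p a)) x" if "p \<in> set xs" "x \<in> D" for p x
    using agree_on_piece[OF perm[OF that(1)] fp(1)[OF that(1)] a(1)] fp(3)[OF that(1)] that gen_Z[OF a(1)] a(3)
    by (auto simp: agree_on_def on_Z_def)
  then have "intertwines id D xs ys" by (simp add: intertwines_def ys_def list_all2_conv_all_nth)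
  moreover have "invariant (gen (set e)) ys"
  proof -
    have "on_Z g ` gen (set e) = g ` gen (set e)" for g
      using agree_on_image[OF agree_on_subset[OF agree_on_Z gen_Z[OF e(1)]]] by simp
    then show ?thesis using fp(4) by (simp add: invariant_def ys_def)
  qed
  ultimately show ?thesis by blast
qed

text \<open>
  The glued automorphism \<open>\<theta>\<close> need not preserve \<open>Z\<close>, but it maps generators of \<open>E\<close> into \<open>Z\<close>; therefore
  \<open>lift_partial\<close> provides an automorphism that agrees with \<open>\<theta>\<close> on \<open>E\<close> and preserves \<open>Z\<close>.
\<close>

lemma skeleton_independence:
  assumes "A \<in> skeleton_pieces" "B \<in> skeleton_pieces" "C \<in> skeleton_pieces" "A \<subseteq> B" "A \<subseteq> C"
  shows "\<exists>g\<in>skeleton_perms. agree_on A g id \<and>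
    (\<exists>E\<in>skeleton_pieces. B \<union> g ` C \<subseteq> E \<and>
      (\<forall>\<phi>\<in>skeleton_perms. \<forall>\<psi>\<in>skeleton_perms.
         \<phi> ` B = B \<and> \<psi> ` g ` C = g ` C \<and> \<phi> ` A = A \<and> agree_on A \<phi> \<psi> \<longrightarrow>
         (\<exists>\<theta>\<in>skeleton_perms. \<theta> ` E = E \<and> agree_on B \<theta> \<phi> \<and> agree_on (g ` C) \<theta> \<psi>)))"
proof -
  obtain a b c where a: "a \<in> lists Z" "a \<noteq> []" "A = gen (set a)" and b: "b \<in> lists Z" "b \<noteq> []" "B = gen (set b)"
    and c: "c \<in> lists Z" "c \<noteq> []" "C = gen (set c)"
    using assms(1-3) by (auto simp: skeleton_pieces_def)
  obtain g where g: "g \<in> Aut" "g ` Z = Z" and copy: "independent_copy a b c g"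
    using lift_copy[OF a(1,2) b(1,2) c(1,2)] assms(4,5) a(3) b(3) c(3) by blast
  define d where "d = b @ map g c"
  define E where "E = gen (set d)"
  have d: "d \<in> lists Z" "d \<noteq> []" using b c g(2) by (auto simp: d_def lists_eq_set)
  have AZ: "A \<subseteq> Z" "B \<subseteq> Z" "C \<subseteq> Z" "E \<subseteq> Z" using a b c d gen_Z by (simp_all add: E_def)
  have img: "on_Z g ` C = g ` C" using agree_on_image[OF agree_on_subset[OF agree_on_Z AZ(3)]] by simp
  have gC: "g ` C = gen (g ` set c)" unfolding c(3) using c(1) Z_sub by (intro image_gen[OF g(1)]) auto
  have sub: "B \<subseteq> E" "g ` C \<subseteq> E" unfolding b(3) gC E_def d_def by (rule hull_mono, simp)+
  have glue: "\<exists>\<theta>\<in>skeleton_perms. \<theta> ` E = E \<and> agree_on B \<theta> \<phi> \<and> agree_on (g ` C) \<theta> \<psi>"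
    if h: "\<phi> \<in> skeleton_perms" "\<psi> \<in> skeleton_perms" "\<phi> ` B = B" "\<psi> ` g ` C = g ` C" "\<phi> ` A = A" "agree_on A \<phi> \<psi>"
    for \<phi> \<psi>
  proof -
    have lift_agree: "agree_on Z (lift p) p" if "p \<in> skeleton_perms" for p
      using lift(2)[OF that] by (simp add: agree_on_def)
    have gCZ: "g ` C \<subseteq> Z" using sub AZ by blast
    have 1: "lift \<phi> ` gen (set b) = gen (set b)" "lift \<phi> ` gen (set a) = gen (set a)"
      "lift \<psi> ` g ` gen (set c) = g ` gen (set c)"
      using agree_on_image[OF agree_on_subset[OF lift_agree[OF h(1)] AZ(2)]]
        agree_on_image[OF agree_on_subset[OF lift_agree[OF h(1)] AZ(1)]]
        agree_on_image[OF agree_on_subset[OF lift_agree[OF h(2)] gCZ]] h(3-5) a(3) b(3) c(3) by simp_all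
    have 2: "\<forall>x\<in>gen (set a). lift \<phi> x = lift \<psi> x"
      using h(6) AZ(1) lift(2)[OF h(1)] lift(2)[OF h(2)] a(3) by (auto simp: agree_on_def)
    obtain \<theta> where \<theta>: "\<theta> \<in> Aut" "\<theta> ` E = E" "\<forall>x\<in>B. \<theta> x = lift \<phi> x" "\<forall>x\<in>g ` C. \<theta> x = lift \<psi> x"
      using copy[unfolded independent_copy_def, THEN conjunct2, rule_format, OF lift(1)[OF h(1)] lift(1)[OF h(2)]]
        1 2 unfolding E_def d_def b(3) c(3) by blast
    have "set d \<subseteq> E" unfolding E_def by (rule hull_subset)
    then have \<theta>d: "map \<theta> d \<in> lists Z" using \<theta>(2) AZ(4) by (auto simp: lists_eq_set)
    have "\<exists>e f. e \<in> lists Z \<and> e \<noteq> [] \<and> gen (set d) \<subseteq> gen (set e) \<and>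
        (\<forall>b\<in>set [map \<theta> d]. f b \<in> Aut \<and> f b ` Z = Z \<and> map (f b) d = b \<and> f b ` gen (set e) = gen (set e))"
      by (rule lift_partial[OF d]) (use \<theta>d \<theta>(1) in auto)
    then obtain f where f: "f \<in> Aut" "f ` Z = Z" "map f d = map \<theta> d" by auto
    have eq: "on_Z f x = \<theta> x" if "x \<in> E" for x
    proof -
      have "f x = \<theta> x"
      proof (rule agree_on_gen[OF f(1) \<theta>(1)])
        show "set d \<subseteq> X" using d(1) Z_sub by auto
        show "f y = \<theta> y" if "y \<in> set d" for y using that f(3) by simp
        show "x \<in> gen (set d)" using that by (simp add: E_def)
      qed
      moreover have "x \<in> Z" using that AZ(4) by blast
      ultimately show ?thesis by (simp add: on_Z_def)
    qed
    have "on_Z f ` E = E" using eq \<theta>(2) by simp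
    moreover have "agree_on B (on_Z f) \<phi>"
      using eq sub(1) \<theta>(3) lift(2)[OF h(1)] AZ(2) by (auto simp: agree_on_def subset_iff)
    moreover have "agree_on (g ` C) (on_Z f) \<psi>"
      using eq sub(2) \<theta>(4) lift(2)[OF h(2)] gCZ by (auto simp: agree_on_def subset_iff)
    ultimately show ?thesis using on_Z_in[OF f(1,2)] by blast
  qed
  have "agree_on A (on_Z g) id"
    using copy AZ(1) a(3) by (auto simp: agree_on_def on_Z_def independent_copy_def)
  moreover have "E \<in> skeleton_pieces" using d by (auto simp: skeleton_pieces_def E_def)
  ultimately show ?thesis
    using on_Z_in[OF g] sub glue unfolding img[symmetric] by (intro bexI[of _ "on_Z g"] bexI[of _ E] conjI) auto
qed

sublocale closed_permutation_group Z skeleton_perms skeleton_pieces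
proof
  fix p assume p: "p \<in> skeleton_perms"
  show "p permutes Z" by (rule lift(3)[OF p])
  have "perm_inv p permutes Z" by (rule permutes_inv[OF lift(3)[OF p]])
  moreover have "agree_on Z (ainv (lift p)) (perm_inv p)"
    unfolding agree_on_def
  proof
    fix x assume "x \<in> Z"
    then have y: "perm_inv p x \<in> Z" using permutes_in_image[OF \<open>perm_inv p permutes Z\<close>] by simp
    have "lift p (perm_inv p x) = x" using lift(2)[OF p y] permutes_inverses(1)[OF lift(3)[OF p]] by simp
    then show "ainv (lift p) x = perm_inv p x" using ainv_left[OF lift(1)[OF p], of "perm_inv p x"] y Z_sub by auto
  qed
  ultimately show "perm_inv p \<in> skeleton_perms"
    using ainv_aut[OF lift(1)[OF p]] by (auto simp: skeleton_perms_def)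
  fix q assume q: "q \<in> skeleton_perms"
  have "p \<circ> q permutes Z" using lift(3)[OF p] lift(3)[OF q] by (rule permutes_compose[rotated])
  moreover have "agree_on Z (compose X (lift p) (lift q)) (p \<circ> q)"
    using lift(2)[OF p] lift(2,4)[OF q] Z_sub by (auto simp: agree_on_def compose_def subset_iff)
  ultimately show "p \<circ> q \<in> skeleton_perms"
    using compose_aut[OF lift(1)[OF p] lift(1)[OF q]] by (auto simp: skeleton_perms_def)
next
  show "id \<in> skeleton_perms"
    using id_aut Z_sub permutes_id by (auto simp: skeleton_perms_def agree_on_def intro!: bexI[OF _ id_aut])
  have "countable {a \<in> lists Z. a \<noteq> []}"
    by (rule countable_subset[OF _ countable_lists[OF countable]]) auto
  then show "countable skeleton_pieces" unfolding skeleton_pieces_def by (rule countable_image)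
  obtain x where x: "x \<in> Z" using Z_nonempty by blast
  then have "gen (set [x]) \<in> skeleton_pieces" unfolding skeleton_pieces_def by (intro imageI) auto
  then show "skeleton_pieces \<noteq> {}" by blast
  show "\<Union>skeleton_pieces = Z"
  proof
    show "\<Union>skeleton_pieces \<subseteq> Z" using gen_Z by (auto simp: skeleton_pieces_def)
    show "Z \<subseteq> \<Union>skeleton_pieces"
    proof
      fix x assume "x \<in> Z"
      then have "gen (set [x]) \<in> skeleton_pieces" unfolding skeleton_pieces_def by (intro imageI) auto
      moreover have "x \<in> gen (set [x])" by (rule hull_inc) simp
      ultimately show "x \<in> \<Union>skeleton_pieces" by blast
    qed
  qed
next
  fix D E assume "D \<in> skeleton_pieces" "E \<in> skeleton_pieces"
  then obtain a b where a: "a \<in> lists Z" "a \<noteq> []" "D = gen (set a)" and b: "b \<in> lists Z" "E = gen (set b)"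
    by (auto simp: skeleton_pieces_def)
  have "D \<subseteq> gen (set (a @ b))" "E \<subseteq> gen (set (a @ b))" unfolding a(3) b(2) by (rule hull_mono, simp)+
  moreover have "gen (set (a @ b)) \<in> skeleton_pieces" unfolding skeleton_pieces_def using a b by (intro imageI) auto
  ultimately show "\<exists>F\<in>skeleton_pieces. D \<union> E \<subseteq> F" by blast
next
  fix p D assume p: "p \<in> skeleton_perms" and "D \<in> skeleton_pieces"
  then obtain a where a: "a \<in> lists Z" "a \<noteq> []" "D = gen (set a)" by (auto simp: skeleton_pieces_def)
  show "p ` D \<in> skeleton_pieces"
    unfolding a(3) image_skeleton_piece(1)[OF p a(1)] skeleton_pieces_def
    using image_skeleton_piece(2)[OF p a(1)] a(2) by (intro imageI) auto
qed (rule skeleton_closed skeleton_separable skeleton_extend_partial skeleton_independence; assumption)+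

end

context countable_skeleton
begin

text \<open>
  Transfer of \<open>stabilizer_in_sixfold_product\<close> to the automorphisms that preserve \<open>Z\<close>. Density of \<open>Z\<close> makes
  an automorphism unique for the permutation that it induces.
\<close>

lemma stabilizer_absorbed:
  assumes cover: "Aut \<subseteq> (\<Union>n::nat. A n)" and W: "W \<subseteq> Aut" "\<And>w. w \<in> W \<Longrightarrow> ainv w \<in> W"
    and quotient: "\<And>n p q. p \<in> A n \<Longrightarrow> q \<in> A n \<Longrightarrow> compose X (ainv p) q \<in> W"
    and sixfold: "\<And>a b c d e f. a \<in> W \<Longrightarrow> b \<in> W \<Longrightarrow> c \<in> W \<Longrightarrow> d \<in> W \<Longrightarrow> e \<in> W \<Longrightarrow> f \<in> W \<Longrightarrow>
      compose X (compose X (compose X (compose X (compose X a b) c) d) e) f \<in> U"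
  obtains a where "a \<in> lists Z" "a \<noteq> []" "\<And>g. g \<in> aut_fix L M a \<Longrightarrow> g ` Z = Z \<Longrightarrow> g \<in> U"
proof -
  define V where "V = {p \<in> skeleton_perms. \<exists>w\<in>W. agree_on Z w p}"
  define B where "B n = {p \<in> skeleton_perms. lift p \<in> A n}" for n
  \<comment> \<open>translating by an element of \<open>A\<^sub>n\<close> that itself comes from the permutation group\<close>
  define k where "k n = (if B n = {} then id else SOME p. p \<in> B n)" for n
  have kB: "k n \<in> B n" if "B n \<noteq> {}" for n
    using that some_in_eq[of "B n"] by (simp add: k_def)
  have k: "k n \<in> skeleton_perms" for n
  proof (cases "B n = {}")
    case True
    then show ?thesis using id_in by (simp add: k_def)
  next
    case False
    then show ?thesis using kB[OF False] by (simp add: B_def)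
  qed
  have agree_ainv: "agree_on Z (ainv g) (perm_inv p)"
    if g: "g \<in> Aut" "agree_on Z g p" and p: "p \<in> skeleton_perms" for g p
    unfolding agree_on_def
  proof
    fix x assume "x \<in> Z"
    then have y: "perm_inv p x \<in> Z" using lift(4)[OF inv_in[OF p]] by simp
    then have "g (perm_inv p x) = x" using agree_onD[OF g(2) y] p by simp
    then show "ainv g x = perm_inv p x" using ainv_left[OF g(1), of "perm_inv p x"] y Z_sub by auto
  qed
  have agree_comp: "agree_on Z (compose X g h) (p \<circ> q)"
    if "agree_on Z g p" "agree_on Z h q" "q \<in> skeleton_perms" for g h p q
  proof -
    have "compose X g h x = p (q x)" if x: "x \<in> Z" for x
    proof -
      have "compose X g h x = g (h x)" using x Z_sub by (auto simp: compose_def)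
      also have "\<dots> = g (q x)" using agree_onD[OF \<open>agree_on Z h q\<close> x] by simp
      also have "\<dots> = p (q x)" using agree_onD[OF \<open>agree_on Z g p\<close> lift(4)[OF \<open>q \<in> skeleton_perms\<close> x]] .
      finally show ?thesis .
    qed
    then show ?thesis by (simp add: agree_on_def)
  qed
  have lift_agree: "agree_on Z (lift p) p" if "p \<in> skeleton_perms" for p
    using lift(2)[OF that] by (simp add: agree_on_def)
  obtain D where D: "D \<in> skeleton_pieces"
    "\<And>g. g \<in> skeleton_perms \<Longrightarrow> agree_on D g id \<Longrightarrow>
       \<exists>a\<in>V. \<exists>b\<in>V. \<exists>c\<in>V. \<exists>d\<in>V. \<exists>e\<in>V. \<exists>f\<in>V. g = a \<circ> b \<circ> c \<circ> d \<circ> e \<circ> f"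
  proof (rule stabilizer_in_sixfold_product[OF k])
    show "V \<subseteq> skeleton_perms" by (auto simp: V_def)
    show "perm_inv w \<in> V" if w: "w \<in> V" for w
    proof -
      obtain g where "w \<in> skeleton_perms" "g \<in> W" "agree_on Z g w" using w by (auto simp: V_def)
      then show ?thesis using inv_in W agree_ainv[of g w] by (auto simp: V_def)
    qed
    show "\<exists>n. perm_inv (k n) \<circ> p \<in> V" if p: "p \<in> skeleton_perms" for p
    proof -
      obtain n where n: "lift p \<in> A n" using cover lift(1)[OF p] by blast
      then have "p \<in> B n" using p by (simp add: B_def)
      then have kn: "lift (k n) \<in> A n" using kB[of n] by (auto simp: B_def)
      have "agree_on Z (ainv (lift (k n))) (perm_inv (k n))"
        by (rule agree_ainv[OF lift(1)[OF k] lift_agree[OF k] k])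
      then have "agree_on Z (compose X (ainv (lift (k n))) (lift p)) (perm_inv (k n) \<circ> p)"
        using lift_agree[OF p] p by (rule agree_comp)
      then have "perm_inv (k n) \<circ> p \<in> V"
        using quotient[OF kn n] comp_in[OF inv_in[OF k] p] by (auto simp: V_def)
      then show ?thesis by blast
    qed
  next
    fix D assume "D \<in> skeleton_pieces"
      "\<And>g. g \<in> skeleton_perms \<Longrightarrow> agree_on D g id \<Longrightarrow>
         \<exists>a\<in>V. \<exists>b\<in>V. \<exists>c\<in>V. \<exists>d\<in>V. \<exists>e\<in>V. \<exists>f\<in>V. g = a \<circ> b \<circ> c \<circ> d \<circ> e \<circ> f"
    then show thesis by (rule that)
  qed
  obtain a where a: "a \<in> lists Z" "a \<noteq> []" "D = gen (set a)" using D(1) by (auto simp: skeleton_pieces_def)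
  have "g \<in> U" if g: "g \<in> aut_fix L M a" "g ` Z = Z" for g
  proof -
    have gA: "g \<in> Aut" and ga: "map g a = a" using g(1) by (simp_all add: aut_fix_def)
    have P: "on_Z g \<in> skeleton_perms" by (rule on_Z_in[OF gA g(2)])
    have "on_Z g x = x" if x: "x \<in> gen (set a)" for x
    proof -
      have "g x = restrict (\<lambda>x. x) X x"
      proof (rule agree_on_gen[OF gA id_aut _ _ x])
        show "set a \<subseteq> X" using a(1) Z_sub by auto
        show "g y = restrict (\<lambda>x. x) X y" if y: "y \<in> set a" for y
          using y ga a(1) Z_sub by (auto simp: map_eq_conv[of g a "\<lambda>x. x", simplified] subset_iff)
      qed
      moreover have "x \<in> Z" using x gen_Z[OF a(1)] by blast
      ultimately show ?thesis using Z_sub by (auto simp: on_Z_def)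
    qed
    then have "agree_on D (on_Z g) id" unfolding a(3) by (simp add: agree_on_def)
    from D(2)[OF P this] obtain p1 p2 p3 p4 p5 p6 where p: "p1 \<in> V" "p2 \<in> V" "p3 \<in> V" "p4 \<in> V" "p5 \<in> V" "p6 \<in> V"
      "on_Z g = p1 \<circ> p2 \<circ> p3 \<circ> p4 \<circ> p5 \<circ> p6" by blast
    have "\<forall>p\<in>V. \<exists>w. w \<in> W \<and> agree_on Z w p" by (auto simp: V_def)
    then obtain \<eta> where \<eta>: "\<And>p. p \<in> V \<Longrightarrow> \<eta> p \<in> W" "\<And>p. p \<in> V \<Longrightarrow> agree_on Z (\<eta> p) p" by metis
    have VP: "p \<in> skeleton_perms" if "p \<in> V" for p using that by (simp add: V_def)
    define h where "h = compose X (compose X (compose X (compose X (compose X (\<eta> p1) (\<eta> p2)) (\<eta> p3)) (\<eta> p4)) (\<eta> p5)) (\<eta> p6)"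
    have "agree_on Z h (on_Z g)"
      unfolding h_def p(7) by (intro agree_comp \<eta>(2) VP p(1-6))
    moreover have "h \<in> U" unfolding h_def by (intro sixfold \<eta>(1) p(1-6))
    moreover have "h \<in> Aut" unfolding h_def using \<eta>(1) p(1-6) W(1) by (intro compose_aut) auto
    ultimately have "h = g"
      by (intro aut_eq_on_dense[OF _ gA dense]) (auto simp: agree_on_def on_Z_def)
    then show ?thesis using \<open>h \<in> U\<close> by simp
  qed
  then show ?thesis using that a(1,2) by blast
qed

end

context metric_fo_structure
begin

text \<open>
  The list \<open>t\<close> codes an instance of one of three requirements: a partial action on generators to be
  extended, a triple of generating tuples for which an independent copy is wanted, or a tuple \<open>a\<close> whose
  stabiliser is not contained in \<open>U\<close>. The automorphisms in \<open>K\<close> and the points in \<open>E\<close> meet it.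
\<close>

definition witnesses :: "('a \<Rightarrow> 'a) set \<Rightarrow> 'a list list \<Rightarrow> ('a \<Rightarrow> 'a) set \<Rightarrow> 'a set \<Rightarrow> bool" where
  "witnesses U t K E \<longleftrightarrow>
    (\<forall>a bs. t = a # bs \<and> a \<noteq> [] \<and> (\<forall>b\<in>set bs. \<exists>g\<in>Aut. map g a = b) \<longrightarrow>
       (\<exists>e f. set e \<subseteq> E \<and> e \<noteq> [] \<and> gen (set a) \<subseteq> gen (set e) \<and>
          (\<forall>b\<in>set bs. f b \<in> K \<and> map (f b) a = b \<and> f b ` gen (set e) = gen (set e)))) \<and>
    (\<forall>a b c. t = [a, b, c] \<and> a \<noteq> [] \<and> b \<noteq> [] \<and> c \<noteq> [] \<and> gen (set a) \<subseteq> gen (set b) \<and> gen (set a) \<subseteq> gen (set c) \<longrightarrow>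
       (\<exists>g\<in>K. independent_copy a b c g)) \<and>
    (\<forall>a. t = [a] \<longrightarrow> (\<exists>g\<in>K. g \<in> aut_fix L M a - U))"

lemma skeleton_witnesses:
  assumes hrushovski: "hrushovski_property L M" and extension: "extension_property L M"
    and bad: "\<And>a. a \<in> lists X \<Longrightarrow> \<exists>g\<in>aut_fix L M a. g \<notin> U"
    and t: "t \<in> lists (lists X)"
  shows "\<exists>K E. K \<subseteq> Aut \<and> countable K \<and> E \<subseteq> X \<and> countable E \<and>
    witnesses U t K E"
proof -
  have "\<exists>K E. K \<subseteq> Aut \<and> countable K \<and> E \<subseteq> X \<and> countable E \<and>
    (\<forall>a bs. t = a # bs \<and> a \<noteq> [] \<and> (\<forall>b\<in>set bs. \<exists>g\<in>Aut. map g a = b) \<longrightarrow>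
       (\<exists>e f. set e \<subseteq> E \<and> e \<noteq> [] \<and> gen (set a) \<subseteq> gen (set e) \<and>
          (\<forall>b\<in>set bs. f b \<in> K \<and> map (f b) a = b \<and> f b ` gen (set e) = gen (set e))))"
  proof (cases "\<exists>a bs. t = a # bs \<and> a \<noteq> [] \<and> (\<forall>b\<in>set bs. \<exists>g\<in>Aut. map g a = b)")
    case True
    then obtain a bs where a: "t = a # bs" "a \<noteq> []" "\<forall>b\<in>set bs. \<exists>g\<in>Aut. map g a = b" by blast
    have "\<exists>e f. e \<in> lists X \<and> e \<noteq> [] \<and> gen (set a) \<subseteq> gen (set e) \<and>
        (\<forall>b\<in>set bs. f b \<in> Aut \<and> map (f b) a = b \<and> f b ` gen (set e) = gen (set e))"
      by (rule extend_finite_partial[OF hrushovski]) (use t a in auto)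
    then obtain e f where e: "e \<in> lists X" "e \<noteq> []" "gen (set a) \<subseteq> gen (set e)"
      "\<forall>b\<in>set bs. f b \<in> Aut \<and> map (f b) a = b \<and> f b ` gen (set e) = gen (set e)" by blast
    show ?thesis
    proof (intro exI[of _ "f ` set bs"] exI[of _ "set e"] conjI allI impI)
      fix a' bs' assume "t = a' # bs' \<and> a' \<noteq> [] \<and> (\<forall>b\<in>set bs'. \<exists>g\<in>Aut. map g a' = b)"
      then have "a' = a" "bs' = bs" using a(1) by auto
      then show "\<exists>e' f'. set e' \<subseteq> set e \<and> e' \<noteq> [] \<and> gen (set a') \<subseteq> gen (set e') \<and>
          (\<forall>b\<in>set bs'. f' b \<in> f ` set bs \<and> map (f' b) a' = b \<and> f' b ` gen (set e') = gen (set e'))"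
        using e by (intro exI[of _ e] exI[of _ f]) auto
    qed (use e in \<open>auto intro: countable_finite\<close>)
  next
    case False
    then show ?thesis by (intro exI[of _ "{}"]) auto
  qed
  then obtain K E where K: "K \<subseteq> Aut" "countable K" "E \<subseteq> X" "countable E"
    and KE: "\<And>a bs. t = a # bs \<and> a \<noteq> [] \<and> (\<forall>b\<in>set bs. \<exists>g\<in>Aut. map g a = b) \<Longrightarrow>
       \<exists>e f. set e \<subseteq> E \<and> e \<noteq> [] \<and> gen (set a) \<subseteq> gen (set e) \<and>
          (\<forall>b\<in>set bs. f b \<in> K \<and> map (f b) a = b \<and> f b ` gen (set e) = gen (set e))"
    by (elim exE conjE) (rule that, assumption+, blast)
  have "\<exists>g\<in>Aut. \<forall>a b c. t = [a, b, c] \<and> a \<noteq> [] \<and> b \<noteq> [] \<and> c \<noteq> [] \<and> gen (set a) \<subseteq> gen (set b) \<and>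
      gen (set a) \<subseteq> gen (set c) \<longrightarrow> independent_copy a b c g"
  proof (cases "\<exists>a b c. t = [a, b, c] \<and> a \<noteq> [] \<and> b \<noteq> [] \<and> c \<noteq> [] \<and> gen (set a) \<subseteq> gen (set b) \<and>
      gen (set a) \<subseteq> gen (set c)")
    case True
    then obtain a b c where abc: "t = [a, b, c]" "a \<noteq> []" "b \<noteq> []" "c \<noteq> []"
      "gen (set a) \<subseteq> gen (set b)" "gen (set a) \<subseteq> gen (set c)" by blast
    have "\<exists>g\<in>Aut. independent_copy a b c g"
      by (rule independent_copy_exists[OF hrushovski extension]) (use t abc in auto)
    then show ?thesis using abc(1) by auto
  next
    case False
    then show ?thesis using id_aut by blast
  qed
  then obtain g where g: "g \<in> Aut" "\<And>a b c. t = [a, b, c] \<Longrightarrow> a \<noteq> [] \<Longrightarrow> b \<noteq> [] \<Longrightarrow> c \<noteq> [] \<Longrightarrow>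
      gen (set a) \<subseteq> gen (set b) \<Longrightarrow> gen (set a) \<subseteq> gen (set c) \<Longrightarrow> independent_copy a b c g"
    by auto
  have "\<exists>h\<in>Aut. \<forall>a. t = [a] \<longrightarrow> h \<in> aut_fix L M a - U"
  proof (cases "\<exists>a. t = [a]")
    case True
    then obtain a where a: "t = [a]" by blast
    then obtain h where "h \<in> aut_fix L M a" "h \<notin> U" using bad[of a] t by auto
    then show ?thesis using a by (intro bexI[of _ h]) (auto simp: aut_fix_def)
  next
    case False
    then show ?thesis using id_aut by blast
  qed
  then obtain h where h: "h \<in> Aut" "\<And>a. t = [a] \<Longrightarrow> h \<in> aut_fix L M a - U" by blast
  show ?thesis
    unfolding witnesses_def
  proof (intro exI[of _ "insert g (insert h K)"] exI[of _ E] conjI allI impI)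
    fix a bs assume "t = a # bs \<and> a \<noteq> [] \<and> (\<forall>b\<in>set bs. \<exists>g\<in>Aut. map g a = b)"
    from KE[OF this] obtain e f where "set e \<subseteq> E" "e \<noteq> []" "gen (set a) \<subseteq> gen (set e)"
      "\<forall>b\<in>set bs. f b \<in> K \<and> map (f b) a = b \<and> f b ` gen (set e) = gen (set e)" by blast
    then show "\<exists>e f. set e \<subseteq> E \<and> e \<noteq> [] \<and> gen (set a) \<subseteq> gen (set e) \<and>
        (\<forall>b\<in>set bs. f b \<in> insert g (insert h K) \<and> map (f b) a = b \<and> f b ` gen (set e) = gen (set e))"
      by (intro exI[of _ e] exI[of _ f]) simp
  next
    fix a b c assume "t = [a, b, c] \<and> a \<noteq> [] \<and> b \<noteq> [] \<and> c \<noteq> [] \<and> gen (set a) \<subseteq> gen (set b) \<and> gen (set a) \<subseteq> gen (set c)"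
    then have "independent_copy a b c g" using g(2) by simp
    then show "\<exists>g\<in>insert g (insert h K). independent_copy a b c g" by blast
  next
    fix a assume "t = [a]"
    then show "\<exists>g\<in>insert g (insert h K). g \<in> aut_fix L M a - U" using h(2) by blast
  qed (use K g h in simp_all)
qed

text \<open>
  Close off a countable dense set under the witnesses of all its finite codes, under the chosen
  automorphisms and their inverses, and under the function symbols.
\<close>

lemma skeleton_exists:
  assumes complete: mcomplete and Y: "dense_in_X Y" "countable Y" and lang: "countable_language L"
    and hrushovski: "hrushovski_property L M" and extension: "extension_property L M"
    and bad: "\<And>a. a \<in> lists X \<Longrightarrow> \<exists>g\<in>aut_fix L M a. g \<notin> U"
  obtains Z where "countable_skeleton L M m Z"
    "\<And>a. a \<in> lists Z \<Longrightarrow> \<exists>g\<in>aut_fix L M a. g ` Z = Z \<and> g \<notin> U"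
proof -
  have "\<exists>K E. K \<subseteq> Aut \<and> countable K \<and> E \<subseteq> X \<and> countable E \<and> witnesses U t K E" if "t \<in> lists (lists X)" for t
    by (rule skeleton_witnesses[OF hrushovski extension bad that])
  then obtain K E where KE: "\<And>t. t \<in> lists (lists X) \<Longrightarrow>
      K t \<subseteq> Aut \<and> countable (K t) \<and> E t \<subseteq> X \<and> countable (E t) \<and> witnesses U t (K t) (E t)"
    by metis
  \<comment> \<open>the head \<open>[x]\<close> of a list asks for the images of \<open>x\<close> under the automorphisms chosen for the tail\<close>
  define \<Phi> where "\<Phi> t = E t \<union> (\<lambda>F. fun_int M F (concat t)) ` {F \<in> fun_syms L. fun_arity L F = length (concat t)} \<union>
      (case t of (x # _) # u \<Rightarrow> (\<lambda>k. k x) ` K u \<union> (\<lambda>k. ainv k x) ` K u | _ \<Rightarrow> {})" for t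
  obtain Z where Z: "countable Z" "Y \<subseteq> Z" "Z \<subseteq> X" "\<And>t. t \<in> lists (lists Z) \<Longrightarrow> \<Phi> t \<subseteq> Z"
  proof (rule countable_closure[of Y X \<Phi>])
    show "countable Y" by (rule Y(2))
    show "Y \<subseteq> X" using Y(1) by (simp add: dense_in_X_def)
    fix t assume t: "t \<in> lists (lists X)"
    have "set (concat t) \<subseteq> X" using t by auto
    then have F: "(\<lambda>F. fun_int M F (concat t)) ` {F \<in> fun_syms L. fun_arity L F = length (concat t)} \<subseteq> X"
      using fun_int_in by (auto simp: nlists_def)
    have "countable {F \<in> fun_syms L. fun_arity L F = length (concat t)}"
      using lang unfolding countable_language_def by (metis (no_types, lifting) countable_subset mem_Collect_eq subsetI)
    moreover have "countable (case t of (x # _) # u \<Rightarrow> (\<lambda>k. k x) ` K u \<union> (\<lambda>k. ainv k x) ` K u | _ \<Rightarrow> {})"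
    proof (cases "\<exists>x xs u. t = (x # xs) # u")
      case True
      then obtain x xs u where tu: "t = (x # xs) # u" by blast
      then have "countable (K u)" using KE[of u] t by simp
      then show ?thesis by (simp add: tu)
    next
      case False
      then show ?thesis by (auto split: list.splits)
    qed
    moreover have "(case t of (x # _) # u \<Rightarrow> (\<lambda>k. k x) ` K u \<union> (\<lambda>k. ainv k x) ` K u | _ \<Rightarrow> {}) \<subseteq> X"
    proof (cases t)
      case (Cons xs u)
      show ?thesis
      proof (cases xs)
        case (Cons x xs')
        have x: "x \<in> X" and u: "K u \<subseteq> Aut" using t KE[of u] \<open>t = xs # u\<close> Cons by auto
        have "k x \<in> X" "ainv k x \<in> X" if "k \<in> K u" for k
          using aut_in[OF _ x] ainv_aut u that by blast+
        then show ?thesis using \<open>t = xs # u\<close> Cons by auto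
      qed (simp add: Cons)
    qed simp
    ultimately show "countable (\<Phi> t) \<and> \<Phi> t \<subseteq> X"
      unfolding \<Phi>_def using KE[OF t] F by (intro conjI countable_Un countable_image Un_least) auto
  next
    fix Z assume "countable Z" "Y \<subseteq> Z" "Z \<subseteq> X" "\<And>t. t \<in> lists (lists Z) \<Longrightarrow> \<Phi> t \<subseteq> Z"
    then show thesis by (rule that)
  qed
  have listsZ: "t \<in> lists (lists X)" if "t \<in> lists (lists Z)" for t
    using that lists_mono[OF lists_mono[OF Z(3)]] by blast
  have stable: "k \<in> Aut" "k ` Z = Z" if t: "t \<in> lists (lists Z)" and k: "k \<in> K t" for t k
  proof -
    show kA: "k \<in> Aut" using KE[OF listsZ[OF t]] k by blast
    have "k x \<in> Z" "ainv k x \<in> Z" if x: "x \<in> Z" for x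
    proof -
      have "\<Phi> ([x] # t) \<subseteq> Z" using x t by (intro Z(4)) auto
      then show "k x \<in> Z" "ainv k x \<in> Z" using k by (auto simp: \<Phi>_def)
    qed
    moreover have "k (ainv k x) = x" if "x \<in> Z" for x using ainv_right[OF kA] that Z(3) by blast
    ultimately show "k ` Z = Z" by (metis image_subsetI image_eqI subsetI subset_antisym)
  qed
  have E: "E t \<subseteq> Z" if "t \<in> lists (lists Z)" for t using Z(4)[OF that] by (auto simp: \<Phi>_def)
  have good: "witnesses U t (K t) (E t)" if "t \<in> lists (lists Z)" for t using KE[OF listsZ[OF that]] by blast
  have "countable_skeleton L M m Z"
  proof
    show mcomplete by (rule complete)
    show "dense_in_X Z" using Y(1) Z(2,3) unfolding dense_in_X_def by blast
    show "countable Z" by (rule Z(1))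
    show "fun_closed L M Z"
    proof (rule fun_closedI[OF Z(3)])
      fix F xs assume F: "F \<in> fun_syms L" "xs \<in> nlists (fun_arity L F) Z"
      then have "[xs] \<in> lists (lists Z)" "fun_arity L F = length xs" by (auto simp: nlists_def)
      moreover from this(1) have "\<Phi> [xs] \<subseteq> Z" by (rule Z(4))
      ultimately show "fun_int M F xs \<in> Z" using F(1) by (auto simp: \<Phi>_def)
    qed
  next
    fix a bs assume a: "a \<in> lists Z" "a \<noteq> []" "bs \<in> lists (lists Z)"
      and ex: "\<And>b. b \<in> set bs \<Longrightarrow> \<exists>g\<in>Aut. map g a = b"
    have t: "a # bs \<in> lists (lists Z)" using a by simp
    obtain e f where e: "set e \<subseteq> E (a # bs)" "e \<noteq> []" "gen (set a) \<subseteq> gen (set e)"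
      and f: "\<And>b. b \<in> set bs \<Longrightarrow> f b \<in> K (a # bs) \<and> map (f b) a = b \<and> f b ` gen (set e) = gen (set e)"
      using good[OF t, unfolded witnesses_def, THEN conjunct1, rule_format, of a bs] a(2) ex by blast
    have "e \<in> lists Z" using e(1) E[OF t] by auto
    moreover have "f b \<in> Aut \<and> f b ` Z = Z \<and> map (f b) a = b \<and> f b ` gen (set e) = gen (set e)"
      if "b \<in> set bs" for b
      using f[OF that] stable[OF t] by simp
    ultimately show "\<exists>e f. e \<in> lists Z \<and> e \<noteq> [] \<and> gen (set a) \<subseteq> gen (set e) \<and>
        (\<forall>b\<in>set bs. f b \<in> Aut \<and> f b ` Z = Z \<and> map (f b) a = b \<and> f b ` gen (set e) = gen (set e))"
      using e(2,3) by (intro exI[of _ e] exI[of _ f]) blast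
  next
    fix a b c assume abc: "a \<in> lists Z" "a \<noteq> []" "b \<in> lists Z" "b \<noteq> []" "c \<in> lists Z" "c \<noteq> []"
      "gen (set a) \<subseteq> gen (set b)" "gen (set a) \<subseteq> gen (set c)"
    have t: "[a, b, c] \<in> lists (lists Z)" using abc by simp
    obtain g where "g \<in> K [a, b, c]" "independent_copy a b c g"
      using good[OF t, unfolded witnesses_def, THEN conjunct2, THEN conjunct1, rule_format, of a b c] abc by blast
    then show "\<exists>g\<in>Aut. g ` Z = Z \<and> independent_copy a b c g" using stable[OF t] by blast
  qed
  moreover have "\<exists>g\<in>aut_fix L M a. g ` Z = Z \<and> g \<notin> U" if a: "a \<in> lists Z" for a
  proof -
    have t: "[a] \<in> lists (lists Z)" using a by simp
    obtain g where "g \<in> K [a]" "g \<in> aut_fix L M a - U"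
      using good[OF t, unfolded witnesses_def, THEN conjunct2, THEN conjunct2, rule_format, of a] by blast
    then show ?thesis using stable[OF t] by blast
  qed
  ultimately show ?thesis by (rule that)
qed

text \<open>
  If each stabiliser contained an element outside \<open>U\<close>, a skeleton closed under such elements would
  contradict \<open>stabilizer_absorbed\<close>.
\<close>

theorem tuple_stabilizer_absorbed:
  assumes complete: mcomplete and Y: "dense_in_X Y" "countable Y" and lang: "countable_language L"
    and hrushovski: "hrushovski_property L M" and extension: "extension_property L M"
    and cover: "Aut \<subseteq> (\<Union>n::nat. A n)" and W: "W \<subseteq> Aut" "\<And>w. w \<in> W \<Longrightarrow> ainv w \<in> W"
    and quotient: "\<And>n p q. p \<in> A n \<Longrightarrow> q \<in> A n \<Longrightarrow> compose X (ainv p) q \<in> W"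
    and sixfold: "\<And>a b c d e f. a \<in> W \<Longrightarrow> b \<in> W \<Longrightarrow> c \<in> W \<Longrightarrow> d \<in> W \<Longrightarrow> e \<in> W \<Longrightarrow> f \<in> W \<Longrightarrow>
      compose X (compose X (compose X (compose X (compose X a b) c) d) e) f \<in> U"
  obtains a where "a \<in> lists X" "aut_fix L M a \<subseteq> U"
proof (rule ccontr)
  note witness = that
  assume contra: "\<not> thesis"
  have "\<exists>g\<in>aut_fix L M a. g \<notin> U" if "a \<in> lists X" for a
    using contra witness[OF that] by blast
  then obtain Z where Z: "countable_skeleton L M m Z" "\<And>a. a \<in> lists Z \<Longrightarrow> \<exists>g\<in>aut_fix L M a. g ` Z = Z \<and> g \<notin> U"
    by (rule skeleton_exists[OF complete Y lang hrushovski extension]) blast+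
  interpret countable_skeleton L M m Z by (rule Z(1))
  obtain a where "a \<in> lists Z" "\<And>g. g \<in> aut_fix L M a \<Longrightarrow> g ` Z = Z \<Longrightarrow> g \<in> U"
    by (rule stabilizer_absorbed[OF cover W quotient sixfold]) blast+
  then show False using Z(2)[of a] by blast
qed

end

section \<open>Topological groups\<close>

lemma topological_group_translate:
  assumes "topological_group H S" "a \<in> carrier H" "openin S V"
  shows "openin S {x \<in> carrier H. a \<otimes>\<^bsub>H\<^esub> x \<in> V}"
proof -
  have top: "topspace S = carrier H" and
    mult: "continuous_map (prod_topology S S) S (\<lambda>(x, y). x \<otimes>\<^bsub>H\<^esub> y)"
    using assms(1) by (simp_all add: topological_group_def)
  have "continuous_map S (prod_topology S S) (\<lambda>x. (a, x))"
    using assms(2) top by (intro continuous_map_pairedI) auto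
  from continuous_map_compose[OF this mult] have "continuous_map S S (\<lambda>x. a \<otimes>\<^bsub>H\<^esub> x)"
    by (simp add: o_def)
  from openin_continuous_map_preimage[OF this assms(3)] show ?thesis by (simp add: top)
qed

lemma topological_group_halving:
  assumes H: "topological_group H S" and V: "openin S V" "\<one>\<^bsub>H\<^esub> \<in> V"
  obtains U where "openin S U" "\<one>\<^bsub>H\<^esub> \<in> U" "\<And>x. x \<in> U \<Longrightarrow> inv\<^bsub>H\<^esub> x \<in> U"
    "\<And>x y. x \<in> U \<Longrightarrow> y \<in> U \<Longrightarrow> x \<otimes>\<^bsub>H\<^esub> y \<in> V"
proof -
  interpret group H using H by (simp add: topological_group_def)
  have top: "topspace S = carrier H" and
    mult: "continuous_map (prod_topology S S) S (\<lambda>(x, y). x \<otimes>\<^bsub>H\<^esub> y)" and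
    inv: "continuous_map S S (\<lambda>x. inv\<^bsub>H\<^esub> x)"
    using H by (simp_all add: topological_group_def)
  have "openin (prod_topology S S) {p \<in> topspace (prod_topology S S). (\<lambda>(x, y). x \<otimes>\<^bsub>H\<^esub> y) p \<in> V}"
    using mult V(1) by (rule openin_continuous_map_preimage)
  moreover have "(\<one>\<^bsub>H\<^esub>, \<one>\<^bsub>H\<^esub>) \<in> {p \<in> topspace (prod_topology S S). (\<lambda>(x, y). x \<otimes>\<^bsub>H\<^esub> y) p \<in> V}"
    using V(2) by (simp add: top)
  ultimately obtain A B where A: "openin S A" "\<one>\<^bsub>H\<^esub> \<in> A" and B: "openin S B" "\<one>\<^bsub>H\<^esub> \<in> B"
    and AB: "A \<times> B \<subseteq> {p \<in> topspace (prod_topology S S). (\<lambda>(x, y). x \<otimes>\<^bsub>H\<^esub> y) p \<in> V}"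
    unfolding openin_prod_topology_alt by blast
  define C where "C = A \<inter> B"
  have C: "openin S C" "\<one>\<^bsub>H\<^esub> \<in> C" using A B by (auto simp: C_def)
  define U where "U = C \<inter> {x \<in> topspace S. inv\<^bsub>H\<^esub> x \<in> C}"
  show ?thesis
  proof (rule that)
    show "openin S U"
      unfolding U_def using C(1) openin_continuous_map_preimage[OF inv C(1)] by (rule openin_Int)
    show "\<one>\<^bsub>H\<^esub> \<in> U" using C(2) by (simp add: U_def top)
    show "inv\<^bsub>H\<^esub> x \<in> U" if "x \<in> U" for x using that by (simp add: U_def top)
    show "x \<otimes>\<^bsub>H\<^esub> y \<in> V" if "x \<in> U" "y \<in> U" for x y
    proof -
      have "(x, y) \<in> A \<times> B" using that by (simp add: U_def C_def)
      from subsetD[OF AB this] show ?thesis by simp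
    qed
  qed
qed

lemma topological_group_halving_sequence:
  assumes H: "topological_group H S" and V0: "openin S V0" "\<one>\<^bsub>H\<^esub> \<in> V0"
  obtains V :: "nat \<Rightarrow> 'a set" where "V 0 = V0" "\<And>n. openin S (V n)" "\<And>n. \<one>\<^bsub>H\<^esub> \<in> V n"
    "\<And>n x. x \<in> V (Suc n) \<Longrightarrow> inv\<^bsub>H\<^esub> x \<in> V (Suc n)"
    "\<And>n x y. x \<in> V (Suc n) \<Longrightarrow> y \<in> V (Suc n) \<Longrightarrow> x \<otimes>\<^bsub>H\<^esub> y \<in> V n"
proof -
  have "\<exists>V. \<forall>n. (openin S (V n) \<and> \<one>\<^bsub>H\<^esub> \<in> V n \<and> (n = 0 \<longrightarrow> V n = V0)) \<and>
      ((\<forall>x\<in>V (Suc n). inv\<^bsub>H\<^esub> x \<in> V (Suc n)) \<and> (\<forall>x\<in>V (Suc n). \<forall>y\<in>V (Suc n). x \<otimes>\<^bsub>H\<^esub> y \<in> V n))"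
  proof (rule dependent_nat_choice)
    show "\<exists>V. openin S V \<and> \<one>\<^bsub>H\<^esub> \<in> V \<and> ((0::nat) = 0 \<longrightarrow> V = V0)" using V0 by blast
  next
    fix V and n :: nat assume "openin S V \<and> \<one>\<^bsub>H\<^esub> \<in> V \<and> (n = 0 \<longrightarrow> V = V0)"
    then obtain U where "openin S U" "\<one>\<^bsub>H\<^esub> \<in> U" "\<And>x. x \<in> U \<Longrightarrow> inv\<^bsub>H\<^esub> x \<in> U"
      "\<And>x y. x \<in> U \<Longrightarrow> y \<in> U \<Longrightarrow> x \<otimes>\<^bsub>H\<^esub> y \<in> V"
      using topological_group_halving[OF H, of V] by (elim conjE) metis
    then show "\<exists>U. (openin S U \<and> \<one>\<^bsub>H\<^esub> \<in> U \<and> (Suc n = 0 \<longrightarrow> U = V0)) \<and>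
        (\<forall>x\<in>U. inv\<^bsub>H\<^esub> x \<in> U) \<and> (\<forall>x\<in>U. \<forall>y\<in>U. x \<otimes>\<^bsub>H\<^esub> y \<in> V)"
      by (intro exI[of _ U]) simp
  qed
  then obtain V where V: "\<And>n. (openin S (V n) \<and> \<one>\<^bsub>H\<^esub> \<in> V n \<and> (n = 0 \<longrightarrow> V n = V0)) \<and>
      ((\<forall>x\<in>V (Suc n). inv\<^bsub>H\<^esub> x \<in> V (Suc n)) \<and> (\<forall>x\<in>V (Suc n). \<forall>y\<in>V (Suc n). x \<otimes>\<^bsub>H\<^esub> y \<in> V n))"
    by blast
  show ?thesis by (rule that[of V]) (use V in simp_all)
qed

section \<open>Automatic continuity\<close>

context metric_fo_structure
begin

lemma near_compose_id:
  assumes g: "g \<in> Aut" and f: "f \<in> near F \<epsilon> (\<lambda>x. x)" and F: "F \<subseteq> X"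
  shows "compose X g f \<in> near F \<epsilon> g"
proof -
  have fA: "f \<in> Aut" using f by (simp add: near_def)
  have "d (compose X g f x) (g x) < \<epsilon>" if x: "x \<in> F" for x
  proof -
    have xX: "x \<in> X" using x F by blast
    have "d (g (f x)) (g x) = d (f x) x" by (rule aut_isometry[OF g aut_in[OF fA xX] xX])
    then show ?thesis using f x xX by (simp add: near_def compose_def)
  qed
  then show ?thesis using compose_aut[OF g fA] by (simp add: near_def)
qed

lemma near_ainv_compose:
  assumes g: "g \<in> Aut" and f: "f \<in> near F \<epsilon> g" and F: "F \<subseteq> X"
  shows "compose X (ainv g) f \<in> near F \<epsilon> (\<lambda>x. x)"
proof -
  have fA: "f \<in> Aut" using f by (simp add: near_def)
  have "d (compose X (ainv g) f x) x < \<epsilon>" if x: "x \<in> F" for x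
  proof -
    have xX: "x \<in> X" using x F by blast
    have "d (ainv g (f x)) (ainv g (g x)) = d (f x) (g x)"
      by (rule aut_isometry[OF ainv_aut[OF g] aut_in[OF fA xX] aut_in[OF g xX]])
    then show ?thesis using f x xX ainv_left[OF g xX] by (simp add: near_def compose_def)
  qed
  then show ?thesis using compose_aut[OF ainv_aut[OF g] fA] by (simp add: near_def)
qed

text \<open>
  If \<open>u\<close> fixes \<open>g b\<close>, \<open>v\<close> fixes \<open>b\<close> and \<open>u b = v (f b)\<close>, then \<open>x = g\<^sup>-\<^sup>1 u g\<close> and
  \<open>z = u\<^sup>-\<^sup>1 v f\<close> fix \<open>b\<close>, and \<open>f = v\<^sup>-\<^sup>1 u z\<close>.
\<close>

lemma orbit_meet_factorization:
  assumes g: "g \<in> Aut" and f: "f \<in> Aut" and b: "b \<in> lists X"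
    and meet: "orbit_over L M b (map g b) \<inter> orbit_over L M (map f b) b \<noteq> {}"
  obtains x y z where "x \<in> aut_fix L M b" "y \<in> aut_fix L M b" "z \<in> aut_fix L M b"
    "f = y \<otimes>\<^bsub>G\<^esub> (g \<otimes>\<^bsub>G\<^esub> x \<otimes>\<^bsub>G\<^esub> inv\<^bsub>G\<^esub> g) \<otimes>\<^bsub>G\<^esub> z"
proof -
  obtain u v where u: "u \<in> aut_fix L M (map g b)" and v: "v \<in> aut_fix L M b" and uv: "map u b = map v (map f b)"
    using meet unfolding orbit_over_def by blast
  have uA: "u \<in> Aut" "\<And>x. x \<in> set b \<Longrightarrow> u (g x) = g x" using u by (auto simp: aut_fix_def)
  have vA: "v \<in> Aut" "\<And>x. x \<in> set b \<Longrightarrow> v x = x" using v by (auto simp: aut_fix_def map_idI intro: map_eq_conv[THEN iffD1, rule_format, of v b "\<lambda>x. x", simplified])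
  have bX: "x \<in> X" if "x \<in> set b" for x using b that by auto
  define x where "x = compose X (ainv g) (compose X u g)"
  define y where "y = ainv v"
  define z where "z = compose X (ainv u) (compose X v f)"
  have xA: "x \<in> Aut" "y \<in> Aut" "z \<in> Aut"
    unfolding x_def y_def z_def by (intro compose_aut ainv_aut g f uA(1) vA(1))+
  have fix1: "x s = s" if s: "s \<in> set b" for s
    using bX[OF s] uA(2)[OF s] ainv_left[OF g bX[OF s]] by (simp add: x_def compose_def)
  have fix2: "y s = s" if s: "s \<in> set b" for s
    using ainv_left[OF vA(1) bX[OF s]] vA(2)[OF s] by (simp add: y_def)
  have fix3: "z s = s" if s: "s \<in> set b" for s
  proof -
    have "u s = v (f s)" using uv s by simp
    then show ?thesis using ainv_left[OF uA(1) bX[OF s]] bX[OF s] by (simp add: z_def compose_def)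
  qed
  show ?thesis
  proof (rule that)
    show "x \<in> aut_fix L M b" "y \<in> aut_fix L M b" "z \<in> aut_fix L M b"
      using xA fix1 fix2 fix3 by (simp_all add: aut_fix_def map_idI)
    show "f = y \<otimes>\<^bsub>G\<^esub> (g \<otimes>\<^bsub>G\<^esub> x \<otimes>\<^bsub>G\<^esub> inv\<^bsub>G\<^esub> g) \<otimes>\<^bsub>G\<^esub> z"
    proof (rule aut_ext[OF f])
      show "y \<otimes>\<^bsub>G\<^esub> (g \<otimes>\<^bsub>G\<^esub> x \<otimes>\<^bsub>G\<^esub> inv\<^bsub>G\<^esub> g) \<otimes>\<^bsub>G\<^esub> z \<in> Aut"
        using xA g by (simp add: mult_G inv_G compose_aut ainv_aut)
      fix s assume s: "s \<in> X"
      define t where "t = ainv u (v (f s))"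
      have vf: "v (f s) \<in> X" using aut_in[OF vA(1) aut_in[OF f s]] .
      have t: "t \<in> X" "z s = t" using aut_in[OF ainv_aut[OF uA(1)] vf] s by (simp_all add: t_def z_def compose_def)
      have gt: "ainv g t \<in> X" by (rule aut_in[OF ainv_aut[OF g] t(1)])
      have "x (ainv g t) = ainv g (u t)" using gt ainv_right[OF g t(1)] by (simp add: x_def compose_def)
      moreover have "u t = v (f s)" unfolding t_def by (rule ainv_right[OF uA(1) vf])
      moreover have "y (v (f s)) = f s" unfolding y_def by (rule ainv_left[OF vA(1) aut_in[OF f s]])
      ultimately show "f s = (y \<otimes>\<^bsub>G\<^esub> (g \<otimes>\<^bsub>G\<^esub> x \<otimes>\<^bsub>G\<^esub> inv\<^bsub>G\<^esub> g) \<otimes>\<^bsub>G\<^esub> z) s"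
        using xA g s t gt ainv_right[OF g vf]
        by (simp add: mult_G inv_G compose_aut ainv_aut) (simp add: compose_def)
    qed
  qed
qed

text \<open>
  The sets \<open>V n\<close> halve: a product of two elements of \<open>V (n + 1)\<close> lies in \<open>V n\<close>. Six factors cost five
  levels, from \<open>10\<close> to \<open>5\<close>, and the factorisation \<open>y (g x g\<^sup>-\<^sup>1) z\<close> leads from \<open>5\<close> to \<open>1\<close>; level \<open>0\<close> is
  left for the quotient of two such elements, and level \<open>11\<close> for the separability of the target.
\<close>

lemma continuous_at_identity:
  fixes H :: "'h monoid"
  assumes complete: mcomplete and Y: "dense_in_X Y" "countable Y" and lang: "countable_language L"
    and hrushovski: "hrushovski_property L M" and extension: "extension_property L M"
    and basis: "aut_basis L M m \<B>"
    and interior: "\<And>a \<epsilon>. a \<in> \<B> \<Longrightarrow> \<epsilon> > 0 \<Longrightarrow>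
           prod_topology T T interior_of
             {(g, f) \<in> aut_nbhd L M m a \<epsilon> \<times> Aut.
                orbit_over L M a (map g a) \<inter> orbit_over L M (map f a) a \<noteq> {}} \<noteq> {}"
    and H: "topological_group H S" "separable_space S" and h: "h \<in> hom G H"
    and O: "openin S O1" "\<one>\<^bsub>H\<^esub> \<in> O1"
  obtains F \<epsilon> where "finite F" "F \<subseteq> X" "0 < \<epsilon>" "\<And>g. g \<in> near F \<epsilon> (\<lambda>x. x) \<Longrightarrow> h g \<in> O1"
proof -
  have H_group: "group H" and top: "topspace S = carrier H" using H(1) by (simp_all add: topological_group_def)
  interpret H: group H by (rule H_group)
  interpret h: group_hom G H h
    by (intro group_hom.intro group_hom_axioms.intro group_G H_group h)
  have hA: "h g \<in> carrier H" if "g \<in> Aut" for g using h.hom_closed[of g] that by simp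
  have h_compose: "h (compose X g f) = h g \<otimes>\<^bsub>H\<^esub> h f" if "g \<in> Aut" "f \<in> Aut" for g f
    using h.hom_mult[of g f] that by (simp add: mult_G)
  have h_ainv: "h (ainv g) = inv\<^bsub>H\<^esub> h g" if "g \<in> Aut" for g
    using h.hom_inv[of g] that by (simp add: inv_G)
  obtain V :: "nat \<Rightarrow> 'h set" where V0: "V 0 = O1" and V_open: "\<And>n. openin S (V n)" and V_one: "\<And>n. \<one>\<^bsub>H\<^esub> \<in> V n"
    and V_inv: "\<And>n x. x \<in> V (Suc n) \<Longrightarrow> inv\<^bsub>H\<^esub> x \<in> V (Suc n)"
    and V_mult: "\<And>n x y. x \<in> V (Suc n) \<Longrightarrow> y \<in> V (Suc n) \<Longrightarrow> x \<otimes>\<^bsub>H\<^esub> y \<in> V n"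
    by (rule topological_group_halving_sequence[OF H(1) O]) blast
  have V_sub: "V n \<subseteq> carrier H" for n using openin_subset[OF V_open] top by blast
  have V_step: "V (Suc n) \<subseteq> V n" for n
  proof
    fix x assume x: "x \<in> V (Suc n)"
    have "x \<otimes>\<^bsub>H\<^esub> \<one>\<^bsub>H\<^esub> \<in> V n" using x V_one by (rule V_mult)
    then show "x \<in> V n" using x V_sub[of "Suc n"] by (simp add: subset_iff)
  qed
  have V_anti: "V n \<subseteq> V k" if "k \<le> n" for k n
    using lift_Suc_antimono_le[of V, OF V_step that] .
  define pre where "pre n = {g \<in> Aut. h g \<in> V n}" for n
  have pre_mult: "compose X g f \<in> pre n" if "g \<in> pre (Suc n)" "f \<in> pre k" "Suc n \<le> k" for g f n k
    using that V_anti[of "Suc n" k] V_mult[of "h g" n "h f"] by (auto simp: pre_def h_compose compose_aut)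
  have pre_ainv: "ainv g \<in> pre (Suc n)" if "g \<in> pre (Suc n)" for g n
    using that V_inv[of "h g" n] by (simp add: pre_def h_ainv ainv_aut)
  obtain Q where Q: "countable Q" "Q \<subseteq> topspace S" "S closure_of Q = topspace S"
    using H(2) unfolding separable_space_def by blast
  have "Q \<noteq> {}" using Q(3) top H.one_closed by force
  define q where "q = from_nat_into Q"
  have q: "range q = Q" unfolding q_def using \<open>Q \<noteq> {}\<close> Q(1) by (rule range_from_nat_into)
  have qH: "q n \<in> carrier H" for n using q Q(2) top by blast
  \<comment> \<open>\<open>A\<^sub>n\<close> is the preimage of the translate \<open>q\<^sub>n V\<close> of a small neighbourhood\<close>
  define A where "A n = {g \<in> Aut. inv\<^bsub>H\<^esub> (q n) \<otimes>\<^bsub>H\<^esub> h g \<in> V 11}" for n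
  have cover: "Aut \<subseteq> (\<Union>n. A n)"
  proof
    fix g assume g: "g \<in> Aut"
    define N where "N = {x \<in> carrier H. inv\<^bsub>H\<^esub> h g \<otimes>\<^bsub>H\<^esub> x \<in> V 11}"
    have "openin S N" unfolding N_def using hA[OF g] V_open by (intro topological_group_translate[OF H(1)]) auto
    moreover have "h g \<in> N" using hA[OF g] V_one by (simp add: N_def)
    moreover have "h g \<in> S closure_of Q" using Q(3) hA[OF g] top by simp
    ultimately obtain s where s: "s \<in> Q" "s \<in> N" unfolding in_closure_of by blast
    then obtain n where n: "s = q n" using q by blast
    have "inv\<^bsub>H\<^esub> (inv\<^bsub>H\<^esub> h g \<otimes>\<^bsub>H\<^esub> q n) \<in> V 11"
      using s(2) V_inv[of _ 10] by (simp add: N_def n eval_nat_numeral)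
    moreover have "inv\<^bsub>H\<^esub> (inv\<^bsub>H\<^esub> h g \<otimes>\<^bsub>H\<^esub> q n) = inv\<^bsub>H\<^esub> (q n) \<otimes>\<^bsub>H\<^esub> h g"
      using hA[OF g] qH by (simp add: H.inv_mult_group)
    ultimately show "g \<in> (\<Union>n. A n)" using g by (auto simp: A_def)
  qed
  have quotient: "compose X (ainv p) r \<in> pre 10" if "p \<in> A n" "r \<in> A n" for n p r
  proof -
    have p: "p \<in> Aut" "inv\<^bsub>H\<^esub> (q n) \<otimes>\<^bsub>H\<^esub> h p \<in> V 11" and r: "r \<in> Aut" "inv\<^bsub>H\<^esub> (q n) \<otimes>\<^bsub>H\<^esub> h r \<in> V 11"
      using that by (simp_all add: A_def)
    have "inv\<^bsub>H\<^esub> (inv\<^bsub>H\<^esub> (q n) \<otimes>\<^bsub>H\<^esub> h p) \<otimes>\<^bsub>H\<^esub> (inv\<^bsub>H\<^esub> (q n) \<otimes>\<^bsub>H\<^esub> h r) \<in> V 10"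
      using V_inv[of "inv\<^bsub>H\<^esub> (q n) \<otimes>\<^bsub>H\<^esub> h p" 10] V_mult[of _ 10] p(2) r(2) by (simp add: eval_nat_numeral)
    moreover have "inv\<^bsub>H\<^esub> (inv\<^bsub>H\<^esub> (q n) \<otimes>\<^bsub>H\<^esub> h p) \<otimes>\<^bsub>H\<^esub> (inv\<^bsub>H\<^esub> (q n) \<otimes>\<^bsub>H\<^esub> h r) = inv\<^bsub>H\<^esub> h p \<otimes>\<^bsub>H\<^esub> h r"
    proof -
      have "inv\<^bsub>H\<^esub> (inv\<^bsub>H\<^esub> (q n) \<otimes>\<^bsub>H\<^esub> h p) = inv\<^bsub>H\<^esub> h p \<otimes>\<^bsub>H\<^esub> q n"
        using hA[OF p(1)] qH by (simp add: H.inv_mult_group)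
      moreover have "q n \<otimes>\<^bsub>H\<^esub> (inv\<^bsub>H\<^esub> (q n) \<otimes>\<^bsub>H\<^esub> h r) = h r"
        using hA[OF r(1)] qH[of n] by (simp add: H.m_assoc[symmetric])
      ultimately show ?thesis using hA[OF p(1)] hA[OF r(1)] qH[of n] by (simp add: H.m_assoc)
    qed
    ultimately show ?thesis
      using p(1) r(1) by (simp add: pre_def h_compose h_ainv compose_aut ainv_aut)
  qed
  have pre_sub: "pre n \<subseteq> Aut" for n by (auto simp: pre_def)
  have sixfold: "compose X (compose X (compose X (compose X (compose X u v) w) x) y) z \<in> pre 5"
    if six: "u \<in> pre 10" "v \<in> pre 10" "w \<in> pre 10" "x \<in> pre 10" "y \<in> pre 10" "z \<in> pre 10" for u v w x y z
  proof -
    have "compose X u v \<in> pre 9" by (rule pre_mult[OF _ six(2)]) (use six(1) in \<open>simp_all add: eval_nat_numeral\<close>)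
    then have "compose X (compose X u v) w \<in> pre 8" by (intro pre_mult[OF _ six(3)]) (simp_all add: eval_nat_numeral)
    then have "compose X (compose X (compose X u v) w) x \<in> pre 7" by (intro pre_mult[OF _ six(4)]) (simp_all add: eval_nat_numeral)
    then have "compose X (compose X (compose X (compose X u v) w) x) y \<in> pre 6" by (intro pre_mult[OF _ six(5)]) (simp_all add: eval_nat_numeral)
    then show ?thesis by (intro pre_mult[OF _ six(6)]) (simp_all add: eval_nat_numeral)
  qed
  have pre_ainv10: "ainv g \<in> pre 10" if "g \<in> pre 10" for g
    using pre_ainv[of g 9] that by (simp add: eval_nat_numeral)
  obtain a where a: "a \<in> lists X" "aut_fix L M a \<subseteq> pre 5"
    by (rule tuple_stabilizer_absorbed[OF complete Y lang hrushovski extension cover pre_sub pre_ainv10 quotient sixfold])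
  have A_sub: "A n \<subseteq> Aut" for n by (auto simp: A_def)
  obtain F \<epsilon> where F: "finite F" "F \<subseteq> X" "0 < \<epsilon>"
    and dense: "\<And>f F' \<epsilon>'. f \<in> near F \<epsilon> (\<lambda>x. x) \<Longrightarrow> finite F' \<Longrightarrow> F' \<subseteq> X \<Longrightarrow> 0 < \<epsilon>' \<Longrightarrow> near F' \<epsilon>' f \<inter> pre 10 \<noteq> {}"
    by (rule quotients_dense_near_identity[OF complete Y cover A_sub quotient], assumption+, rule that)
  obtain c0 where c0: "set c0 = F" using F(1) finite_list by blast
  \<comment> \<open>\<open>c\<close> controls both the stabiliser and the neighbourhood in which \<open>pre 10\<close> is dense\<close>
  define c where "c = a @ c0"
  have c: "c \<in> lists X" using a(1) c0 F(2) by (auto simp: c_def)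
  obtain b \<eta> where b: "b \<in> \<B>" "0 < \<eta>" "aut_fix L M b \<subseteq> aut_fix L M c" "aut_nbhd L M m b \<eta> \<subseteq> aut_nbhd L M m c \<epsilon>"
    using basis c F(3) unfolding aut_basis_def by blast
  have bX: "b \<in> lists X"
    using basis b(1) unfolding aut_basis_def by (auto simp: nlists_def)
  have fix_b: "aut_fix L M b \<subseteq> pre 5"
    using b(3) a(2) by (force simp: aut_fix_def c_def)
  define P where "P = {(g, f) \<in> aut_nbhd L M m b \<eta> \<times> Aut.
                orbit_over L M b (map g b) \<inter> orbit_over L M (map f b) b \<noteq> {}}"
  have "prod_topology T T interior_of P \<noteq> {}" unfolding P_def by (rule interior[OF b(1,2)])
  then obtain g0 f0 where gf: "(g0, f0) \<in> prod_topology T T interior_of P" by auto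
  have "openin (prod_topology T T) (prod_topology T T interior_of P)" by simp
  from this[unfolded openin_prod_topology_alt, rule_format, OF gf]
  obtain U1 U2 where U: "openin T U1" "openin T U2" "g0 \<in> U1" "f0 \<in> U2"
    "U1 \<times> U2 \<subseteq> prod_topology T T interior_of P"
    by blast
  have UP: "(g, f) \<in> P" if "g \<in> U1" "f \<in> U2" for g f
    using subset_trans[OF U(5) interior_of_subset] that by (auto dest: subsetD)
  obtain F1 \<epsilon>1 where F1: "finite F1" "F1 \<subseteq> X" "0 < \<epsilon>1" "near F1 \<epsilon>1 g0 \<subseteq> U1"
    by (rule openin_T_near[OF U(1,3)])
  obtain F2 \<epsilon>2 where F2: "finite F2" "F2 \<subseteq> X" "0 < \<epsilon>2" "near F2 \<epsilon>2 f0 \<subseteq> U2"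
    by (rule openin_T_near[OF U(2,4)])
  have gf0: "g0 \<in> aut_nbhd L M m b \<eta>" "f0 \<in> Aut" using UP[OF U(3,4)] by (simp_all add: P_def)
  have "g0 \<in> near F \<epsilon> (\<lambda>x. x)"
  proof -
    have "g0 \<in> near (set c) \<epsilon> (\<lambda>x. x)" using gf0(1) b(4) aut_nbhd_eq_near[OF F(3)] by blast
    then show ?thesis using c0 by (simp add: near_def c_def)
  qed
  from dense[OF this F1(1-3)] obtain g where g: "g \<in> near F1 \<epsilon>1 g0" "g \<in> pre 10" by blast
  have gA: "g \<in> Aut" and g5: "h g \<in> V 5" using g(2) V_anti[of 5 10] by (auto simp: pre_def)
  have key: "h f \<in> V 1" if f: "f \<in> near F2 \<epsilon>2 f0" for f
  proof -
    have fA: "f \<in> Aut" using f by (simp add: near_def)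
    have "(g, f) \<in> P" using subsetD[OF F1(4) g(1)] subsetD[OF F2(4) f] by (rule UP)
    then have "orbit_over L M b (map g b) \<inter> orbit_over L M (map f b) b \<noteq> {}" by (simp add: P_def)
    then obtain x y z where xyz: "x \<in> aut_fix L M b" "y \<in> aut_fix L M b" "z \<in> aut_fix L M b"
      "f = y \<otimes>\<^bsub>G\<^esub> (g \<otimes>\<^bsub>G\<^esub> x \<otimes>\<^bsub>G\<^esub> inv\<^bsub>G\<^esub> g) \<otimes>\<^bsub>G\<^esub> z"
      by (rule orbit_meet_factorization[OF gA fA bX])
    have in5: "x \<in> Aut" "y \<in> Aut" "z \<in> Aut" "h x \<in> V 5" "h y \<in> V 5" "h z \<in> V 5"
      using xyz(1-3) fix_b by (auto simp: pre_def)
    have hf: "h f = h y \<otimes>\<^bsub>H\<^esub> (h g \<otimes>\<^bsub>H\<^esub> h x \<otimes>\<^bsub>H\<^esub> inv\<^bsub>H\<^esub> h g) \<otimes>\<^bsub>H\<^esub> h z"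
      unfolding xyz(4) using in5(1-3) gA h.G.inv_closed[of g] h.G.m_closed h.hom_mult h.hom_inv[of g] by simp
    have "h g \<otimes>\<^bsub>H\<^esub> h x \<in> V 4" using V_mult[of "h g" 4 "h x"] g5 in5(4) by (simp add: eval_nat_numeral)
    moreover have "inv\<^bsub>H\<^esub> h g \<in> V 4" using V_inv[of "h g" 4] g5 V_anti[of 4 5] by (auto simp: eval_nat_numeral)
    ultimately have "h g \<otimes>\<^bsub>H\<^esub> h x \<otimes>\<^bsub>H\<^esub> inv\<^bsub>H\<^esub> h g \<in> V 3" using V_mult[of _ 3] by (simp add: eval_nat_numeral)
    moreover have "h y \<in> V 3" "h z \<in> V 2" using in5(5,6) V_anti[of 3 5] V_anti[of 2 5] by auto
    ultimately show ?thesis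
      unfolding hf using V_mult[of _ 2] V_mult[of _ 1] by (simp add: eval_nat_numeral)
  qed
  show ?thesis
  proof (rule that[OF F2(1-3)])
    fix f assume f: "f \<in> near F2 \<epsilon>2 (\<lambda>x. x)"
    have fA: "f \<in> Aut" using f by (simp add: near_def)
    have 1: "h f0 \<in> V 1" by (rule key[OF near_self[OF gf0(2) F2(2,3)]])
    have "h (compose X f0 f) \<in> V 1" by (rule key[OF near_compose_id[OF gf0(2) f F2(2)]])
    then have "inv\<^bsub>H\<^esub> h f0 \<otimes>\<^bsub>H\<^esub> (h f0 \<otimes>\<^bsub>H\<^esub> h f) \<in> V 0"
      using V_mult[of _ 0] V_inv[of _ 0] 1 gf0(2) fA by (simp add: h_compose)
    then show "h f \<in> O1"
      using hA[OF gf0(2)] hA[OF fA] V0 by (simp add: H.m_assoc[symmetric])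
  qed
qed

end

theorem corollary59:
  fixes L :: "('f, 'r) fo_language"
    and M :: "('f, 'r, 'a) fo_struct"
    and m :: "'a metric"
    and \<B> :: "'a list set"
  assumes "contains_dist L"
    and "countable_language L"
    and "metric_structure L M m"
    and "separable_space (mtopology_of m)"
    and "mcomplete_of m"
    and "extension_property L M"
    and "hrushovski_property L M"
    and "aut_basis L M m \<B>"
    and "\<And>a \<epsilon>. a \<in> \<B> \<Longrightarrow> \<epsilon> > 0 \<Longrightarrow>
           prod_topology (aut_topology L M m) (aut_topology L M m) interior_of
             {(g, f) \<in> aut_nbhd L M m a \<epsilon> \<times> aut L M.
                orbit_over L M a (map g a) \<inter> orbit_over L M (map f a) a \<noteq> {}} \<noteq> {}"
  shows "automatic_continuity TYPE('h) (aut_group L M) (aut_topology L M m)"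
proof -
  interpret metric_fo_structure L M m using assms(1,3) by unfold_locales
  have complete: mcomplete using assms(5) by (simp add: mcomplete_of_def mspace_eq)
  obtain Y where Y: "countable Y" "Y \<subseteq> X" "mtopology closure_of Y = X"
    using assms(4) unfolding separable_space_def by (auto simp: mtopology_of_eq)
  have dense: "dense_in_X Y"
    unfolding dense_in_X_def
  proof (intro conjI ballI allI impI)
    fix x and \<epsilon> :: real assume "x \<in> X" "0 < \<epsilon>"
    then have "x \<in> mtopology closure_of Y" using Y(3) by simp
    then show "\<exists>y\<in>Y. d x y < \<epsilon>" using \<open>0 < \<epsilon>\<close> unfolding metric_closure_of by auto
  qed (rule Y(2))
  show ?thesis
    unfolding automatic_continuity_def
  proof (intro allI impI, elim conjE)
    fix H :: "'h monoid" and S h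
    assume H: "polish_group H S" and h: "h \<in> hom G H"
    have tg: "topological_group H S" and sep: "separable_space S" using H by (simp_all add: polish_group_def)
    then have H_group: "group H" and top: "topspace S = carrier H" by (simp_all add: topological_group_def)
    interpret H: group H by (rule H_group)
    have hA: "h g \<in> carrier H" if "g \<in> Aut" for g using hom_in_carrier[OF h] that by simp
    show "continuous_map T S h"
      unfolding continuous_map_def
    proof (intro conjI allI impI)
      show "h \<in> topspace T \<rightarrow> topspace S" using hA top by simp
      fix V assume V: "openin S V"
      show "openin T {g \<in> topspace T. h g \<in> V}"
        unfolding openin_subopen[of T "{g \<in> topspace T. h g \<in> V}"]
      proof
        fix g assume "g \<in> {g \<in> topspace T. h g \<in> V}"
        then have g: "g \<in> Aut" "h g \<in> V" by auto
        define V' where "V' = {x \<in> carrier H. h g \<otimes>\<^bsub>H\<^esub> x \<in> V}"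
        have V': "openin S V'" "\<one>\<^bsub>H\<^esub> \<in> V'"
          unfolding V'_def using topological_group_translate[OF tg hA[OF g(1)] V] g hA[OF g(1)] by simp_all
        obtain F \<epsilon> where F: "finite F" "F \<subseteq> X" "0 < \<epsilon>" "\<And>f. f \<in> near F \<epsilon> (\<lambda>x. x) \<Longrightarrow> h f \<in> V'"
          by (rule continuous_at_identity[OF complete dense Y(1) assms(2,7,6,8,9) tg sep h V']) blast+
        have "h f \<in> V" if f: "f \<in> near F \<epsilon> g" for f
        proof -
          have fA: "f \<in> Aut" using f by (simp add: near_def)
          have "h g \<otimes>\<^bsub>H\<^esub> h (compose X (ainv g) f) \<in> V"
            using F(4)[OF near_ainv_compose[OF g(1) f F(2)]] by (simp add: V'_def)
          moreover have "h g \<otimes>\<^bsub>H\<^esub> h (compose X (ainv g) f) = h (compose X g (compose X (ainv g) f))"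
          proof -
            have c: "compose X (ainv g) f \<in> Aut" by (intro compose_aut ainv_aut g(1) fA)
            show ?thesis using hom_mult[OF h, of g "compose X (ainv g) f"] g(1) c by (simp add: mult_G)
          qed
          moreover have "compose X g (compose X (ainv g) f) = f"
          proof (rule aut_ext[OF _ fA])
            show "compose X g (compose X (ainv g) f) \<in> Aut" by (intro compose_aut ainv_aut g(1) fA)
            show "compose X g (compose X (ainv g) f) x = f x" if "x \<in> X" for x
              using that ainv_right[OF g(1)] aut_in[OF fA] by (simp add: compose_def)
          qed
          ultimately show ?thesis by simp
        qed
        then have "near F \<epsilon> g \<subseteq> {g \<in> topspace T. h g \<in> V}" by (auto simp: near_def)
        then show "\<exists>W. openin T W \<and> g \<in> W \<and> W \<subseteq> {g \<in> topspace T. h g \<in> V}"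
          using openin_near[OF F(1,2) g(1)] near_self[OF g(1) F(2,3)] by blast
      qed
    qed
  qed
qed

end
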